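(* Let $P_\bullet$, $Q_\bullet$, $R_\bullet$ be reduced expressions expressing double cosets $p$, $q$, $r$ respectively, composable in the sense that $P_\bullet\circ Q_\bullet\circ R_\bullet$ is defined, and suppose that $P_\bullet\circ Q_\bullet\circ R_\bullet$ is a reduced expression (expressing the reduced composition $p.q.r$). Then $$\mathrm{id}_{\mathrm{BS}(P_\bullet)}\otimes \mathrm{End}_{<q}(\mathrm{BS}(Q_\bullet))\otimes \mathrm{id}_{\mathrm{BS}(R_\bullet)}\subset \mathrm{End}_{<p.q.r}(\mathrm{BS}(P_\bullet\circ Q_\bullet\circ R_\bullet)).$$
   Context: Cosets. $(W,S)$ is a Coxeter system with length function $\ell$. For $I\subset S$, $W_I$ is the subgroup generated by $I$; $I$ is finitary if $W_I$ is finite, and then $w_I$ is its longest element and $\ell(I):=\ell(w_I)$. The $*$-product on $W$ is the associative monoid product determined by $s*w=sw$ if $sw>w$ and $s*w=w$ if $sw<w$ ($s\in S$, $w\in W$). For finitary $I,J$, an $(I,J)$-coset is an element $p\in W_I\backslash W/W_J$ (regarded as a triple $(p,I,J)$), with maximal and minimal elements $\overline p,\underline p$; $p\le q$ means $\underline p\le\underline q$ in Bruhat order. Expressions. A (singlestep) expression is a sequence $I_\bullet=[I_0,\dots,I_d]$ of finitary subsets of $S$, consecutive ones differing by adding or removing one element. It expresses the unique $(I_0,I_d)$-coset $q$ with $\overline q=w_{I_0}*\cdots*w_{I_d}$. Recording local maxima and minima gives $I_0=L_0\subset K_1\supset L_1\subset\cdots\subset K_m\supset L_m=I_d$ (with $L_0=K_1$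 if $I_\bullet$ starts by decreasing and $K_m=L_m$ if it ends by increasing); $I_\bullet$ is reduced if $\overline q=(w_{K_1}w_{L_1}^{-1})\cdots(w_{K_{m-1}}w_{L_{m-1}}^{-1})w_{K_m}$ with lengths of the factors adding up to $\ell(\overline q)$. Expressions with matching end and start are concatenated: $[P_0,\dots,P_c]\circ[Q_0,\dots,Q_d]=[P_0,\dots,P_c=Q_0,\dots,Q_d]$. If $P_\bullet\circ Q_\bullet\circ R_\bullet$ is reduced, $p.q.r$ denotes the coset it expresses. Realization. $V$ is a realization of $(W,S)$ over a field $\Bbbk$: a finite-dimensional $\Bbbk$-vector space with $\alpha_s^\vee\in V$, $\alpha_s\in V^*$ ($s\in S$), $\langle\alpha_s^\vee,\alpha_s\rangle=2$, such that $s(v)=v-\alpha_s(v)\alpha_s^\vee$ defines a representation of $W$, with the standard Elias–Williamson technical condition that the two-coloured quantum numbers $[m_{st}]_s,[m_{st}]_t$ vanish when $m_{st}<\infty$ (defined by $[0]=0$, $[1]=1$, $[2]_s=-\langle\alpha_s^\vee,\alpha_t\rangle$, $[2]_t=-\langle\alpha_t^\vee,\alpha_s\rangle$, $[2]_s[n]_t=[n+1]_s+[n-1]_s$ and symmetrically). It is assumed balanced ($[m_{st}-1]_s=[m_{st}-1]_t=1$ for $m_{st}<\infty$), reflection faithful ($W$ acts faithfully, and $x\in W$ fixes a codimension one subspace exactly when it is conjugate to an element of $S$) and to satisfy generalized Demazure surjectivity (for each finitary $I$ the Demazure operator $\partial_{w_I}:R\to R^I$, composed from $\partial_s(f)=(f-sf)/\alpha_s$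 along a reduced word of $w_I$, is surjective). $R=\mathrm{Sym}(V^* )$ is graded with $V^*$ in degree 2, and $R^I$ is the subring of $W_I$-invariants. Bimodules. $M(i)$ is the grading shift with $M(i)^j=M^{i+j}$. For $I\subset J$ finitary, $\mathrm{BS}([I,J])=R^I$ as $(R^I,R^J)$-bimodule and $\mathrm{BS}([J,I])=R^I(\ell(J)-\ell(I))$ as $(R^J,R^I)$-bimodule; $\mathrm{BS}([I])=R^I$, and $\mathrm{BS}(I_\bullet)=\mathrm{BS}([I_0,I_1])\otimes_{R^{I_1}}\cdots\otimes_{R^{I_{d-1}}}\mathrm{BS}([I_{d-1},I_d])$. Thus $\mathrm{BS}(P_\bullet\circ Q_\bullet\circ R_\bullet)$ is the tensor product $\mathrm{BS}(P_\bullet)\otimes\mathrm{BS}(Q_\bullet)\otimes\mathrm{BS}(R_\bullet)$ over the intermediate invariant rings. $\mathrm{Hom}(M,N)=\bigoplus_{i\in\mathbb Z}\mathrm{Hom}^i(M,N)$, where $\mathrm{Hom}^i(M,N)$ is the space of degree zero bimodule maps $M\to N(i)$; $\mathrm{End}(M)=\mathrm{Hom}(M,M)$. Lower terms. For a downward-closed set $C$ of $(I,J)$-cosets, $\mathrm{Hom}_C$ is the two-sided ideal in the category of graded $(R^I,R^J)$-bimodules generated by the identity maps of $\mathrm{BS}(M_\bullet)$ for all expressions $M_\bullet$ expressing some $q\in C$; i.e. it consists of finite sums of morphisms each factoring through such a $\mathrm{BS}(M_\bullet)$. $\mathrm{Hom}_{<p}$ is $\mathrm{Hom}_C$ for $C=\{q\mid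 q<p\}$, and $\mathrm{End}_{<p}(B)=\mathrm{Hom}_{<p}(B,B)$. *)

theory Defs
  imports "HOL-Algebra.Algebra" "HOL-Library.Poly_Mapping"
begin

section \<open>Coxeter systems\<close>

record 'w coxeter = "'w monoid" +
  gens :: "'w set"

definition word_prod :: "('w, 'x) monoid_scheme \<Rightarrow> 'w list \<Rightarrow> 'w" where
  "word_prod G ss = foldr (\<lambda>s x. s \<otimes>\<^bsub>G\<^esub> x) ss \<one>\<^bsub>G\<^esub>"

text \<open>The order of \<^term>\<open>s \<otimes>\<^bsub>C\<^esub> t\<close> in the group; the value 0 stands for \<open>\<infinity>\<close>
  (the convention of \<^const>\<open>group.ord\<close>).\<close>

definition cox_m :: "('w, 'x) monoid_scheme \<Rightarrow> 'w \<Rightarrow> 'w \<Rightarrow> nat" where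
  "cox_m C s t = group.ord C (s \<otimes>\<^bsub>C\<^esub> t)"

text \<open>The congruence on words in the generators that is generated by the Coxeter relations
  \<open>(st)\<^sup>m = 1\<close>, \<open>m = cox_m C s t < \<infinity>\<close>. The case \<open>s = t\<close> is the relation \<open>s\<^sup>2 = 1\<close>.\<close>

inductive cox_equiv :: "('w, 'x) coxeter_scheme \<Rightarrow> 'w list \<Rightarrow> 'w list \<Rightarrow> bool"
  for C :: "('w, 'x) coxeter_scheme" where
  relation: "\<lbrakk>u \<in> lists (gens C); v \<in> lists (gens C); s \<in> gens C; t \<in> gens C; cox_m C s t > 0\<rbrakk>
    \<Longrightarrow> cox_equiv C (u @ concat (replicate (cox_m C s t) [s, t]) @ v) (u @ v)"
| refl: "u \<in> lists (gens C) \<Longrightarrow> cox_equiv C u u"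
| sym: "cox_equiv C u v \<Longrightarrow> cox_equiv C v u"
| trans: "\<lbrakk>cox_equiv C u v; cox_equiv C v w\<rbrakk> \<Longrightarrow> cox_equiv C u w"

text \<open>The last clause says that the relations above already present the group.\<close>

definition coxeter_system :: "('w, 'x) coxeter_scheme \<Rightarrow> bool" where
  "coxeter_system C \<longleftrightarrow>
     group C \<and> gens C \<subseteq> carrier C \<and> generate C (gens C) = carrier C \<and>
     (\<forall>s \<in> gens C. s \<noteq> \<one>\<^bsub>C\<^esub> \<and> s \<otimes>\<^bsub>C\<^esub> s = \<one>\<^bsub>C\<^esub>) \<and>
     (\<forall>u \<in> lists (gens C). \<forall>v \<in> lists (gens C).
        word_prod C u = word_prod C v \<longrightarrow> cox_equiv C u v)"

definition len :: "('w, 'x) coxeter_scheme \<Rightarrow> 'w \<Rightarrow> nat" where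
  "len C w = (LEAST n. \<exists>ss \<in> lists (gens C). length ss = n \<and> word_prod C ss = w)"

definition reduced_word :: "('w, 'x) coxeter_scheme \<Rightarrow> 'w list \<Rightarrow> 'w \<Rightarrow> bool" where
  "reduced_word C ss w \<longleftrightarrow>
     ss \<in> lists (gens C) \<and> word_prod C ss = w \<and> length ss = len C w"

definition some_reduced_word :: "('w, 'x) coxeter_scheme \<Rightarrow> 'w \<Rightarrow> 'w list" where
  "some_reduced_word C w = (SOME ss. reduced_word C ss w)"

definition reflections :: "('w, 'x) coxeter_scheme \<Rightarrow> 'w set" where
  "reflections C = {x \<otimes>\<^bsub>C\<^esub> s \<otimes>\<^bsub>C\<^esub> inv\<^bsub>C\<^esub> x | x s. x \<in> carrier C \<and> s \<in> gens C}"

definition bruhat_le :: "('w, 'x) coxeter_scheme \<Rightarrow> 'w \<Rightarrow> 'w \<Rightarrow> bool" where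
  "bruhat_le C = (\<lambda>x y. \<exists>t \<in> reflections C. y = x \<otimes>\<^bsub>C\<^esub> t \<and> len C x < len C y)\<^sup>*\<^sup>*"

definition bruhat_less :: "('w, 'x) coxeter_scheme \<Rightarrow> 'w \<Rightarrow> 'w \<Rightarrow> bool" where
  "bruhat_less C x y \<longleftrightarrow> bruhat_le C x y \<and> x \<noteq> y"

text \<open>By associativity, \<open>x * y\<close> is obtained by letting the letters of any reduced word of
  \<open>x\<close> act successively on \<open>y\<close>.\<close>

definition star_gen :: "('w, 'x) coxeter_scheme \<Rightarrow> 'w \<Rightarrow> 'w \<Rightarrow> 'w" where
  "star_gen C s w = (if bruhat_less C w (s \<otimes>\<^bsub>C\<^esub> w) then s \<otimes>\<^bsub>C\<^esub> w else w)"

definition star :: "('w, 'x) coxeter_scheme \<Rightarrow> 'w \<Rightarrow> 'w \<Rightarrow> 'w" where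
  "star C x y = foldr (star_gen C) (some_reduced_word C x) y"

definition star_list :: "('w, 'x) coxeter_scheme \<Rightarrow> 'w list \<Rightarrow> 'w" where
  "star_list C xs = foldr (star C) xs \<one>\<^bsub>C\<^esub>"

definition finitary :: "('w, 'x) coxeter_scheme \<Rightarrow> 'w set \<Rightarrow> bool" where
  "finitary C I \<longleftrightarrow> I \<subseteq> gens C \<and> finite (generate C I)"

definition longest :: "('w, 'x) coxeter_scheme \<Rightarrow> 'w set \<Rightarrow> 'w" where
  "longest C I = (THE x. x \<in> generate C I \<and> (\<forall>y \<in> generate C I. len C y \<le> len C x))"

definition ell :: "('w, 'x) coxeter_scheme \<Rightarrow> 'w set \<Rightarrow> nat" where
  "ell C I = len C (longest C I)"


section \<open>Double cosets and singlestep expressions\<close>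

text \<open>A coset is a triple \<open>(p, I, J)\<close> whose first component is the underlying set.\<close>

type_synonym 'w coset = "'w set \<times> 'w set \<times> 'w set"

fun is_coset :: "('w, 'x) coxeter_scheme \<Rightarrow> 'w coset \<Rightarrow> bool" where
  "is_coset C (p, I, J) \<longleftrightarrow> finitary C I \<and> finitary C J \<and>
     (\<exists>x \<in> carrier C. p = (generate C I #>\<^bsub>C\<^esub> x) <#>\<^bsub>C\<^esub> generate C J)"

definition max_elt :: "('w, 'x) coxeter_scheme \<Rightarrow> 'w coset \<Rightarrow> 'w" where
  "max_elt C p = (THE x. x \<in> fst p \<and> (\<forall>y \<in> fst p. bruhat_le C y x))"

definition min_elt :: "('w, 'x) coxeter_scheme \<Rightarrow> 'w coset \<Rightarrow> 'w" where
  "min_elt C p = (THE x. x \<in> fst p \<and> (\<forall>y \<in> fst p. bruhat_le C x y))"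

definition coset_le :: "('w, 'x) coxeter_scheme \<Rightarrow> 'w coset \<Rightarrow> 'w coset \<Rightarrow> bool" where
  "coset_le C p q \<longleftrightarrow> is_coset C p \<and> is_coset C q \<and> snd p = snd q \<and>
     bruhat_le C (min_elt C p) (min_elt C q)"

definition coset_less :: "('w, 'x) coxeter_scheme \<Rightarrow> 'w coset \<Rightarrow> 'w coset \<Rightarrow> bool" where
  "coset_less C p q \<longleftrightarrow> coset_le C p q \<and> p \<noteq> q"

definition expression :: "('w, 'x) coxeter_scheme \<Rightarrow> 'w set list \<Rightarrow> bool" where
  "expression C Is \<longleftrightarrow> Is \<noteq> [] \<and> (\<forall>I \<in> set Is. finitary C I) \<and>
     successively (\<lambda>I J. (\<exists>s. s \<notin> I \<and> J = insert s I) \<or> (\<exists>s. s \<notin> J \<and> I = insert s J)) Is"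

definition expresses :: "('w, 'x) coxeter_scheme \<Rightarrow> 'w set list \<Rightarrow> 'w coset \<Rightarrow> bool" where
  "expresses C Is q \<longleftrightarrow> expression C Is \<and> is_coset C q \<and>
     snd q = (hd Is, last Is) \<and> max_elt C q = star_list C (map (longest C) Is)"

text \<open>\<open>turns_up\<close> lists the turning points \<open>[K\<^sub>1, L\<^sub>1, \<dots>, K\<^sub>m, L\<^sub>m]\<close> of an expression. It reads
  an increasing stretch and \<open>turns_down\<close> a decreasing one, and an expression is read starting with
  an increasing stretch, possibly of length 0; so an initial decreasing step gives
  \<open>K\<^sub>1 = L\<^sub>0 = I\<^sub>0\<close>, and a final increasing stretch gives \<open>K\<^sub>m = L\<^sub>m = I\<^sub>d\<close>.\<close>

fun turns_up :: "'w set list \<Rightarrow> 'w set list" and turns_down :: "'w set list \<Rightarrow> 'w set list" where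
  "turns_up [] = []"
| "turns_up [I] = [I, I]"
| "turns_up (I # J # Is) = (if I \<subset> J then turns_up (J # Is) else I # turns_down (J # Is))"
| "turns_down [] = []"
| "turns_down [I] = [I]"
| "turns_down (I # J # Is) = (if J \<subset> I then turns_down (J # Is) else I # turns_up (J # Is))"

fun turn_factors :: "('w, 'x) coxeter_scheme \<Rightarrow> 'w set list \<Rightarrow> 'w list" where
  "turn_factors C [K, L] = [longest C K]"
| "turn_factors C (K # L # Ks) = (longest C K \<otimes>\<^bsub>C\<^esub> inv\<^bsub>C\<^esub> (longest C L)) # turn_factors C Ks"
| "turn_factors C Ks = []"

definition reduced_expr :: "('w, 'x) coxeter_scheme \<Rightarrow> 'w set list \<Rightarrow> bool" where
  "reduced_expr C Is \<longleftrightarrow> (\<exists>q. expresses C Is q \<and>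
     max_elt C q = word_prod C (turn_factors C (turns_up Is)) \<and>
     len C (max_elt C q) = sum_list (map (len C) (turn_factors C (turns_up Is))))"

definition composable :: "'w set list \<Rightarrow> 'w set list \<Rightarrow> bool" where
  "composable Ps Qs \<longleftrightarrow> last Ps = hd Qs"

definition expr_comp :: "'w set list \<Rightarrow> 'w set list \<Rightarrow> 'w set list" (infixr \<open>\<circ>\<^sub>e\<close> 65) where
  "Ps \<circ>\<^sub>e Qs = Ps @ tl Qs"


section \<open>Realizations\<close>

text \<open>\<open>bas\<close> is a basis of \<open>V\<close>, used only to write \<open>Sym(V*)\<close> as a polynomial ring; \<open>vact\<close> is the
  action of the group on \<open>V\<close>, determined by its values on the generators.\<close>

record ('w, 'v, 'k) realization_data = "'w coxeter" +
  scl :: "'k \<Rightarrow> 'v \<Rightarrow> 'v"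
  bas :: "'v set"
  root :: "'w \<Rightarrow> 'v \<Rightarrow> 'k"
  coroot :: "'w \<Rightarrow> 'v"
  vact :: "'w \<Rightarrow> 'v \<Rightarrow> 'v"

text \<open>Two-coloured quantum numbers: if \<open>x = [2]\<^sub>s\<close> and \<open>y = [2]\<^sub>t\<close>, then \<open>qnum x y n = [n]\<^sub>s\<close>
  and \<open>qnum y x n = [n]\<^sub>t\<close>.\<close>

fun qnum :: "'k::comm_ring_1 \<Rightarrow> 'k \<Rightarrow> nat \<Rightarrow> 'k" where
  "qnum x y 0 = 0"
| "qnum x y (Suc 0) = 1"
| "qnum x y (Suc (Suc n)) = x * qnum y x (Suc n) - qnum x y n"

definition quantum :: "('w, 'v, 'k::field) realization_data \<Rightarrow> 'w \<Rightarrow> 'w \<Rightarrow> nat \<Rightarrow> 'k" where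
  "quantum H s t n = qnum (- root H t (coroot H s)) (- root H s (coroot H t)) n"

definition is_realization :: "('w, 'v::ab_group_add, 'k::field) realization_data \<Rightarrow> bool" where
  "is_realization H \<longleftrightarrow>
     coxeter_system H \<and>
     finite_dimensional_vector_space (scl H) (bas H) \<and>
     (\<forall>s \<in> gens H. Vector_Spaces.linear (scl H) (*) (root H s)) \<and>
     (\<forall>s \<in> gens H. root H s (coroot H s) = 2) \<and>
     (\<forall>v. vact H \<one>\<^bsub>H\<^esub> v = v) \<and>
     (\<forall>x \<in> carrier H. \<forall>y \<in> carrier H. \<forall>v. vact H (x \<otimes>\<^bsub>H\<^esub> y) v = vact H x (vact H y v)) \<and>
     (\<forall>s \<in> gens H. \<forall>v. vact H s v = v - scl H (root H s v) (coroot H s)) \<and>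
     (\<forall>s \<in> gens H. \<forall>t \<in> gens H. s \<noteq> t \<and> cox_m H s t > 0 \<longrightarrow>
        quantum H s t (cox_m H s t) = 0 \<and> quantum H t s (cox_m H s t) = 0)"

definition balanced :: "('w, 'v, 'k::field) realization_data \<Rightarrow> bool" where
  "balanced H \<longleftrightarrow> (\<forall>s \<in> gens H. \<forall>t \<in> gens H. s \<noteq> t \<and> cox_m H s t > 0 \<longrightarrow>
     quantum H s t (cox_m H s t - 1) = 1 \<and> quantum H t s (cox_m H s t - 1) = 1)"

definition reflection_faithful :: "('w, 'v::ab_group_add, 'k::field) realization_data \<Rightarrow> bool" where
  "reflection_faithful H \<longleftrightarrow> inj_on (vact H) (carrier H) \<and>
     (\<forall>x \<in> carrier H.
        vector_space.dim (scl H) {v. vact H x v = v} + 1 = vector_space.dim (scl H) UNIV \<longleftrightarrow>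
        x \<in> reflections H)"


subsection \<open>The polynomial ring and Demazure operators\<close>

text \<open>Multivariate polynomials; \<open>Sym(V*)\<close> is the subring of polynomials in the variables \<open>bas H\<close>,
  the variable \<open>b\<close> being the coordinate functional dual to the basis vector \<open>b\<close>.\<close>

type_synonym ('v, 'k) mpoly = "('v \<Rightarrow>\<^sub>0 nat) \<Rightarrow>\<^sub>0 'k"

definition Sym :: "('w, 'v, 'k::field) realization_data \<Rightarrow> ('v, 'k) mpoly set" where
  "Sym H = {f. \<forall>m \<in> Poly_Mapping.keys f. Poly_Mapping.keys m \<subseteq> bas H}"

definition coord :: "('w, 'v::ab_group_add, 'k::field) realization_data \<Rightarrow> 'v \<Rightarrow> 'v \<Rightarrow> 'k" where
  "coord H b v = module.representation (scl H) (bas H) v b"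

text \<open>The inclusion of \<open>V*\<close> into \<open>Sym(V*)\<close>.\<close>

definition lin_poly :: "('w, 'v, 'k::field) realization_data \<Rightarrow> ('v \<Rightarrow> 'k) \<Rightarrow> ('v, 'k) mpoly" where
  "lin_poly H \<phi> = (\<Sum>b \<in> bas H. Poly_Mapping.single (Poly_Mapping.single b 1) (\<phi> b))"

text \<open>The algebra automorphism extending \<open>\<phi> \<mapsto> \<phi> \<circ> w\<^sup>-\<^sup>1\<close> on \<open>V*\<close>.\<close>

definition pact :: "('w, 'v::ab_group_add, 'k::field) realization_data \<Rightarrow> 'w \<Rightarrow>
    ('v, 'k) mpoly \<Rightarrow> ('v, 'k) mpoly" where
  "pact H w f = (\<Sum>m \<in> Poly_Mapping.keys f. Poly_Mapping.single 0 (Poly_Mapping.lookup f m) *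
     (\<Prod>b \<in> Poly_Mapping.keys m.
        lin_poly H (\<lambda>v. coord H b (vact H (inv\<^bsub>H\<^esub> w) v)) ^ Poly_Mapping.lookup m b))"

definition Sym_inv :: "('w, 'v::ab_group_add, 'k::field) realization_data \<Rightarrow> 'w set \<Rightarrow>
    ('v, 'k) mpoly set" where
  "Sym_inv H I = {f \<in> Sym H. \<forall>w \<in> generate H I. pact H w f = f}"

text \<open>The homogeneous elements of degree \<open>n\<close>, where \<open>V*\<close> is in degree 2.\<close>

definition Sym_deg :: "('w, 'v, 'k::field) realization_data \<Rightarrow> int \<Rightarrow> ('v, 'k) mpoly set" where
  "Sym_deg H n = {f \<in> Sym H. \<forall>m \<in> Poly_Mapping.keys f.
     int (2 * (\<Sum>b \<in> Poly_Mapping.keys m. Poly_Mapping.lookup m b)) = n}"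

definition demazure_gen :: "('w, 'v::ab_group_add, 'k::field) realization_data \<Rightarrow> 'w \<Rightarrow>
    ('v, 'k) mpoly \<Rightarrow> ('v, 'k) mpoly" where
  "demazure_gen H s f = (THE g. g \<in> Sym H \<and> lin_poly H (root H s) * g = f - pact H s f)"

definition demazure :: "('w, 'v::ab_group_add, 'k::field) realization_data \<Rightarrow> 'w \<Rightarrow>
    ('v, 'k) mpoly \<Rightarrow> ('v, 'k) mpoly" where
  "demazure H w f = foldr (demazure_gen H) (some_reduced_word H w) f"

definition demazure_surjective :: "('w, 'v::ab_group_add, 'k::field) realization_data \<Rightarrow> bool" where
  "demazure_surjective H \<longleftrightarrow>
     (\<forall>I. finitary H I \<longrightarrow> demazure H (longest H I) ` Sym H = Sym_inv H I)"


section \<open>Graded bimodules\<close>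

text \<open>The underlying abelian group is written multiplicatively, as for
  \<^const>\<open>free_Abelian_group\<close>. \<open>gpart M n\<close> is the homogeneous part of degree \<open>n\<close>.\<close>

record ('r, 'm) gr_bimodule = "'m monoid" +
  lact :: "'r \<Rightarrow> 'm \<Rightarrow> 'm"
  ract :: "'m \<Rightarrow> 'r \<Rightarrow> 'm"
  gpart :: "int \<Rightarrow> 'm set"

text \<open>\<open>Hom\<^sup>i(M, N)\<close> for \<open>(A, B)\<close>-bimodules. Maps are normalised to be
  \<^const>\<open>undefined\<close> outside the source.\<close>

definition Hom_deg :: "'r set \<Rightarrow> 'r set \<Rightarrow> int \<Rightarrow> ('r, 'm) gr_bimodule \<Rightarrow> ('r, 'n) gr_bimodule \<Rightarrow>
    ('m \<Rightarrow> 'n) set" where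
  "Hom_deg A B i M N = {f \<in> hom M N \<inter> extensional (carrier M).
     (\<forall>a \<in> A. \<forall>x \<in> carrier M. f (lact M a x) = lact N a (f x)) \<and>
     (\<forall>b \<in> B. \<forall>x \<in> carrier M. f (ract M x b) = ract N (f x) b) \<and>
     (\<forall>n. f ` gpart M n \<subseteq> gpart N (n + i))}"

definition Hom :: "'r set \<Rightarrow> 'r set \<Rightarrow> ('r, 'm) gr_bimodule \<Rightarrow> ('r, 'n) gr_bimodule \<Rightarrow>
    ('m \<Rightarrow> 'n) set" where
  "Hom A B M N = {\<lambda>x \<in> carrier M. finprod N (\<lambda>i. \<phi> i x) F | F \<phi>.
     finite F \<and> (\<forall>i \<in> F. \<phi> i \<in> Hom_deg A B i M N)}"


subsection \<open>Bott--Samelson bimodules\<close>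

text \<open>The tensor factors of \<open>BS(I\<^sub>\<bullet>)\<close> and their grading shifts. A factor is a subring of
  \<open>Sym(V*)\<close>, shifted by \<open>k\<close> so that its part of degree \<open>n\<close> is the part of degree \<open>n + k\<close> of the
  subring. The bimodule of an expression \<open>[I]\<close> has the single factor \<open>R\<^sup>I\<close>.\<close>

definition bs_slots :: "('w, 'v::ab_group_add, 'k::field) realization_data \<Rightarrow> 'w set list \<Rightarrow>
    ('v, 'k) mpoly set list" where
  "bs_slots H Is = (if length Is = 1 then [Sym_inv H (hd Is)]
     else map2 (\<lambda>I J. if I \<subseteq> J then Sym_inv H I else Sym_inv H J) (butlast Is) (tl Is))"

definition bs_shifts :: "('w, 'v, 'k) realization_data \<Rightarrow> 'w set list \<Rightarrow> int list" where
  "bs_shifts H Is = (if length Is = 1 then [0]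
     else map2 (\<lambda>I J. if I \<subseteq> J then 0 else int (ell H I) - int (ell H J)) (butlast Is) (tl Is))"

text \<open>The iterated tensor product over the intermediate rings \<open>R\<^bsup>I\<^sub>j\<^esup>\<close> is the quotient of the free
  abelian group on tuples, one entry for each factor, by multiadditivity and by moving scalars
  across the tensor signs.\<close>

abbreviation bs_tuples :: "('w, 'v::ab_group_add, 'k::field) realization_data \<Rightarrow> 'w set list \<Rightarrow>
    ('v, 'k) mpoly list set" where
  "bs_tuples H Is \<equiv> listset (bs_slots H Is)"

abbreviation bs_free :: "('w, 'v::ab_group_add, 'k::field) realization_data \<Rightarrow> 'w set list \<Rightarrow>
    (('v, 'k) mpoly list \<Rightarrow>\<^sub>0 int) monoid" where
  "bs_free H Is \<equiv> free_Abelian_group (bs_tuples H Is)"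

definition bs_relators :: "('w, 'v::ab_group_add, 'k::field) realization_data \<Rightarrow> 'w set list \<Rightarrow>
    (('v, 'k) mpoly list \<Rightarrow>\<^sub>0 int) set" where
  "bs_relators H Is =
     {frag_of (xs[i := x + y]) - frag_of (xs[i := x]) - frag_of (xs[i := y]) | xs i x y.
        xs \<in> bs_tuples H Is \<and> i < length xs \<and> x \<in> bs_slots H Is ! i \<and> y \<in> bs_slots H Is ! i} \<union>
     {frag_of (xs[i := xs ! i * a]) - frag_of (xs[Suc i := a * xs ! Suc i]) | xs i a.
        xs \<in> bs_tuples H Is \<and> Suc i < length xs \<and> a \<in> Sym_inv H (Is ! Suc i)}"

definition bs_rel :: "('w, 'v::ab_group_add, 'k::field) realization_data \<Rightarrow> 'w set list \<Rightarrow>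
    (('v, 'k) mpoly list \<Rightarrow>\<^sub>0 int) set" where
  "bs_rel H Is = generate (bs_free H Is) (bs_relators H Is)"

text \<open>The elements of \<open>BS(I\<^sub>\<bullet>)\<close> are cosets of \<^const>\<open>bs_rel\<close>.\<close>

type_synonym ('v, 'k) bs_elt = "(('v, 'k) mpoly list \<Rightarrow>\<^sub>0 int) set"

definition bs_class :: "('w, 'v::ab_group_add, 'k::field) realization_data \<Rightarrow> 'w set list \<Rightarrow>
    (('v, 'k) mpoly list \<Rightarrow>\<^sub>0 int) \<Rightarrow> ('v, 'k) bs_elt" where
  "bs_class H Is c = bs_rel H Is #>\<^bsub>bs_free H Is\<^esub> c"

text \<open>The unions below are the choice-free way of evaluating a map on a class: all the classes
  united coincide.\<close>

definition BS :: "('w, 'v::ab_group_add, 'k::field) realization_data \<Rightarrow> 'w set list \<Rightarrow>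
    (('v, 'k) mpoly, ('v, 'k) bs_elt) gr_bimodule" where
  "BS H Is = \<lparr>
     carrier = carrier (bs_free H Is Mod bs_rel H Is),
     monoid.mult = monoid.mult (bs_free H Is Mod bs_rel H Is),
     one = one (bs_free H Is Mod bs_rel H Is),
     lact = (\<lambda>a U. \<Union>c \<in> U. bs_class H Is
       (frag_extend (\<lambda>xs. frag_of ((a * hd xs) # tl xs)) c)),
     ract = (\<lambda>U a. \<Union>c \<in> U. bs_class H Is
       (frag_extend (\<lambda>xs. frag_of (butlast xs @ [last xs * a])) c)),
     gpart = (\<lambda>n. generate (bs_free H Is Mod bs_rel H Is)
       {bs_class H Is (frag_of xs) | xs ds. xs \<in> bs_tuples H Is \<and> length ds = length xs \<and>
          (\<forall>i < length xs. xs ! i \<in> Sym_deg H (ds ! i + bs_shifts H Is ! i)) \<and>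
          sum_list ds = n})\<rparr>"

text \<open>The tensor \<open>x \<otimes> y \<in> BS(P\<^sub>\<bullet> \<circ>\<^sub>e Q\<^sub>\<bullet>) = BS(P\<^sub>\<bullet>) \<otimes> BS(Q\<^sub>\<bullet>)\<close> of \<open>x \<in> BS(P\<^sub>\<bullet>)\<close> and \<open>y \<in> BS(Q\<^sub>\<bullet>)\<close>.
  Pure tensors are juxtaposed; when one of the expressions has no steps, its bimodule is the
  unit for the tensor product and the identification is by multiplication.\<close>

definition bs_glue :: "'w set list \<Rightarrow> 'w set list \<Rightarrow> 'r::comm_ring_1 list \<Rightarrow> 'r list \<Rightarrow> 'r list" where
  "bs_glue Ps Qs xs ys =
     (if length Ps = 1 then (hd xs * hd ys) # tl ys
      else if length Qs = 1 then butlast xs @ [last xs * hd ys]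
      else xs @ ys)"

definition bs_tensor :: "('w, 'v::ab_group_add, 'k::field) realization_data \<Rightarrow>
    'w set list \<Rightarrow> 'w set list \<Rightarrow> ('v, 'k) bs_elt \<Rightarrow> ('v, 'k) bs_elt \<Rightarrow> ('v, 'k) bs_elt" where
  "bs_tensor H Ps Qs U V = (\<Union>c \<in> U. \<Union>d \<in> V. bs_class H (Ps \<circ>\<^sub>e Qs)
     (frag_extend (\<lambda>xs. frag_extend (\<lambda>ys. frag_of (bs_glue Ps Qs xs ys)) d) c))"

text \<open>The tensor product \<open>f \<otimes> g\<close> of \<open>f : BS(P\<^sub>\<bullet>) \<rightarrow> BS(P'\<^sub>\<bullet>)\<close> and \<open>g : BS(Q\<^sub>\<bullet>) \<rightarrow> BS(Q'\<^sub>\<bullet>)\<close>.\<close>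

definition bs_tensor_map :: "('w, 'v::ab_group_add, 'k::field) realization_data \<Rightarrow>
    'w set list \<Rightarrow> 'w set list \<Rightarrow> 'w set list \<Rightarrow> 'w set list \<Rightarrow>
    (('v, 'k) bs_elt \<Rightarrow> ('v, 'k) bs_elt) \<Rightarrow> (('v, 'k) bs_elt \<Rightarrow> ('v, 'k) bs_elt) \<Rightarrow>
    ('v, 'k) bs_elt \<Rightarrow> ('v, 'k) bs_elt" where
  "bs_tensor_map H Ps Qs Ps' Qs' f g =
     (THE h. h \<in> hom (BS H (Ps \<circ>\<^sub>e Qs)) (BS H (Ps' \<circ>\<^sub>e Qs')) \<and>
        h \<in> extensional (carrier (BS H (Ps \<circ>\<^sub>e Qs))) \<and>
        (\<forall>x \<in> carrier (BS H Ps). \<forall>y \<in> carrier (BS H Qs).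
           h (bs_tensor H Ps Qs x y) = bs_tensor H Ps' Qs' (f x) (g y)))"

definition bs_id :: "('w, 'v::ab_group_add, 'k::field) realization_data \<Rightarrow> 'w set list \<Rightarrow>
    ('v, 'k) bs_elt \<Rightarrow> ('v, 'k) bs_elt" where
  "bs_id H Is = (\<lambda>x \<in> carrier (BS H Is). x)"


subsection \<open>Lower terms\<close>

text \<open>\<open>Hom\<^sub>C(M, N)\<close> for graded \<open>(R\<^sup>I, R\<^sup>J)\<close>-bimodules \<open>M\<close>, \<open>N\<close> and a set \<open>C\<close> of \<open>(I, J)\<close>-cosets.\<close>

inductive_set Hom_ideal :: "('w, 'v::ab_group_add, 'k::field) realization_data \<Rightarrow>
    'w set \<Rightarrow> 'w set \<Rightarrow> 'w coset set \<Rightarrow>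
    (('v, 'k) mpoly, 'm) gr_bimodule \<Rightarrow> (('v, 'k) mpoly, 'n) gr_bimodule \<Rightarrow> ('m \<Rightarrow> 'n) set"
  for H :: "('w, 'v::ab_group_add, 'k::field) realization_data"
    and I :: "'w set" and J :: "'w set" and C :: "'w coset set"
    and M :: "(('v, 'k) mpoly, 'm) gr_bimodule" and N :: "(('v, 'k) mpoly, 'n) gr_bimodule" where
  zero: "(\<lambda>x \<in> carrier M. \<one>\<^bsub>N\<^esub>) \<in> Hom_ideal H I J C M N"
| factor: "\<lbrakk>q \<in> C; expresses H Ms q;
      f \<in> Hom (Sym_inv H I) (Sym_inv H J) M (BS H Ms);
      g \<in> Hom (Sym_inv H I) (Sym_inv H J) (BS H Ms) N\<rbrakk>
    \<Longrightarrow> compose (carrier M) g f \<in> Hom_ideal H I J C M N"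
| add: "\<lbrakk>f \<in> Hom_ideal H I J C M N; g \<in> Hom_ideal H I J C M N\<rbrakk>
    \<Longrightarrow> (\<lambda>x \<in> carrier M. f x \<otimes>\<^bsub>N\<^esub> g x) \<in> Hom_ideal H I J C M N"

definition End_below :: "('w, 'v::ab_group_add, 'k::field) realization_data \<Rightarrow> 'w coset \<Rightarrow>
    (('v, 'k) mpoly, 'm) gr_bimodule \<Rightarrow> ('m \<Rightarrow> 'm) set" where
  "End_below H p B = (case p of (_, I, J) \<Rightarrow> Hom_ideal H I J {q. coset_less H q p} B B)"

end

theory Submission
  imports Defs
begin

text \<open>
  A map \<open>f\<close> factoring through \<open>BS(M)\<close> gives \<open>id \<otimes> f \<otimes> id\<close> factoring through
  \<open>BS(P \<circ> M \<circ> R)\<close>, so it suffices that \<open>P \<circ> M \<circ> R\<close> expresses a coset below \<open>p.q.r\<close> when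
  \<open>M\<close> expresses some \<open>q' < q\<close>. Comparing minimal elements of cosets amounts to comparing maximal
  ones, and the star product is monotone, which gives \<open>\<le>\<close>. For strictness compare the lengths of
  maximal elements: with \<open>q\<close> an \<open>(I, J)\<close>-coset, the one of \<open>P \<circ> M \<circ> R\<close> has length at most
  \<open>\<ell>(p) - \<ell>(I) + \<ell>(q') - \<ell>(J) + \<ell>(r)\<close>, while reducedness makes the one of \<open>P \<circ> Q \<circ> R\<close> equal
  to the same expression with \<open>q\<close> in place of \<open>q'\<close>.

  The Coxeter group theory needed for this (strong exchange, hence the lifting property of the
  Bruhat order) rests on the parity of the number of times that a reflection occurs in the
  reflection sequence of a word: the defining relations preserve it.
\<close>

section \<open>Coxeter groups\<close>

text \<open>The corrections by \<open>\<ell>(I)\<close> and \<open>\<ell>(J)\<close> come from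
  writing the maximum of \<open>p\<close> as \<open>x w_I\<close> and that of \<open>r\<close> as
  \<open>w_J y\<close> with lengths adding: the descents of the middle factor absorb
  \<open>w_I\<close> and \<open>w_J\<close>. The expression \<open>M\<close> is arbitrary, so only
  subadditivity of length is available for it; for reduced expressions the matching equality comes
  from telescoping the lengths of the turning factors. Everything about inversions follows from one
  cocycle rule. On the bimodule side, elements are cosets of relations, operations are unions over
  representatives, and tensor products of maps are definite descriptions. Each of these needs
  existence, from a universal property on pure tensors applied in one argument at a time, and
  uniqueness, since pure tensors generate. An expression without steps still owns one tensor slot,
  so tuples do not simply juxtapose, and the constructions split into three cases. Compatibility of
  \<open>id \<otimes> f \<otimes> id\<close> with sums and composites is then forced by its values
  on triple tensors. A morphism is a sum of maps of several degrees, so linearity and degree are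
  treated separately.\<close>

locale coxeter_sys = group C for C :: "('w, 'x) coxeter_scheme" (structure) +
  assumes coxeter: "coxeter_system C"
begin

lemma gens_carrier: "gens C \<subseteq> carrier C"
  and generate_gens: "generate C (gens C) = carrier C"
  and gen_square: "s \<in> gens C \<Longrightarrow> s \<otimes> s = \<one>"
  and word_prod_eq_imp: "\<lbrakk>u \<in> lists (gens C); v \<in> lists (gens C); word_prod C u = word_prod C v\<rbrakk>
    \<Longrightarrow> cox_equiv C u v"
  using coxeter by (auto simp: coxeter_system_def)

lemma gen_closed [simp, intro]: "s \<in> gens C \<Longrightarrow> s \<in> carrier C"
  using gens_carrier by blast

lemma gen_inv [simp]: "s \<in> gens C \<Longrightarrow> inv s = s"
  by (rule inv_equality) (auto simp: gen_square)

lemma gen_cancel [simp]: "\<lbrakk>s \<in> gens C; x \<in> carrier C\<rbrakk> \<Longrightarrow> s \<otimes> (s \<otimes> x) = x"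
  by (metis gen_closed gen_square l_one m_assoc)

lemma gen_cancel_right [simp]: "\<lbrakk>s \<in> gens C; x \<in> carrier C\<rbrakk> \<Longrightarrow> x \<otimes> s \<otimes> s = x"
  by (simp add: gen_square m_assoc)

subsection \<open>Words and length\<close>

lemma word_prod_Nil [simp]: "word_prod C [] = \<one>"
  and word_prod_Cons [simp]: "word_prod C (s # ss) = s \<otimes> word_prod C ss"
  by (simp_all add: word_prod_def)

lemma word_prod_closed [simp, intro]: "ss \<in> lists (carrier C) \<Longrightarrow> word_prod C ss \<in> carrier C"
  by (induction ss) auto

lemma lists_gens_carrier [simp, intro]: "ss \<in> lists (gens C) \<Longrightarrow> ss \<in> lists (carrier C)"
  using gens_carrier lists_mono by blast

lemma word_prod_append [simp]:
  "\<lbrakk>us \<in> lists (carrier C); vs \<in> lists (carrier C)\<rbrakk>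
    \<Longrightarrow> word_prod C (us @ vs) = word_prod C us \<otimes> word_prod C vs"
  by (induction us) (auto simp: m_assoc)

lemma word_prod_rev: "ss \<in> lists (gens C) \<Longrightarrow> word_prod C (rev ss) = inv (word_prod C ss)"
proof (induction ss)
  case (Cons s ss)
  then have "rev ss \<in> lists (carrier C)" by auto
  with Cons show ?case by (simp add: inv_mult_group)
qed simp

text \<open>Generators are involutions, so inverses cost no extra letters and words over
  \<open>I\<close> suffice.\<close>

lemma generate_iff_word:
  assumes "I \<subseteq> gens C"
  shows "x \<in> generate C I \<longleftrightarrow> (\<exists>ss \<in> lists I. word_prod C ss = x)"
proof
  assume "x \<in> generate C I"
  then show "\<exists>ss \<in> lists I. word_prod C ss = x"
  proof induction
    case one
    show ?case by (rule bexI[of _ "[]"]) auto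
  next
    case (incl h)
    then show ?case using assms by (intro bexI[of _ "[h]"]) auto
  next
    case (inv h)
    then show ?case using assms by (intro bexI[of _ "[h]"]) (auto simp: subset_iff)
  next
    case (eng h1 h2)
    then obtain us vs where "us \<in> lists I" "word_prod C us = h1" "vs \<in> lists I" "word_prod C vs = h2"
      by blast
    moreover have "lists I \<subseteq> lists (carrier C)" using assms gens_carrier by (intro lists_mono) auto
    ultimately show ?case
      by (intro bexI[of _ "us @ vs"]) (simp_all add: word_prod_append subset_iff)
  qed
next
  assume "\<exists>ss \<in> lists I. word_prod C ss = x"
  then obtain ss where "ss \<in> lists I" "word_prod C ss = x" by blast
  then show "x \<in> generate C I"
    by (induction ss arbitrary: x) (auto intro: generate.intros)
qed

lemma ex_word: "x \<in> carrier C \<Longrightarrow> \<exists>ss \<in> lists (gens C). word_prod C ss = x"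
  using generate_iff_word[of "gens C"] generate_gens by blast

lemma ex_reduced_word: "x \<in> carrier C \<Longrightarrow> \<exists>ss. reduced_word C ss x"
proof -
  assume "x \<in> carrier C"
  then have "\<exists>n. \<exists>ss \<in> lists (gens C). length ss = n \<and> word_prod C ss = x"
    using ex_word by blast
  from LeastI_ex[OF this] show ?thesis unfolding reduced_word_def len_def by blast
qed

lemma some_reduced_word: "x \<in> carrier C \<Longrightarrow> reduced_word C (some_reduced_word C x) x"
  unfolding some_reduced_word_def using ex_reduced_word by (rule someI_ex)

lemma reduced_wordD:
  assumes "reduced_word C ss x"
  shows "ss \<in> lists (gens C)" "word_prod C ss = x" "length ss = len C x"
  using assms by (auto simp: reduced_word_def)

lemma len_le: "ss \<in> lists (gens C) \<Longrightarrow> len C (word_prod C ss) \<le> length ss"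
  unfolding len_def by (rule Least_le) blast

lemma len_one [simp]: "len C \<one> = 0"
  using len_le[of "[]"] by simp

lemma len_mult_le:
  assumes "x \<in> carrier C" "y \<in> carrier C"
  shows "len C (x \<otimes> y) \<le> len C x + len C y"
proof -
  obtain us vs where "reduced_word C us x" "reduced_word C vs y"
    using assms ex_reduced_word by meson
  then show ?thesis using len_le[of "us @ vs"] by (auto simp: reduced_word_def)
qed

lemma len_inv [simp]:
  assumes "x \<in> carrier C"
  shows "len C (inv x) = len C x"
proof -
  have le: "len C (inv y) \<le> len C y" if "y \<in> carrier C" for y
  proof -
    obtain us where us: "reduced_word C us y" using \<open>y \<in> carrier C\<close> ex_reduced_word by meson
    then have "rev us \<in> lists (gens C)" by (auto simp: reduced_word_def)
    then show ?thesis using len_le[of "rev us"] us word_prod_rev[of us] by (auto simp: reduced_word_def)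
  qed
  from le[OF assms] le[OF inv_closed[OF assms]] assms show ?thesis by simp
qed

lemma len_gen_le: "s \<in> gens C \<Longrightarrow> len C s \<le> 1"
  using len_le[of "[s]"] by auto

subsection \<open>Reflections and inversions\<close>

abbreviation conj :: "'w \<Rightarrow> 'w \<Rightarrow> 'w" where
  "conj g x \<equiv> g \<otimes> x \<otimes> inv g"

lemma mult_inv_cancel [simp]:
  assumes "g \<in> carrier C" "x \<in> carrier C"
  shows "g \<otimes> (inv g \<otimes> x) = x" "inv g \<otimes> (g \<otimes> x) = x"
  using assms by (simp_all add: m_assoc[symmetric])

lemma conj_mult: "\<lbrakk>g \<in> carrier C; h \<in> carrier C; x \<in> carrier C\<rbrakk>
    \<Longrightarrow> conj (g \<otimes> h) x = conj g (conj h x)"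
  by (simp add: inv_mult_group m_assoc)

text \<open>For the word \<open>s1 ... sk\<close> the i-th entry is
  \<open>s1 ... s(i-1) si s(i-1) ... s1\<close>, the reflection whose left multiplication deletes
  the i-th letter.\<close>

primrec refls :: "'w list \<Rightarrow> 'w list" where
  "refls [] = []"
| "refls (s # ss) = s # map (conj s) (refls ss)"

lemma refls_closed: "ss \<in> lists (carrier C) \<Longrightarrow> set (refls ss) \<subseteq> carrier C"
  by (induction ss) auto

lemma map_conj_mult: "\<lbrakk>g \<in> carrier C; h \<in> carrier C; set L \<subseteq> carrier C\<rbrakk>
    \<Longrightarrow> map (conj (g \<otimes> h)) L = map (conj g) (map (conj h) L)"
  unfolding map_map by (rule map_cong) (auto simp only: o_apply conj_mult)

lemma map_conj_one: "set L \<subseteq> carrier C \<Longrightarrow> map (conj \<one>) L = L"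
  by (induction L) auto

lemma refls_append:
  "\<lbrakk>us \<in> lists (carrier C); vs \<in> lists (carrier C)\<rbrakk>
    \<Longrightarrow> refls (us @ vs) = refls us @ map (conj (word_prod C us)) (refls vs)"
proof (induction us)
  case Nil
  then have "map (conj \<one>) (refls vs) = refls vs" by (intro map_conj_one refls_closed)
  then show ?case by (simp only: append_Nil refls.simps word_prod_Nil)
next
  case (Cons s us)
  then show ?case
    using map_conj_mult[of s "word_prod C us" "refls vs"] refls_closed[of vs] by auto
qed

lemma count_map_conj:
  assumes "g \<in> carrier C" "t \<in> carrier C" "set L \<subseteq> carrier C"
  shows "count_list (map (conj g) L) t = count_list L (inv g \<otimes> t \<otimes> g)"
  using assms(3)
proof (induction L)
  case (Cons a L)
  have "a \<in> carrier C" using Cons.prems by simp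
  then have *: "inv g \<otimes> conj g a \<otimes> g = a" "conj g (inv g \<otimes> t \<otimes> g) = t"
    using assms(1,2) by (simp_all add: m_assoc)
  have "conj g a = t \<longleftrightarrow> a = inv g \<otimes> t \<otimes> g"
  proof
    show "a = inv g \<otimes> t \<otimes> g" if "conj g a = t" using *(1) that by metis
    show "conj g a = t" if "a = inv g \<otimes> t \<otimes> g" using *(2) that by metis
  qed
  with Cons show ?case by simp
qed simp

lemma relator_closed:
  "\<lbrakk>s \<in> gens C; t \<in> gens C\<rbrakk> \<Longrightarrow> concat (replicate k [s, t]) \<in> lists (gens C)"
  by (induction k) auto

lemma word_prod_relator:
  "\<lbrakk>s \<in> gens C; t \<in> gens C\<rbrakk> \<Longrightarrow> word_prod C (concat (replicate k [s, t])) = (s \<otimes> t) [^] k"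
proof (induction k)
  case (Suc k)
  then show ?case using nat_pow_mult[of "s \<otimes> t" 1 k] by (simp add: m_assoc)
qed simp

text \<open>The alternating word runs through reflections of the dihedral group of \<open>s\<close>
  and \<open>t\<close>; writing them as powers of \<open>s \<otimes> t\<close> times
  \<open>s\<close> makes their periodicity visible.\<close>

lemma refls_relator:
  assumes "s \<in> gens C" "t \<in> gens C"
  shows "refls (concat (replicate k [s, t])) = map (\<lambda>j. (s \<otimes> t) [^] j \<otimes> s) [0..<2 * k]"
proof (induction k)
  case (Suc k)
  let ?f = "\<lambda>j. (s \<otimes> t) [^] j \<otimes> s"
  \<comment> \<open>Conjugation by \<open>s \<otimes> t\<close> raises the exponent by two, because
    \<open>s \<otimes> inv (s \<otimes> t) = (s \<otimes> t) \<otimes> s\<close>.\<close>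
  have step: "conj s (conj t (?f j)) = ?f (j + 2)" for j :: nat
  proof -
    have "conj s (conj t (?f j)) = conj (s \<otimes> t) (?f j)"
      using assms by (subst conj_mult) auto
    also have "\<dots> = (s \<otimes> t) \<otimes> (s \<otimes> t) [^] j \<otimes> (s \<otimes> t) \<otimes> s"
      using assms by (simp add: inv_mult_group m_assoc)
    also have "\<dots> = ?f (j + 2)"
      using assms nat_pow_Suc2[of "s \<otimes> t" j] by (simp add: numeral_2_eq_2)
    finally show ?thesis .
  qed
  have "[0..<2 * Suc k] = 0 # 1 # map (\<lambda>j. j + 2) [0..<2 * k]"
  proof -
    have "[0..<2 * Suc k] = [0..<2 + 2 * k]" by (simp only: mult_Suc_right)
    also have "\<dots> = [0..<2] @ [2..<2 + 2 * k]" by (rule upt_add_eq_append) simp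
    also have "[2..<2 + 2 * k] = map (\<lambda>j. j + 2) [0..<2 * k]"
      by (simp only: map_add_upt add.commute)
    also have "[0..<2 :: nat] = [0, 1]" by (simp add: numeral_2_eq_2)
    finally show ?thesis by (simp only: append_Cons append_Nil)
  qed
  moreover have "refls (concat (replicate (Suc k) [s, t]))
      = s # conj s t # map (\<lambda>x. conj s (conj t x)) (map ?f [0..<2 * k])"
    by (simp del: map_map add: Suc) simp
  moreover have "map (\<lambda>x. conj s (conj t x)) (map ?f [0..<2 * k]) = map ?f (map (\<lambda>j. j + 2) [0..<2 * k])"
    unfolding map_map by (rule map_cong) (simp_all only: o_apply step)
  moreover have "?f (0 :: nat) = s" "?f (1 :: nat) = conj s t" using assms by simp_all
  ultimately show ?case by (simp only: list.map)
qed simp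

text \<open>The exponent in \<open>refls_relator\<close> matters only modulo
  \<open>cox_m C s t\<close> but runs over twice that range, so a relator contributes each
  reflection an even number of times.\<close>

lemma refls_relator_double:
  assumes "s \<in> gens C" "t \<in> gens C" "cox_m C s t > 0"
  shows "\<exists>L. refls (concat (replicate (cox_m C s t) [s, t])) = L @ L"
proof -
  let ?m = "cox_m C s t"
  let ?f = "\<lambda>j. (s \<otimes> t) [^] j \<otimes> s"
  have one: "(s \<otimes> t) [^] ?m = \<one>"
    using assms by (simp add: cox_m_def)
  have "?f (j + ?m) = ?f j" for j
    using one assms nat_pow_mult[of "s \<otimes> t" j ?m] by (simp add: nat_pow_mult)
  then have "map ?f (map (\<lambda>j. j + ?m) [0..<?m]) = map ?f [0..<?m]" by simp
  moreover have "[0..<2 * ?m] = [0..<?m] @ map (\<lambda>j. j + ?m) [0..<?m]"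
    by (simp add: map_add_upt upt_add_eq_append[of 0 ?m ?m, simplified] mult_2)
  ultimately show ?thesis using refls_relator[OF assms(1,2)] by (metis map_append)
qed

text \<open>A relator has trivial product, so the reflections of the letters after it are not
  conjugated any further; it has even length, and its own reflections form a doubled list. Hence all
  three invariants survive its insertion.\<close>

lemma cox_equiv_invariants:
  assumes "cox_equiv C u v"
  shows "u \<in> lists (gens C) \<and> v \<in> lists (gens C) \<and> word_prod C u = word_prod C v \<and>
    even (length u) = even (length v) \<and>
    (\<forall>t \<in> carrier C. even (count_list (refls u) t) = even (count_list (refls v) t))"
  using assms
proof induction
  case (relation u v s t)
  let ?r = "concat (replicate (cox_m C s t) [s, t])"
  obtain L where L: "refls ?r = L @ L" using refls_relator_double relation by blast
  have r: "?r \<in> lists (gens C)" using relation relator_closed by blast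
  have uc: "u \<in> lists (carrier C)" and vc: "v \<in> lists (carrier C)" and rc: "?r \<in> lists (carrier C)"
    using relation r by blast+
  have one: "word_prod C ?r = \<one>"
    using relation word_prod_relator[of s t "cox_m C s t"] by (simp add: cox_m_def)
  have "refls (?r @ v) = L @ L @ refls v"
    using refls_append[OF rc vc] one map_conj_one[OF refls_closed[OF vc]] L by simp
  then have "refls (u @ ?r @ v) = refls u @ map (conj (word_prod C u)) (L @ L @ refls v)"
    using refls_append[of u "?r @ v"] uc vc rc by (metis append_in_lists_conv)
  moreover have "refls (u @ v) = refls u @ map (conj (word_prod C u)) (refls v)"
    using refls_append uc vc by blast
  ultimately have "\<forall>t. even (count_list (refls (u @ ?r @ v)) t) = even (count_list (refls (u @ v)) t)"
    by auto
  moreover have "even (length ?r)" by (simp add: length_concat sum_list_replicate)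
  moreover have "word_prod C (u @ ?r @ v) = word_prod C (u @ v)"
    using uc vc rc one word_prod_append[of u "?r @ v"] word_prod_append[of ?r v] word_prod_append[of u v]
    by (metis append_in_lists_conv l_one word_prod_closed)
  ultimately show ?case using relation r by simp
qed auto

text \<open>The parity of word length depends on the group element only (the sign character), and
  prepending a letter flips it.\<close>

lemma len_gen_parity:
  assumes "s \<in> gens C" "x \<in> carrier C"
  shows "even (len C (s \<otimes> x)) \<noteq> even (len C x)"
proof -
  obtain us vs where "reduced_word C us x" "reduced_word C vs (s \<otimes> x)"
    using assms ex_reduced_word by (meson gen_closed m_closed)
  then have *: "us \<in> lists (gens C)" "word_prod C us = x" "length us = len C x"
    "vs \<in> lists (gens C)" "word_prod C vs = s \<otimes> x" "length vs = len C (s \<otimes> x)"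
    by (auto simp: reduced_word_def)
  then have "cox_equiv C vs (s # us)" using assms by (intro word_prod_eq_imp) auto
  from cox_equiv_invariants[OF this] show ?thesis using * by simp
qed

lemma len_gen_cases:
  assumes "s \<in> gens C" "x \<in> carrier C"
  shows "len C (s \<otimes> x) = Suc (len C x) \<or> len C x = Suc (len C (s \<otimes> x))"
proof -
  have "len C (s \<otimes> x) \<le> Suc (len C x)"
    using len_mult_le[of s x] len_gen_le[of s] assms by auto
  moreover have "len C x \<le> Suc (len C (s \<otimes> x))"
    using len_mult_le[of s "s \<otimes> x"] len_gen_le[of s] assms by auto
  moreover have "len C (s \<otimes> x) \<noteq> len C x" using len_gen_parity[OF assms] by metis
  ultimately show ?thesis by linarith
qed

text \<open>The chosen word is immaterial: \<open>inversion_word\<close> computes the parity from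
  any word. For a reflection \<open>t\<close> this is membership in the left inversion set, see
  \<open>inversion_iff_len\<close>.\<close>

definition inversion :: "'w \<Rightarrow> 'w \<Rightarrow> bool" where
  "inversion x t \<longleftrightarrow> odd (count_list (refls (some_reduced_word C x)) t)"

lemma inversion_word:
  assumes "ss \<in> lists (gens C)" "t \<in> carrier C"
  shows "inversion (word_prod C ss) t \<longleftrightarrow> odd (count_list (refls ss) t)"
proof -
  let ?r = "some_reduced_word C (word_prod C ss)"
  have "?r \<in> lists (gens C)" "word_prod C ?r = word_prod C ss"
    using some_reduced_word[of "word_prod C ss"] assms(1) by (auto simp: reduced_word_def)
  then have "cox_equiv C ?r ss" using word_prod_eq_imp assms by blast
  from cox_equiv_invariants[OF this] assms(2) show ?thesis unfolding inversion_def by blast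
qed

text \<open>The cocycle rule \<open>N(xy) = N(x) + x N(y) inv x\<close> modulo 2 for inversion sets,
  read off from the reflection sequence of a concatenated word.\<close>

lemma inversion_mult:
  assumes "x \<in> carrier C" "y \<in> carrier C" "t \<in> carrier C"
  shows "inversion (x \<otimes> y) t \<longleftrightarrow> inversion x t \<noteq> inversion y (inv x \<otimes> t \<otimes> x)"
proof -
  obtain us vs where us: "us \<in> lists (gens C)" "word_prod C us = x"
    and vs: "vs \<in> lists (gens C)" "word_prod C vs = y"
    using assms ex_word by meson
  have uc: "us \<in> lists (carrier C)" and vc: "vs \<in> lists (carrier C)" using us vs by blast+
  have "inversion (x \<otimes> y) t \<longleftrightarrow> odd (count_list (refls (us @ vs)) t)"
    using inversion_word[of "us @ vs" t] us vs uc vc assms by simp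
  also have "\<dots> \<longleftrightarrow> odd (count_list (refls us) t + count_list (refls vs) (inv x \<otimes> t \<otimes> x))"
    using refls_append[OF uc vc] us count_map_conj[of x t "refls vs"] assms refls_closed[OF vc] by simp
  also have "\<dots> \<longleftrightarrow> inversion x t \<noteq> inversion y (inv x \<otimes> t \<otimes> x)"
    using inversion_word[of us t] inversion_word[of vs "inv x \<otimes> t \<otimes> x"] us vs assms by auto
  finally show ?thesis .
qed

lemma inversion_gen: "\<lbrakk>s \<in> gens C; t \<in> carrier C\<rbrakk> \<Longrightarrow> inversion s t \<longleftrightarrow> t = s"
  using inversion_word[of "[s]" t] by auto

lemma inversion_one: "t \<in> carrier C \<Longrightarrow> \<not> inversion \<one> t"
  using inversion_word[of "[]" t] by simp

lemma reflectionsE: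
  assumes "t \<in> reflections C"
  obtains x s where "x \<in> carrier C" "s \<in> gens C" "t = conj x s"
  using assms by (auto simp: reflections_def)

lemma reflection_closed [simp, intro]: "t \<in> reflections C \<Longrightarrow> t \<in> carrier C"
  by (erule reflectionsE) auto

lemma reflection_square [simp]: "t \<in> reflections C \<Longrightarrow> t \<otimes> t = \<one>"
proof -
  assume "t \<in> reflections C"
  then obtain x s where "x \<in> carrier C" "s \<in> gens C" "t = conj x s" by (rule reflectionsE)
  moreover from this have "conj x s \<otimes> conj x s = \<one>"
    by (simp add: m_assoc)
  ultimately show ?thesis by simp
qed

lemma reflection_inv [simp]: "t \<in> reflections C \<Longrightarrow> inv t = t"
  by (rule inv_equality) auto

lemma reflection_cancel [simp]: "\<lbrakk>t \<in> reflections C; x \<in> carrier C\<rbrakk> \<Longrightarrow> t \<otimes> (t \<otimes> x) = x"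
  by (metis reflection_closed reflection_square l_one m_assoc)

lemma gen_reflection: "s \<in> gens C \<Longrightarrow> s \<in> reflections C"
  unfolding reflections_def by (rule CollectI, rule exI[of _ \<one>], rule exI[of _ s]) auto

lemma conj_reflection:
  assumes "t \<in> reflections C" "g \<in> carrier C"
  shows "conj g t \<in> reflections C"
proof -
  obtain x s where "x \<in> carrier C" "s \<in> gens C" "t = conj x s" using assms(1) by (rule reflectionsE)
  then have "g \<otimes> x \<in> carrier C" "conj g t = conj (g \<otimes> x) s" using assms conj_mult[of g x s] by auto
  then show ?thesis using \<open>s \<in> gens C\<close> unfolding reflections_def by blast
qed

lemma conj_inv_reflection:
  assumes "t \<in> reflections C" "g \<in> carrier C"
  shows "inv g \<otimes> t \<otimes> g \<in> reflections C"
  using conj_reflection[of t "inv g"] assms by simp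

text \<open>Write \<open>t\<close> as \<open>x \<otimes> s \<otimes> inv x\<close> and apply the
  cocycle rule to the three factors: the contributions of \<open>x\<close> and \<open>inv x\<close>
  cancel, and \<open>s\<close> contributes once.\<close>

lemma inversion_self:
  assumes "t \<in> reflections C"
  shows "inversion t t"
proof -
  obtain x s where xs: "x \<in> carrier C" "s \<in> gens C" and t: "t = conj x s"
    using assms(1) by (rule reflectionsE)
  have tx: "inv x \<otimes> t \<otimes> x = s" using xs t by (simp add: m_assoc)
  have tc: "t \<in> carrier C" using assms by auto
  have ss: "inv s \<otimes> s \<otimes> s = s" using xs by simp
  have "inversion t t \<longleftrightarrow> inversion (x \<otimes> (s \<otimes> inv x)) t"
    using t xs by (simp add: m_assoc)
  also have "\<dots> \<longleftrightarrow> inversion x t \<noteq> inversion (s \<otimes> inv x) s"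
    using inversion_mult[of x "s \<otimes> inv x" t] xs tc tx by simp
  also have "inversion (s \<otimes> inv x) s \<longleftrightarrow> \<not> inversion (inv x) s"
    using inversion_mult[of s "inv x" s] inversion_gen[of s s] xs ss by simp
  also have "inversion x t \<longleftrightarrow> inversion (inv x) s"
    using inversion_mult[of x "inv x" t] inversion_one[of t] xs tc tx by simp
  finally show ?thesis by simp
qed

text \<open>A later entry has the form \<open>conj s t'\<close> with \<open>t'\<close> from the
  tail, and \<open>conj s t' \<otimes> s = s \<otimes> t'\<close> carries the deletion past the
  first letter.\<close>

lemma refls_delete:
  assumes "ss \<in> lists (gens C)" "t \<in> set (refls ss)"
  shows "\<exists>us s vs. ss = us @ s # vs \<and> t \<otimes> word_prod C ss = word_prod C (us @ vs)"
  using assms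
proof (induction ss arbitrary: t rule: list.induct)
  case (Cons s ss)
  have "ss \<in> lists (gens C)" using Cons.prems by simp
  then have wc: "word_prod C ss \<in> carrier C" by blast
  show ?case
  proof (cases "t = s")
    case True
    then show ?thesis using Cons.prems wc by (intro exI[of _ "[]"] exI[of _ s] exI[of _ ss]) auto
  next
    case False
    then obtain t' where t': "t' \<in> set (refls ss)" "t = conj s t'" using Cons.prems by auto
    obtain us a vs where *: "ss = us @ a # vs" "t' \<otimes> word_prod C ss = word_prod C (us @ vs)"
      using Cons.IH[of t'] Cons.prems t' by auto
    have "t' \<in> carrier C" using t'(1) refls_closed[of ss] Cons.prems by auto
    then have "t \<otimes> word_prod C (s # ss) = s \<otimes> (t' \<otimes> word_prod C ss)"
      using t' Cons.prems wc by (simp add: m_assoc)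
    also have "\<dots> = word_prod C ((s # us) @ vs)" using *(2) by simp
    finally show ?thesis using *(1) by (metis append_Cons)
  qed
qed simp

lemma inversion_delete:
  assumes "ss \<in> lists (gens C)" "t \<in> carrier C" "inversion (word_prod C ss) t"
  shows "\<exists>us s vs. ss = us @ s # vs \<and> t \<otimes> word_prod C ss = word_prod C (us @ vs)"
proof -
  have "odd (count_list (refls ss) t)" using inversion_word assms by blast
  then have "t \<in> set (refls ss)" by (rule contrapos_pp) simp
  then show ?thesis using refls_delete assms by blast
qed

text \<open>One direction is strong exchange: an inversion occurs in the reflection sequence of a
  reduced word, so multiplying by it deletes a letter. Conversely, if \<open>t\<close> is no
  inversion of \<open>x\<close>, the cocycle rule makes it one of \<open>t \<otimes> x\<close>, and
  the first direction gives the opposite inequality.\<close>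

theorem inversion_iff_len:
  assumes "t \<in> reflections C" "x \<in> carrier C"
  shows "inversion x t \<longleftrightarrow> len C (t \<otimes> x) < len C x"
proof -
  have less: "len C (t \<otimes> y) < len C y" if inv: "inversion y t" and y: "y \<in> carrier C" for y
  proof -
    obtain ss where "reduced_word C ss y" using y ex_reduced_word by blast
    then have ss: "ss \<in> lists (gens C)" "word_prod C ss = y" "length ss = len C y"
      by (rule reduced_wordD)+
    obtain us s vs where *: "ss = us @ s # vs" "t \<otimes> word_prod C ss = word_prod C (us @ vs)"
      using inversion_delete[of ss t] inv ss assms(1) by blast
    have "len C (word_prod C (us @ vs)) \<le> length (us @ vs)" using *(1) ss(1) by (intro len_le) auto
    also have "\<dots> < len C y" using *(1) ss(3) by simp
    finally show ?thesis using *(2) ss(2) by simp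
  qed
  have "inversion (t \<otimes> x) t" if "\<not> inversion x t"
    using inversion_mult[of t x t] inversion_self[OF assms(1)] that assms by simp
  moreover have "len C (t \<otimes> (t \<otimes> x)) < len C (t \<otimes> x)" if "inversion (t \<otimes> x) t"
    using less[OF that] assms by blast
  moreover have "t \<otimes> (t \<otimes> x) = x" using assms by simp
  ultimately show ?thesis using less[of x] assms by (metis less_asym)
qed

subsection \<open>Bruhat order\<close>

text \<open>By the cocycle rule exactly one of \<open>x\<close> and \<open>t \<otimes> x\<close> has
  \<open>t\<close> as an inversion.\<close>

lemma reflection_len_neq:
  assumes "t \<in> reflections C" "x \<in> carrier C"
  shows "len C (t \<otimes> x) \<noteq> len C x"
proof -
  have "inversion (t \<otimes> x) t \<longleftrightarrow> \<not> inversion x t"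
    using inversion_mult[of t x t] inversion_self[OF assms(1)] assms by simp
  then show ?thesis using inversion_iff_len[of t x] inversion_iff_len[of t "t \<otimes> x"] assms by auto
qed

definition edge :: "'w \<Rightarrow> 'w \<Rightarrow> bool" where
  "edge x y \<longleftrightarrow> (\<exists>t \<in> reflections C. y = x \<otimes> t \<and> len C x < len C y)"

abbreviation le :: "'w \<Rightarrow> 'w \<Rightarrow> bool" (infix \<open>\<preceq>\<close> 50) where
  "x \<preceq> y \<equiv> bruhat_le C x y"

lemma le_edge: "(\<preceq>) = edge\<^sup>*\<^sup>*"
  unfolding bruhat_le_def edge_def by (rule HOL.refl)

text \<open>The Bruhat order is defined by right multiplication with reflections, while inversions
  concern left multiplication; conjugation by \<open>x\<close> exchanges the two.\<close>

lemma edge_left: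
  assumes "x \<in> carrier C"
  shows "edge x y \<longleftrightarrow> (\<exists>t \<in> reflections C. y = t \<otimes> x \<and> len C x < len C y)"
proof
  assume "edge x y"
  then obtain t where t: "t \<in> reflections C" "y = x \<otimes> t" "len C x < len C y"
    by (auto simp: edge_def)
  moreover have "y = conj x t \<otimes> x" using t assms by (simp add: m_assoc)
  ultimately show "\<exists>t \<in> reflections C. y = t \<otimes> x \<and> len C x < len C y"
    using conj_reflection assms by blast
next
  assume "\<exists>t \<in> reflections C. y = t \<otimes> x \<and> len C x < len C y"
  then obtain t where t: "t \<in> reflections C" "y = t \<otimes> x" "len C x < len C y" by blast
  moreover have "y = x \<otimes> (inv x \<otimes> t \<otimes> x)" using t assms by (simp add: m_assoc)
  ultimately show "edge x y"
    unfolding edge_def using conj_inv_reflection assms by blast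
qed

lemma edge_closed: "\<lbrakk>edge x y; x \<in> carrier C\<rbrakk> \<Longrightarrow> y \<in> carrier C"
  by (auto simp: edge_def)

lemma edge_inv:
  assumes "edge x y" "x \<in> carrier C"
  shows "edge (inv x) (inv y)"
proof -
  obtain t where t: "t \<in> reflections C" "y = x \<otimes> t" "len C x < len C y"
    using assms by (auto simp: edge_def)
  then have "inv y = t \<otimes> inv x" using assms by (simp add: inv_mult_group)
  moreover have "len C (inv x) < len C (inv y)" using t edge_closed[OF assms] assms by simp
  moreover note t
  ultimately have "\<exists>t \<in> reflections C. inv y = t \<otimes> inv x \<and> len C (inv x) < len C (inv y)"
    by blast
  then show ?thesis using assms by (subst edge_left) auto
qed

lemma le_refl [simp, intro]: "x \<preceq> x"
  by (simp add: le_edge)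

lemma le_trans [trans]: "\<lbrakk>x \<preceq> y; y \<preceq> z\<rbrakk> \<Longrightarrow> x \<preceq> z"
  unfolding le_edge by (rule rtranclp_trans)

lemma le_closed: "\<lbrakk>x \<preceq> y; x \<in> carrier C\<rbrakk> \<Longrightarrow> y \<in> carrier C"
  unfolding le_edge by (induction rule: rtranclp_induct) (auto dest: edge_closed)

lemma le_len: "x \<preceq> y \<Longrightarrow> x = y \<or> len C x < len C y"
  unfolding le_edge by (induction rule: rtranclp_induct) (auto simp: edge_def)

lemma le_antisym: "\<lbrakk>x \<preceq> y; y \<preceq> x\<rbrakk> \<Longrightarrow> x = y"
  by (metis le_len less_asym)

lemma le_inv: "\<lbrakk>x \<preceq> y; x \<in> carrier C\<rbrakk> \<Longrightarrow> inv x \<preceq> inv y"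
  unfolding le_edge
proof (induction rule: rtranclp_induct)
  case (step y z)
  moreover have "y \<in> carrier C" using step le_closed by (simp add: le_edge)
  ultimately show ?case using edge_inv by (meson rtranclp.rtrancl_into_rtrancl)
qed simp

lemma le_gen: "\<lbrakk>s \<in> gens C; x \<in> carrier C; len C x < len C (s \<otimes> x)\<rbrakk> \<Longrightarrow> x \<preceq> s \<otimes> x"
  unfolding le_edge using edge_left gen_reflection by (intro r_into_rtranclp) blast

text \<open>The only inversion of \<open>s\<close> is \<open>s\<close> itself, and
  \<open>conj s t\<close> differs from it when \<open>s \<noteq> t\<close>. By the cocycle rule the
  non-inversion \<open>t\<close> of \<open>x\<close> becomes a non-inversion \<open>conj s t\<close>
  of \<open>s \<otimes> x\<close>, so the edge survives multiplication by \<open>s\<close>.\<close>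

lemma edge_lift:
  assumes "x \<in> carrier C" "s \<in> gens C" "t \<in> reflections C" "len C x < len C (t \<otimes> x)" "s \<noteq> t"
  shows "edge (s \<otimes> x) (s \<otimes> (t \<otimes> x))"
proof -
  have tc: "t \<in> carrier C" and sc: "s \<in> carrier C" using assms by auto
  have t': "conj s t \<in> reflections C" using assms conj_reflection by blast
  have eq: "conj s t \<otimes> (s \<otimes> x) = s \<otimes> (t \<otimes> x)"
    using assms tc sc by (simp add: m_assoc)
  have conj_back: "inv s \<otimes> conj s t \<otimes> s = t" using assms tc sc by (simp add: m_assoc)
  have "conj s t \<noteq> s"
  proof
    assume "conj s t = s"
    then have "t = inv s \<otimes> s \<otimes> s" using conj_back by simp
    then show False using assms sc by simp
  qed
  then have "\<not> inversion s (conj s t)" using inversion_gen assms t' by blast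
  moreover have "\<not> inversion x t" using inversion_iff_len assms by auto
  ultimately have "\<not> inversion (s \<otimes> x) (conj s t)"
    using inversion_mult[of s x "conj s t"] conj_back assms t' sc by simp
  then have "len C (s \<otimes> x) < len C (s \<otimes> (t \<otimes> x))"
    using inversion_iff_len[OF t', of "s \<otimes> x"] reflection_len_neq[OF t', of "s \<otimes> x"] assms sc eq
    by simp
  then show ?thesis using edge_left[of "s \<otimes> x"] t' eq assms sc by force
qed

subsection \<open>The star product\<close>

lemma star_gen_eq:
  assumes "s \<in> gens C" "x \<in> carrier C"
  shows "star_gen C s x = (if len C x < len C (s \<otimes> x) then s \<otimes> x else x)"
  using le_len[of x "s \<otimes> x"] le_gen[OF assms] by (auto simp: star_gen_def bruhat_less_def)

lemma star_gen_closed [simp]: "\<lbrakk>s \<in> gens C; x \<in> carrier C\<rbrakk> \<Longrightarrow> star_gen C s x \<in> carrier C"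
  by (simp add: star_gen_eq)

lemma le_star_gen: "\<lbrakk>s \<in> gens C; x \<in> carrier C\<rbrakk> \<Longrightarrow> x \<preceq> star_gen C s x"
  by (simp add: star_gen_eq le_gen)

lemma gen_le_star_gen:
  assumes "s \<in> gens C" "x \<in> carrier C"
  shows "s \<otimes> x \<preceq> star_gen C s x"
proof (cases "len C x < len C (s \<otimes> x)")
  case False
  then have "len C (s \<otimes> x) < len C x" using len_gen_cases[OF assms] by auto
  then show ?thesis using le_gen[of s "s \<otimes> x"] assms False by (simp add: star_gen_eq)
qed (use assms in \<open>simp add: star_gen_eq\<close>)

text \<open>The dual of \<open>star_gen\<close>: the Bruhat minimum of \<open>x\<close> and
  \<open>s \<otimes> x\<close>, used for the downward half of the lifting property.\<close>

definition gen_min :: "'w \<Rightarrow> 'w \<Rightarrow> 'w" where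
  "gen_min s x = (if len C x < len C (s \<otimes> x) then x else s \<otimes> x)"

lemma gen_min_le:
  assumes "s \<in> gens C" "x \<in> carrier C"
  shows "gen_min s x \<preceq> x" "gen_min s x \<preceq> s \<otimes> x"
  using le_gen[OF assms] le_gen[of s "s \<otimes> x"] len_gen_cases[OF assms] assms
  by (auto simp: gen_min_def)

lemma gen_min_cases: "gen_min s x = x \<or> gen_min s x = s \<otimes> x"
  by (simp add: gen_min_def)

text \<open>Along an edge \<open>z = t \<otimes> y\<close> with \<open>s \<noteq> t\<close>, both
  \<open>y\<close> and \<open>s \<otimes> y\<close> lie below \<open>star_gen C s z\<close>; with
  \<open>s = t\<close> the star action on \<open>y\<close> just climbs the edge.\<close>

lemma star_gen_mono:
  assumes "x \<preceq> y" "x \<in> carrier C" "s \<in> gens C"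
  shows "star_gen C s x \<preceq> star_gen C s y"
  using assms(1) unfolding le_edge
proof (induction rule: rtranclp_induct)
  case (step y z)
  have y: "y \<in> carrier C" using step le_closed assms by (simp add: le_edge)
  then have z: "z \<in> carrier C" using step edge_closed by blast
  obtain t where t: "t \<in> reflections C" "z = t \<otimes> y" "len C y < len C z"
    using step edge_left y by blast
  have "star_gen C s y \<preceq> star_gen C s z"
  proof (cases "s = t")
    case True
    have "star_gen C s y = z" using t y assms(3) True by (simp add: star_gen_eq)
    then show ?thesis using le_star_gen[OF assms(3) z] by simp
  next
    case False
    have "edge (s \<otimes> y) (s \<otimes> z)" using edge_lift[of y s t] t y assms(3) False by simp
    then have "s \<otimes> y \<preceq> s \<otimes> z" unfolding le_edge by blast
    then have "s \<otimes> y \<preceq> star_gen C s z" using gen_le_star_gen[OF assms(3) z] by (rule le_trans)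
    moreover have "y \<preceq> z" using step unfolding le_edge by blast
    then have "y \<preceq> star_gen C s z" using le_star_gen[OF assms(3) z] by (rule le_trans)
    ultimately show ?thesis using star_gen_eq[OF assms(3) y] by simp
  qed
  then show ?case using step.IH le_trans unfolding le_edge by (meson rtranclp_trans)
qed simp

lemma gen_min_mono:
  assumes "x \<preceq> y" "x \<in> carrier C" "s \<in> gens C"
  shows "gen_min s x \<preceq> gen_min s y"
  using assms(1) unfolding le_edge
proof (induction rule: rtranclp_induct)
  case (step y z)
  have y: "y \<in> carrier C" using step le_closed assms by (simp add: le_edge)
  then have z: "z \<in> carrier C" using step edge_closed by blast
  obtain t where t: "t \<in> reflections C" "z = t \<otimes> y" "len C y < len C z"
    using step edge_left y by blast
  have "gen_min s y \<preceq> gen_min s z"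
  proof (cases "s = t")
    case True
    then have "s \<otimes> z = y" using t y by simp
    then have "gen_min s z = y" using t by (simp add: gen_min_def)
    then show ?thesis using gen_min_le(1)[OF assms(3) y] by simp
  next
    case False
    have "edge (s \<otimes> y) (s \<otimes> z)" using edge_lift[of y s t] t y assms(3) False by simp
    then have "s \<otimes> y \<preceq> s \<otimes> z" unfolding le_edge by blast
    with gen_min_le(2)[OF assms(3) y] have "gen_min s y \<preceq> s \<otimes> z" by (rule le_trans)
    moreover have "y \<preceq> z" using step unfolding le_edge by blast
    with gen_min_le(1)[OF assms(3) y] have "gen_min s y \<preceq> z" by (rule le_trans)
    ultimately show ?thesis using gen_min_cases[of s z] by auto
  qed
  then show ?case using step.IH unfolding le_edge by (meson rtranclp_trans)
qed simp

text \<open>Monotonicity of the star action ends at \<open>star_gen C s y\<close>, which is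
  \<open>y\<close> because \<open>s\<close> is a descent of it.\<close>

lemma lift_up:
  assumes "x \<preceq> y" "x \<in> carrier C" "s \<in> gens C" "len C (s \<otimes> y) < len C y"
  shows "s \<otimes> x \<preceq> y"
proof -
  have y: "y \<in> carrier C" using assms le_closed by blast
  have "s \<otimes> x \<preceq> star_gen C s x" using gen_le_star_gen assms by blast
  also have "\<dots> \<preceq> star_gen C s y" using star_gen_mono assms by blast
  also have "\<dots> = y" using assms y by (simp add: star_gen_eq)
  finally show ?thesis .
qed

lemma lift_down:
  assumes "x \<preceq> y" "x \<in> carrier C" "s \<in> gens C" "len C x < len C (s \<otimes> x)"
  shows "x \<preceq> s \<otimes> y"
proof -
  have y: "y \<in> carrier C" using assms le_closed by blast
  have "x = gen_min s x" using assms by (simp add: gen_min_def)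
  also have "\<dots> \<preceq> gen_min s y" using gen_min_mono assms by blast
  also have "\<dots> \<preceq> s \<otimes> y" using gen_min_le assms y by blast
  finally show ?thesis .
qed

section \<open>Right-handed versions, obtained by inversion\<close>

lemma len_inv_gen:
  assumes "x \<in> carrier C" "s \<in> gens C"
  shows "len C (s \<otimes> inv x) = len C (x \<otimes> s)"
proof -
  have "inv (x \<otimes> s) = s \<otimes> inv x" using assms by (simp add: inv_mult_group)
  then show ?thesis using len_inv[of "x \<otimes> s"] assms by (metis gen_closed m_closed)
qed

lemma le_inv_iff: "\<lbrakk>x \<in> carrier C; y \<in> carrier C\<rbrakk> \<Longrightarrow> inv x \<preceq> inv y \<longleftrightarrow> x \<preceq> y"
  using le_inv[of x y] le_inv[of "inv x" "inv y"] by auto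

lemma lift_up_right:
  assumes "x \<preceq> y" "x \<in> carrier C" "s \<in> gens C" "len C (y \<otimes> s) < len C y"
  shows "x \<otimes> s \<preceq> y"
proof -
  have y: "y \<in> carrier C" using assms le_closed by blast
  have "s \<otimes> inv x \<preceq> inv y"
    using assms y le_inv by (intro lift_up) (simp_all add: len_inv_gen)
  moreover have "s \<otimes> inv x = inv (x \<otimes> s)" using assms by (simp add: inv_mult_group)
  ultimately show ?thesis using le_inv_iff[of "x \<otimes> s" y] assms y by simp
qed

lemma lift_down_right:
  assumes "x \<preceq> y" "x \<in> carrier C" "s \<in> gens C" "len C x < len C (x \<otimes> s)"
  shows "x \<preceq> y \<otimes> s"
proof -
  have y: "y \<in> carrier C" using assms le_closed by blast
  have "inv x \<preceq> s \<otimes> inv y"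
    using assms y le_inv by (intro lift_down) (simp_all add: len_inv_gen)
  moreover have "s \<otimes> inv y = inv (y \<otimes> s)" using assms y by (simp add: inv_mult_group)
  ultimately show ?thesis using le_inv_iff[of x "y \<otimes> s"] assms y by simp
qed

text \<open>Defined through inversion, so that the one-letter facts about the left action transfer
  to the right.\<close>

definition rstar :: "'w \<Rightarrow> 'w \<Rightarrow> 'w" where
  "rstar x s = inv (star_gen C s (inv x))"

lemma rstar_eq:
  assumes "s \<in> gens C" "x \<in> carrier C"
  shows "rstar x s = (if len C x < len C (x \<otimes> s) then x \<otimes> s else x)"
  using assms by (simp add: rstar_def star_gen_eq len_inv_gen inv_mult_group)

lemma rstar_closed [simp]: "\<lbrakk>s \<in> gens C; x \<in> carrier C\<rbrakk> \<Longrightarrow> rstar x s \<in> carrier C"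
  by (simp add: rstar_def)

lemma le_rstar: "\<lbrakk>s \<in> gens C; x \<in> carrier C\<rbrakk> \<Longrightarrow> x \<preceq> rstar x s"
  unfolding rstar_def using le_inv[OF le_star_gen[of s "inv x"]] by simp

lemma gen_le_rstar:
  assumes "s \<in> gens C" "x \<in> carrier C"
  shows "x \<otimes> s \<preceq> rstar x s"
  using le_inv[OF gen_le_star_gen[of s "inv x"]] assms by (simp add: rstar_def inv_mult_group)

lemma rstar_mono:
  assumes "x \<preceq> y" "x \<in> carrier C" "s \<in> gens C"
  shows "rstar x s \<preceq> rstar y s"
  unfolding rstar_def using assms le_inv[OF assms(1,2)] by (intro le_inv star_gen_mono) auto

text \<open>Both sides are the Bruhat maximum of \<open>{x, s x, x t, s x t}\<close>.\<close>

lemma star_gen_rstar: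
  assumes s: "s \<in> gens C" and t: "t \<in> gens C" and x: "x \<in> carrier C"
  shows "star_gen C s (rstar x t) = rstar (star_gen C s x) t"
proof -
  let ?L = "star_gen C s (rstar x t)" and ?R = "rstar (star_gen C s x) t"
  let ?A = "{x, s \<otimes> x, x \<otimes> t, s \<otimes> (x \<otimes> t)}"
  have st: "(s \<otimes> x) \<otimes> t = s \<otimes> (x \<otimes> t)" using s t x by (simp add: m_assoc)
  have inL: "?L \<in> ?A" using s t x by (simp add: star_gen_eq rstar_eq)
  have inR: "?R \<in> ?A" using s t x st by (simp add: star_gen_eq rstar_eq)
  have upL: "y \<preceq> ?L" if "y \<in> ?A" for y
  proof -
    have 1: "x \<preceq> ?L" using le_rstar[OF t x] le_star_gen[of s "rstar x t"] s t x le_trans by simp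
    have 2: "x \<otimes> t \<preceq> ?L"
      using gen_le_rstar[OF t x] le_star_gen[of s "rstar x t"] s t x le_trans by simp
    have 3: "s \<otimes> y \<preceq> ?L" if "y \<preceq> rstar x t" "y \<in> carrier C" for y
      using le_trans[OF gen_le_star_gen[OF s that(2)] star_gen_mono[OF that s]] .
    show ?thesis using that 1 2 3[OF le_rstar[OF t x] x] 3[OF gen_le_rstar[OF t x]] t x by auto
  qed
  have upR: "y \<preceq> ?R" if "y \<in> ?A" for y
  proof -
    have 1: "x \<preceq> ?R" using le_star_gen[OF s x] le_rstar[of t "star_gen C s x"] s t x le_trans by simp
    have 2: "s \<otimes> x \<preceq> ?R"
      using gen_le_star_gen[OF s x] le_rstar[of t "star_gen C s x"] s t x le_trans by simp
    have 3: "y \<otimes> t \<preceq> ?R" if "y \<preceq> star_gen C s x" "y \<in> carrier C" for y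
      using le_trans[OF gen_le_rstar[OF t that(2)] rstar_mono[OF that t]] .
    show ?thesis
      using that 1 2 3[OF le_star_gen[OF s x] x] 3[OF gen_le_star_gen[OF s x]] s x st by auto
  qed
  show ?thesis using le_antisym upL[OF inR] upR[OF inL] by blast
qed

abbreviation act :: "'w list \<Rightarrow> 'w \<Rightarrow> 'w" where
  "act ss x \<equiv> foldr (star_gen C) ss x"

lemma act_closed [simp]: "\<lbrakk>ss \<in> lists (gens C); x \<in> carrier C\<rbrakk> \<Longrightarrow> act ss x \<in> carrier C"
  by (induction ss) auto

lemma act_mono:
  assumes "x \<preceq> y" "x \<in> carrier C" "ss \<in> lists (gens C)"
  shows "act ss x \<preceq> act ss y"
  using assms(3)
proof (induction ss)
  case (Cons s ss)
  then show ?case using star_gen_mono[of "act ss x" "act ss y" s] assms(2) by simp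
qed (use assms in simp)

lemma foldl_rstar_closed [simp]:
  "\<lbrakk>ts \<in> lists (gens C); x \<in> carrier C\<rbrakk> \<Longrightarrow> foldl rstar x ts \<in> carrier C"
  by (induction ts arbitrary: x) auto

lemma foldl_rstar_mono:
  assumes "x \<preceq> y" "x \<in> carrier C" "ts \<in> lists (gens C)"
  shows "foldl rstar x ts \<preceq> foldl rstar y ts"
  using assms
proof (induction ts arbitrary: x y)
  case (Cons t ts)
  then show ?case using rstar_mono[of x y t] by simp
qed simp

lemma star_gen_foldl_rstar:
  "\<lbrakk>s \<in> gens C; ts \<in> lists (gens C); x \<in> carrier C\<rbrakk>
    \<Longrightarrow> star_gen C s (foldl rstar x ts) = foldl rstar (star_gen C s x) ts"
  by (induction ts arbitrary: x) (auto simp: star_gen_rstar)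

lemma act_foldl_rstar:
  "\<lbrakk>ss \<in> lists (gens C); ts \<in> lists (gens C); x \<in> carrier C\<rbrakk>
    \<Longrightarrow> act ss (foldl rstar x ts) = foldl rstar (act ss x) ts"
  by (induction ss) (auto simp: star_gen_foldl_rstar)

lemma act_len:
  assumes "ss \<in> lists (gens C)" "x \<in> carrier C"
  shows "len C (act ss x) \<le> length ss + len C x"
  using assms
proof (induction ss rule: list.induct)
  case (Cons s ss)
  then have "len C (act (s # ss) x) \<le> Suc (len C (act ss x))"
    using len_gen_cases[of s "act ss x"] by (auto simp: star_gen_eq)
  with Cons show ?case by auto
qed simp

text \<open>Each letter raises the length by at most one, so a total increase by
  \<open>length ss\<close> forces every single step upwards, and there the star action is plain
  multiplication.\<close>

lemma act_additive:
  assumes "ss \<in> lists (gens C)" "x \<in> carrier C" "len C (word_prod C ss \<otimes> x) = length ss + len C x"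
  shows "act ss x = word_prod C ss \<otimes> x"
  using assms
proof (induction ss rule: list.induct)
  case (Cons s ss)
  have s: "s \<in> gens C" and ss: "ss \<in> lists (gens C)" using Cons.prems by auto
  let ?y = "word_prod C ss \<otimes> x"
  have y: "?y \<in> carrier C" using ss assms(2) by blast
  have eq: "word_prod C (s # ss) \<otimes> x = s \<otimes> ?y" using s ss assms(2) by (simp add: m_assoc)
  have "len C ?y \<le> length ss + len C x"
    using len_mult_le[of "word_prod C ss" x] len_le[OF ss] ss assms(2) by simp
  moreover have "len C (s \<otimes> ?y) = Suc (length ss + len C x)"
    using Cons.prems(3) unfolding eq by simp
  ultimately have *: "len C ?y = length ss + len C x" "len C ?y < len C (s \<otimes> ?y)"
    using len_gen_cases[OF s y] by auto
  then have "act ss x = ?y" using Cons.IH ss assms(2) by blast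
  then show ?case using *(2) star_gen_eq[OF s y] eq by simp
qed simp

lemma act_reduced: "reduced_word C ss x \<Longrightarrow> act ss \<one> = x"
  using act_additive[of ss \<one>] word_prod_closed[of ss] by (auto simp: reduced_word_def)

lemma foldl_rstar_inv:
  "\<lbrakk>ts \<in> lists (gens C); x \<in> carrier C\<rbrakk> \<Longrightarrow> foldl rstar x ts = inv (act (rev ts) (inv x))"
  by (induction ts arbitrary: x) (auto simp: rstar_def)

lemma foldl_rstar_reduced:
  assumes "reduced_word C ts x"
  shows "foldl rstar \<one> ts = x"
proof -
  have ts: "ts \<in> lists (gens C)" "word_prod C ts = x" "length ts = len C x"
    using assms by (rule reduced_wordD)+
  then have x: "x \<in> carrier C" by blast
  have "reduced_word C (rev ts) (inv x)"
    using ts x word_prod_rev[OF ts(1)] by (auto simp: reduced_word_def)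
  then show ?thesis using act_reduced foldl_rstar_inv[OF ts(1), of \<one>] x by simp
qed

lemma act_some_reduced_word [simp]: "x \<in> carrier C \<Longrightarrow> act (some_reduced_word C x) \<one> = x"
  using act_reduced some_reduced_word by blast

section \<open>Associativity and monotonicity of the star product\<close>

lemma star_act: "star C x y = act (some_reduced_word C x) y"
  by (simp add: star_def)

lemma some_word_gens: "x \<in> carrier C \<Longrightarrow> some_reduced_word C x \<in> lists (gens C)"
  using some_reduced_word reduced_wordD(1) by blast

lemma star_closed [simp]: "\<lbrakk>x \<in> carrier C; y \<in> carrier C\<rbrakk> \<Longrightarrow> star C x y \<in> carrier C"
  by (simp add: star_act some_word_gens)

text \<open>Because the left and the right actions commute, the left action of a word on \<open>y\<close> can be
  read as the right action of a reduced word of \<open>y\<close> on the Demazure product of the word.\<close>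

lemma act_eq_foldl_rstar:
  assumes "ss \<in> lists (gens C)" "reduced_word C ts y"
  shows "act ss y = foldl rstar (act ss \<one>) ts"
  using act_foldl_rstar[of ss ts \<one>] foldl_rstar_reduced[OF assms(2)] reduced_wordD(1)[OF assms(2)]
    assms(1) by simp

lemma star_eq_foldl_rstar:
  assumes "x \<in> carrier C" "reduced_word C ts y"
  shows "star C x y = foldl rstar x ts"
  using act_eq_foldl_rstar[OF some_word_gens assms(2)] assms(1)
  by (simp add: star_act)

text \<open>Only the Demazure product \<open>act ss \<one>\<close> of the word matters, reduced or
  not. This frees \<open>star\<close> from the chosen reduced word, and associativity follows by
  concatenating words.\<close>

lemma star_eq_act:
  assumes "ss \<in> lists (gens C)" "y \<in> carrier C"
  shows "star C (act ss \<one>) y = act ss y"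
proof -
  obtain ts where ts: "reduced_word C ts y" using assms ex_reduced_word by blast
  show ?thesis using star_eq_foldl_rstar[OF _ ts] act_eq_foldl_rstar[OF assms(1) ts] assms by simp
qed

lemma star_one_right [simp]: "x \<in> carrier C \<Longrightarrow> star C x \<one> = x"
  by (simp add: star_act)

lemma star_assoc:
  assumes "x \<in> carrier C" "y \<in> carrier C" "z \<in> carrier C"
  shows "star C (star C x y) z = star C x (star C y z)"
proof -
  let ?u = "some_reduced_word C x" and ?v = "some_reduced_word C y"
  have "?u @ ?v \<in> lists (gens C)" using assms some_word_gens by simp
  moreover have "act (?u @ ?v) \<one> = star C x y"
    using assms by (simp add: star_act)
  ultimately have "star C (star C x y) z = act (?u @ ?v) z" using star_eq_act assms by metis
  then show ?thesis by (simp add: star_act)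
qed

text \<open>Monotone in the left factor when read as the right action of a fixed word of
  \<open>y\<close>, in the right factor when read as the left action of a fixed word of
  \<open>x'\<close>.\<close>

lemma star_mono:
  assumes "x \<preceq> x'" "y \<preceq> y'" "x \<in> carrier C" "y \<in> carrier C"
  shows "star C x y \<preceq> star C x' y'"
proof -
  have x': "x' \<in> carrier C" using assms le_closed by blast
  obtain ts where ts: "reduced_word C ts y" using assms ex_reduced_word by blast
  have "star C x y \<preceq> star C x' y"
    using foldl_rstar_mono[OF assms(1,3) reduced_wordD(1)[OF ts]] star_eq_foldl_rstar[OF _ ts] assms x'
    by simp
  also have "\<dots> \<preceq> star C x' y'"
    using act_mono[OF assms(2,4) some_word_gens[OF x']] by (simp add: star_act)
  finally show ?thesis .
qed

lemma len_star_le: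
  assumes "x \<in> carrier C" "y \<in> carrier C"
  shows "len C (star C x y) \<le> len C x + len C y"
  using act_len[OF some_word_gens[OF assms(1)] assms(2)] reduced_wordD(3)[OF some_reduced_word[OF assms(1)]]
  by (simp add: star_act)

lemma star_additive:
  assumes "x \<in> carrier C" "y \<in> carrier C" "len C (x \<otimes> y) = len C x + len C y"
  shows "star C x y = x \<otimes> y"
  using act_additive[OF some_word_gens[OF assms(1)] assms(2)] some_reduced_word[OF assms(1)] assms(3)
  by (simp add: star_act reduced_word_def)

lemma star_gen_star:
  assumes "s \<in> gens C" "x \<in> carrier C" "y \<in> carrier C"
  shows "star_gen C s (star C x y) = star C (star_gen C s x) y"
proof -
  let ?u = "some_reduced_word C x"
  have "act (s # ?u) \<one> = star_gen C s x"
    using assms by simp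
  moreover have "s # ?u \<in> lists (gens C)" using assms some_word_gens by simp
  ultimately have "star C (star_gen C s x) y = act (s # ?u) y"
    using star_eq_act[of "s # ?u" y] assms by metis
  then show ?thesis by (simp add: star_act)
qed

lemma rstar_star:
  assumes "s \<in> gens C" "x \<in> carrier C" "y \<in> carrier C"
  shows "rstar (star C x y) s = star C x (rstar y s)"
  using act_foldl_rstar[of "some_reduced_word C x" "[s]" y] some_word_gens[of x] assms
  by (simp add: star_act)

lemma star_one_left [simp]: "y \<in> carrier C \<Longrightarrow> star C \<one> y = y"
  using reduced_wordD(3)[OF some_reduced_word[of \<one>]] by (simp add: star_act)

lemma len_gen_neq: "\<lbrakk>s \<in> gens C; x \<in> carrier C\<rbrakk> \<Longrightarrow> len C (s \<otimes> x) \<noteq> len C x"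
  using len_gen_cases[of s x] by linarith

lemma len_gen_neq_right: "\<lbrakk>s \<in> gens C; x \<in> carrier C\<rbrakk> \<Longrightarrow> len C (x \<otimes> s) \<noteq> len C x"
  using len_gen_neq[of s "inv x"] len_inv_gen[of x s] by simp

subsection \<open>Parabolic subgroups\<close>

abbreviation par :: "'w set \<Rightarrow> 'w set" where
  "par I \<equiv> generate C I"

text \<open>The working criterion for being maximal in a coset; by \<open>ldesc_iff_star_gen\<close>
  it says that the star action of \<open>I\<close> fixes \<open>x\<close>.\<close>

definition ldesc :: "'w set \<Rightarrow> 'w \<Rightarrow> bool" where
  "ldesc I x \<longleftrightarrow> (\<forall>s \<in> I. len C (s \<otimes> x) < len C x)"

definition rdesc :: "'w set \<Rightarrow> 'w \<Rightarrow> bool" where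
  "rdesc I x \<longleftrightarrow> (\<forall>s \<in> I. len C (x \<otimes> s) < len C x)"

lemma rdesc_iff_inv: "\<lbrakk>I \<subseteq> gens C; x \<in> carrier C\<rbrakk> \<Longrightarrow> rdesc I x \<longleftrightarrow> ldesc I (inv x)"
  unfolding rdesc_def ldesc_def using len_inv_gen by (metis len_inv subset_iff)

lemma ldesc_iff_star_gen:
  assumes "I \<subseteq> gens C" "x \<in> carrier C"
  shows "ldesc I x \<longleftrightarrow> (\<forall>s \<in> I. star_gen C s x = x)"
proof -
  have "len C (s \<otimes> x) < len C x \<longleftrightarrow> star_gen C s x = x" if "s \<in> I" for s
  proof -
    have s: "s \<in> gens C" using that assms by blast
    have "s \<otimes> x \<noteq> x" using len_gen_cases[OF s assms(2)] by (metis n_not_Suc_n)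
    then have "star_gen C s x = x \<longleftrightarrow> \<not> len C x < len C (s \<otimes> x)"
      using star_gen_eq[OF s assms(2)] by presburger
    then show ?thesis using len_gen_cases[OF s assms(2)] by linarith
  qed
  then show ?thesis by (simp add: ldesc_def)
qed

lemma rdesc_iff_rstar:
  assumes "I \<subseteq> gens C" "x \<in> carrier C"
  shows "rdesc I x \<longleftrightarrow> (\<forall>s \<in> I. rstar x s = x)"
proof -
  have "star_gen C s (inv x) = inv x \<longleftrightarrow> rstar x s = x" if "s \<in> I" for s
  proof -
    have s: "s \<in> gens C" using that assms by blast
    show ?thesis unfolding rstar_def using s assms(2) by (metis inv_closed inv_inv star_gen_closed)
  qed
  then show ?thesis using rdesc_iff_inv[OF assms] ldesc_iff_star_gen[OF assms(1), of "inv x"] assms(2)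
    by simp
qed

lemma par_closed: "I \<subseteq> gens C \<Longrightarrow> par I \<subseteq> carrier C"
  using generate_incl gens_carrier by blast

lemma par_elem [intro]: "\<lbrakk>I \<subseteq> gens C; u \<in> par I\<rbrakk> \<Longrightarrow> u \<in> carrier C"
  using par_closed by blast

lemma par_inv: "\<lbrakk>I \<subseteq> gens C; u \<in> par I\<rbrakk> \<Longrightarrow> inv u \<in> par I"
  using generate_m_inv_closed[of I] gens_carrier by blast

lemma par_induct [consumes 2, case_names one step]:
  assumes "I \<subseteq> gens C" "u \<in> par I" "P \<one>"
    and "\<And>s v. \<lbrakk>s \<in> I; v \<in> par I; P v\<rbrakk> \<Longrightarrow> P (s \<otimes> v)"
  shows "P u"
proof -
  obtain ss where "ss \<in> lists I" "word_prod C ss = u"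
    using generate_iff_word[OF assms(1)] assms(2) by blast
  then show ?thesis
  proof (induction ss arbitrary: u rule: list.induct)
    case (Cons s ss)
    then have "word_prod C ss \<in> par I" using generate_iff_word[OF assms(1)] by auto
    with Cons assms(4) show ?case by auto
  qed (use assms(3) in simp)
qed

text \<open>If prepending \<open>s\<close> shortens \<open>v\<close>, exchange deletes a letter from
  a reduced word over \<open>I\<close>, and the result is still a word over
  \<open>I\<close>.\<close>

lemma ex_reduced_word_par:
  assumes "I \<subseteq> gens C" "u \<in> par I"
  shows "\<exists>ss \<in> lists I. reduced_word C ss u"
  using assms
proof (induction rule: par_induct)
  case one
  then show ?case by (intro bexI[of _ "[]"]) (simp_all add: reduced_word_def)
next
  case (step s v)
  then obtain ss where "ss \<in> lists I" "reduced_word C ss v" by blast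
  then have ss: "ss \<in> lists I" "ss \<in> lists (gens C)" "word_prod C ss = v" "length ss = len C v"
    by (auto simp: reduced_word_def)
  have s: "s \<in> gens C" and v: "v \<in> carrier C" using step assms(1) ss by blast+
  show ?case
  proof (cases "len C (s \<otimes> v) < len C v")
    case True
    then have "inversion (word_prod C ss) s" using inversion_iff_len gen_reflection s v ss(3) by simp
    then obtain us a vs where d: "ss = us @ a # vs" "s \<otimes> word_prod C ss = word_prod C (us @ vs)"
      using inversion_delete[OF ss(2)] s by blast
    have "length (us @ vs) = len C (s \<otimes> v)" using d(1) ss(4) True len_gen_cases[OF s v] by simp
    moreover have "us @ vs \<in> lists I" "us @ vs \<in> lists (gens C)" using d(1) ss by auto
    ultimately show ?thesis using d(2) ss(3) unfolding reduced_word_def by metis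
  next
    case False
    then have "length (s # ss) = len C (s \<otimes> v)" using len_gen_cases[OF s v] ss(4) by simp
    then show ?thesis using s ss step(1) by (intro bexI[of _ "s # ss"]) (auto simp: reduced_word_def)
  qed
qed

lemma par_mult_le:
  assumes "I \<subseteq> gens C" "u \<in> par I" "ldesc I z" "x \<preceq> z" "x \<in> carrier C"
  shows "u \<otimes> x \<preceq> z"
  using assms(1,2)
proof (induction rule: par_induct)
  case (step s v)
  have "s \<in> gens C" "v \<in> carrier C" using step assms(1) by blast+
  then show ?case
    using lift_up[OF step(3), of s] assms(3,5) step(1) by (simp add: ldesc_def m_assoc)
qed (use assms in simp)

lemma one_le: "x \<in> carrier C \<Longrightarrow> \<one> \<preceq> x"
proof -
  assume x: "x \<in> carrier C"
  have "\<one> \<preceq> act ss \<one>" if "ss \<in> lists (gens C)" for ss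
    using that
  proof (induction ss rule: list.induct)
    case (Cons s ss)
    then have "act ss \<one> \<preceq> act (s # ss) \<one>" by (simp add: le_star_gen)
    with Cons show ?case by (auto intro: le_trans)
  qed simp
  from this[OF some_word_gens[OF x]] show ?thesis using x by simp
qed

lemma ldesc_par_max:
  assumes "I \<subseteq> gens C" "v \<in> par I" "ldesc I v" "u \<in> par I"
  shows "u \<preceq> v"
  using par_mult_le[OF assms(1,4,3) one_le] par_elem[OF assms(1)] assms(2,4) by simp

text \<open>Absorbing letters one by one, an element of \<open>par I\<close> with all descents in
  \<open>I\<close> dominates the whole subgroup in Bruhat order, so it is strictly longer than every
  other element. This trades the length condition in \<open>longest\<close> for a local
  test.\<close>

lemma longest_eqI:
  assumes "I \<subseteq> gens C" "v \<in> par I" "ldesc I v"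
  shows "longest C I = v"
  unfolding longest_def
proof (rule the_equality)
  show "v \<in> par I \<and> (\<forall>y \<in> par I. len C y \<le> len C v)"
    using ldesc_par_max[OF assms] le_len assms(2) by fastforce
  fix x assume "x \<in> par I \<and> (\<forall>y \<in> par I. len C y \<le> len C x)"
  then show "x = v" using ldesc_par_max[OF assms, of x] le_len[of x v] assms(2) by fastforce
qed

lemma finitaryD: "finitary C I \<Longrightarrow> I \<subseteq> gens C" "finitary C I \<Longrightarrow> finite (par I)"
  by (auto simp: finitary_def)

lemma ex_max_len:
  assumes "finite A" "x \<in> A"
  shows "\<exists>v \<in> A. \<forall>y \<in> A. len C y \<le> len C v"
proof -
  have "Max (len C ` A) \<in> len C ` A" using assms by (intro Max_in) auto
  then obtain v where "v \<in> A" "len C v = Max (len C ` A)" by force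
  then show ?thesis using assms(1) by (intro bexI[of _ v]) auto
qed

lemma longest_par_ldesc:
  assumes "finitary C I"
  shows "longest C I \<in> par I \<and> ldesc I (longest C I)"
proof -
  have I: "I \<subseteq> gens C" and fin: "finite (par I)" using assms by (auto simp: finitary_def)
  have "\<one> \<in> par I" by (rule generate.one)
  then obtain v where v: "v \<in> par I" "\<And>y. y \<in> par I \<Longrightarrow> len C y \<le> len C v"
    using ex_max_len[OF fin] by blast
  have "ldesc I v"
    unfolding ldesc_def
  proof
    fix s assume s: "s \<in> I"
    then have "s \<otimes> v \<in> par I" using v(1) by (blast intro: generate.eng generate.incl)
    then have "len C (s \<otimes> v) \<le> len C v" by (rule v(2))
    moreover have "len C (s \<otimes> v) \<noteq> len C v" using len_gen_neq s I v(1) by blast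
    ultimately show "len C (s \<otimes> v) < len C v" by simp
  qed
  then show ?thesis using longest_eqI[OF I v(1)] v(1) by simp
qed

lemma longest_closed [simp]: "finitary C I \<Longrightarrow> longest C I \<in> carrier C"
  using longest_par_ldesc finitaryD by blast

text \<open>The inverse lies below the longest element and has the same length.\<close>

lemma longest_inv:
  assumes "finitary C I"
  shows "inv (longest C I) = longest C I"
proof -
  have I: "I \<subseteq> gens C" by (rule finitaryD[OF assms])
  let ?w = "longest C I"
  have w: "?w \<in> par I" "ldesc I ?w" "?w \<in> carrier C" using longest_par_ldesc assms by auto
  have "inv ?w \<preceq> ?w" using ldesc_par_max[OF I w(1,2) par_inv[OF I w(1)]] .
  then show ?thesis using le_len[of "inv ?w" ?w] w(3) by simp
qed

lemma longest_rdesc: "finitary C I \<Longrightarrow> rdesc I (longest C I)"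
  using rdesc_iff_inv[of I "longest C I"] longest_inv longest_par_ldesc finitaryD by simp

text \<open>The longest element has a reduced word over \<open>I\<close>, and each of its letters
  fixes \<open>z\<close> under the star action.\<close>

lemma star_longest:
  assumes "finitary C I" "z \<in> carrier C" "ldesc I z"
  shows "star C (longest C I) z = z"
proof -
  have I: "I \<subseteq> gens C" by (rule finitaryD[OF assms(1)])
  obtain ss where ss: "ss \<in> lists I" "reduced_word C ss (longest C I)"
    using ex_reduced_word_par[OF I] longest_par_ldesc[OF assms(1)] by blast
  have "act us z = z" if "us \<in> lists I" for us
    using that ldesc_iff_star_gen[OF I assms(2)] assms(3) by (induction us rule: list.induct) auto
  moreover have "star C (act ss \<one>) z = act ss z"
    using star_eq_act[OF reduced_wordD(1)[OF ss(2)] assms(2)] .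
  ultimately show ?thesis using act_reduced[OF ss(2)] ss(1) by simp
qed

lemma star_longest_right:
  assumes "finitary C I" "z \<in> carrier C" "rdesc I z"
  shows "star C z (longest C I) = z"
proof -
  have I: "I \<subseteq> gens C" by (rule finitaryD[OF assms(1)])
  obtain ss where ss: "ss \<in> lists I" "reduced_word C ss (longest C I)"
    using ex_reduced_word_par[OF I] longest_par_ldesc[OF assms(1)] by blast
  have "foldl rstar z us = z" if "us \<in> lists I" for us
    using that rdesc_iff_rstar[OF I assms(2)] assms(3) by (induction us rule: list.induct) auto
  then show ?thesis using star_eq_foldl_rstar[OF assms(2) ss(2)] ss(1) by simp
qed

text \<open>Prepend the letters of a reduced word of \<open>u\<close> one at a time. The new letter
  \<open>s\<close> is no inversion of the part \<open>v\<close> read so far, as the word is reduced,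
  and \<open>inv v \<otimes> s \<otimes> v\<close> is a reflection in \<open>par I\<close>, hence no
  inversion of the minimal \<open>x\<close>. The cocycle rule then makes the length grow.\<close>

lemma par_min_additive:
  assumes I: "I \<subseteq> gens C" and x: "x \<in> carrier C"
    and min: "\<And>u. u \<in> par I \<Longrightarrow> len C x \<le> len C (u \<otimes> x)" and "u \<in> par I"
  shows "len C (u \<otimes> x) = len C u + len C x"
proof -
  obtain ss where ss: "ss \<in> lists I" "reduced_word C ss u"
    using ex_reduced_word_par[OF I assms(4)] by blast
  have "len C (word_prod C us \<otimes> x) = length us + len C x"
    if "us \<in> lists I" "length us = len C (word_prod C us)" for us
    using that
  proof (induction us rule: list.induct)
    case (Cons s us)
    have us: "us \<in> lists I" "us \<in> lists (gens C)" and s: "s \<in> I" "s \<in> gens C"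
      using Cons.prems I by auto
    let ?v = "word_prod C us"
    have v: "?v \<in> par I" "?v \<in> carrier C" using us generate_iff_word[OF I] by blast+
    have vx: "?v \<otimes> x \<in> carrier C" using v x by blast
    have sv: "len C (s \<otimes> ?v) = Suc (length us)" using Cons.prems(2) by simp
    then have lv: "len C ?v = length us" using len_le[OF us(2)] len_gen_cases[OF s(2) v(2)] by auto
    then have IH: "len C (?v \<otimes> x) = length us + len C x" using Cons.IH us by simp
    have sr: "s \<in> reflections C" using gen_reflection s by blast
    have "\<not> inversion ?v s" using inversion_iff_len[OF sr v(2)] sv lv by simp
    moreover have "\<not> inversion x (inv ?v \<otimes> s \<otimes> ?v)"
    proof -
      have "inv ?v \<otimes> s \<otimes> ?v \<in> par I"
        using par_inv[OF I v(1)] v(1) s(1) by (blast intro: generate.eng generate.incl)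
      then show ?thesis
        using inversion_iff_len[OF conj_inv_reflection[OF sr v(2)] x] min by fastforce
    qed
    ultimately have "\<not> inversion (?v \<otimes> x) s"
      using inversion_mult[OF v(2) x] s(2) by simp
    then have "\<not> len C (s \<otimes> (?v \<otimes> x)) < len C (?v \<otimes> x)" using inversion_iff_len[OF sr vx] by simp
    then have "len C (s \<otimes> (?v \<otimes> x)) = Suc (len C (?v \<otimes> x))" using len_gen_cases[OF s(2) vx] by auto
    then show ?case using IH s v x by (simp add: m_assoc)
  qed (use x in simp)
  then show ?thesis using ss by (auto simp: reduced_word_def)
qed

text \<open>Take \<open>x\<close> of least length among the products of \<open>par I\<close> with
  \<open>z\<close>. Lengths add over \<open>x\<close>, so the descents of \<open>z\<close> in
  \<open>I\<close> become descents of the complementary factor, which must be the longest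
  element.\<close>

lemma longest_factor:
  assumes "finitary C I" "z \<in> carrier C" "ldesc I z"
  shows "\<exists>x \<in> carrier C. z = longest C I \<otimes> x \<and> len C z = ell C I + len C x"
proof -
  have I: "I \<subseteq> gens C" by (rule finitaryD[OF assms(1)])
  obtain u where u: "u \<in> par I" "\<And>v. v \<in> par I \<Longrightarrow> len C (u \<otimes> z) \<le> len C (v \<otimes> z)"
    using ex_has_least_nat[of "\<lambda>u. u \<in> par I" \<one> "\<lambda>u. len C (u \<otimes> z)"] generate.one by metis
  let ?x = "u \<otimes> z" and ?v = "inv u"
  have uc: "u \<in> carrier C" using u I by blast
  have x: "?x \<in> carrier C" using uc assms(2) by blast
  have min: "len C ?x \<le> len C (v \<otimes> ?x)" if "v \<in> par I" for v
    using u(2)[OF generate.eng[OF that u(1)]] par_elem[OF I that] uc assms(2) by (simp add: m_assoc)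
  have vI: "?v \<in> par I" using par_inv[OF I u(1)] .
  have z: "z = ?v \<otimes> ?x" using uc assms(2) by simp
  have lz: "len C z = len C ?v + len C ?x" using par_min_additive[OF I x min vI] z by simp
  have "ldesc I ?v"
    unfolding ldesc_def
  proof
    fix s assume s: "s \<in> I"
    have sc: "s \<in> carrier C" using s I by blast
    have "len C (s \<otimes> ?v \<otimes> ?x) = len C (s \<otimes> ?v) + len C ?x"
      using par_min_additive[OF I x min generate.eng[OF generate.incl[OF s] vI]] .
    moreover have "s \<otimes> ?v \<otimes> ?x = s \<otimes> z" using sc uc assms(2) by (simp add: m_assoc)
    ultimately show "len C (s \<otimes> ?v) < len C ?v" using assms(3) s lz unfolding ldesc_def by fastforce
  qed
  then have "?v = longest C I" using longest_eqI[OF I vI] by simp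
  then show ?thesis using z lz x unfolding ell_def by metis
qed

lemma longest_factor_right:
  assumes "finitary C I" "z \<in> carrier C" "rdesc I z"
  shows "\<exists>x \<in> carrier C. z = x \<otimes> longest C I \<and> len C z = len C x + ell C I"
proof -
  have "ldesc I (inv z)" using rdesc_iff_inv[OF finitaryD(1)] assms by blast
  then obtain x where x: "x \<in> carrier C" "inv z = longest C I \<otimes> x" "len C (inv z) = ell C I + len C x"
    using longest_factor[OF assms(1)] assms(2) by blast
  have "z = inv (longest C I \<otimes> x)" using x(2) assms(2) by (metis inv_inv)
  also have "\<dots> = inv x \<otimes> longest C I" using x assms(1) longest_inv by (simp add: inv_mult_group)
  finally have "z = inv x \<otimes> longest C I" .
  moreover have "len C z = len C (inv x) + ell C I" using x(1,3) assms(2) by simp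
  ultimately show ?thesis using x(1) by blast
qed

text \<open>The longest element of \<open>K\<close> ends in that of \<open>L\<close> with lengths
  adding, so the quotient is the complementary factor. Integers allow the telescoping in
  \<open>turn_factors_len\<close>.\<close>

lemma len_longest_quotient:
  assumes "finitary C K" "finitary C L" "L \<subseteq> K"
  shows "int (len C (longest C K \<otimes> inv (longest C L))) = int (ell C K) - int (ell C L)"
proof -
  have "rdesc L (longest C K)" using longest_rdesc[OF assms(1)] assms(3) by (auto simp: rdesc_def)
  then obtain x where "x \<in> carrier C" "longest C K = x \<otimes> longest C L"
      "len C (longest C K) = len C x + ell C L"
    using longest_factor_right[OF assms(2) longest_closed[OF assms(1)]] by blast
  then show ?thesis using assms(2) by (simp add: m_assoc ell_def)
qed

subsection \<open>Double cosets\<close>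

definition dcos :: "'w set \<Rightarrow> 'w set \<Rightarrow> 'w \<Rightarrow> 'w set" where
  "dcos I J x = {u \<otimes> x \<otimes> v | u v. u \<in> par I \<and> v \<in> par J}"

lemma dcos_eq: "(par I #> x) <#> par J = dcos I J x"
  unfolding dcos_def r_coset_def set_mult_def by blast

lemma dcosI: "\<lbrakk>u \<in> par I; v \<in> par J\<rbrakk> \<Longrightarrow> u \<otimes> x \<otimes> v \<in> dcos I J x"
  unfolding dcos_def by blast

lemma is_coset_iff:
  "is_coset C (p, I, J) \<longleftrightarrow> finitary C I \<and> finitary C J \<and> (\<exists>x \<in> carrier C. p = dcos I J x)"
  by (simp add: dcos_eq)

lemma dcos_self: "x \<in> carrier C \<Longrightarrow> x \<in> dcos I J x"
  using dcosI[of \<one> I \<one> J x] by (simp add: generate.one)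

lemma dcos_trans:
  assumes "I \<subseteq> gens C" "J \<subseteq> gens C" "x \<in> carrier C" "y \<in> dcos I J x" "z \<in> dcos I J y"
  shows "z \<in> dcos I J x"
proof -
  obtain u v where uv: "u \<in> par I" "v \<in> par J" "y = u \<otimes> x \<otimes> v" using assms(4) dcos_def by auto
  obtain u' v' where uv': "u' \<in> par I" "v' \<in> par J" "z = u' \<otimes> y \<otimes> v'" using assms(5) dcos_def by auto
  have c: "u \<in> carrier C" "v \<in> carrier C" "u' \<in> carrier C" "v' \<in> carrier C"
    using uv uv' par_elem assms(1,2) by blast+
  have "z = (u' \<otimes> u) \<otimes> x \<otimes> (v \<otimes> v')" using uv(3) uv'(3) c assms(3) by (simp add: m_assoc)
  then show ?thesis using dcosI[OF generate.eng[OF uv'(1) uv(1)] generate.eng[OF uv(2) uv'(2)]] by simp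
qed

lemma dcos_sym:
  assumes "I \<subseteq> gens C" "J \<subseteq> gens C" "x \<in> carrier C" "y \<in> dcos I J x"
  shows "x \<in> dcos I J y"
proof -
  obtain u v where uv: "u \<in> par I" "v \<in> par J" "y = u \<otimes> x \<otimes> v" using assms(4) dcos_def by auto
  have c: "u \<in> carrier C" "v \<in> carrier C" using uv par_elem assms(1,2) by blast+
  have "x = inv u \<otimes> y \<otimes> inv v" using uv(3) c assms(3) by (simp add: m_assoc)
  then show ?thesis using dcosI[OF par_inv[OF assms(1) uv(1)] par_inv[OF assms(2) uv(2)]] by metis
qed

lemma dcos_closed:
  assumes "I \<subseteq> gens C" "J \<subseteq> gens C" "x \<in> carrier C" "y \<in> dcos I J x"
  shows "y \<in> carrier C"
proof -
  obtain u v where "u \<in> par I" "v \<in> par J" "y = u \<otimes> x \<otimes> v" using assms(4) dcos_def by auto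
  then show ?thesis using par_elem[OF assms(1)] par_elem[OF assms(2)] assms(3) by simp
qed

lemma dcos_cong:
  assumes "I \<subseteq> gens C" "J \<subseteq> gens C" "x \<in> carrier C" "y \<in> dcos I J x"
  shows "dcos I J y = dcos I J x"
proof -
  have "y \<in> carrier C" "x \<in> dcos I J y" using dcos_closed[OF assms] dcos_sym[OF assms] .
  then show ?thesis using dcos_trans[OF assms(1,2)] assms(3,4) by blast
qed

lemma dcos_gen_left:
  assumes "I \<subseteq> gens C" "J \<subseteq> gens C" "x \<in> carrier C" "y \<in> dcos I J x" "s \<in> I"
  shows "s \<otimes> y \<in> dcos I J x"
proof -
  have "s \<otimes> y \<otimes> \<one> \<in> dcos I J y" using assms(5) by (intro dcosI generate.incl generate.one)
  moreover have "s \<otimes> y \<in> carrier C" using dcos_closed[OF assms(1-4)] assms(1,5) by blast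
  ultimately show ?thesis using dcos_trans[OF assms(1-4)] by simp
qed

lemma dcos_gen_right:
  assumes "I \<subseteq> gens C" "J \<subseteq> gens C" "x \<in> carrier C" "y \<in> dcos I J x" "s \<in> J"
  shows "y \<otimes> s \<in> dcos I J x"
proof -
  have "\<one> \<otimes> y \<otimes> s \<in> dcos I J y" using assms(5) by (intro dcosI generate.incl generate.one)
  then show ?thesis using dcos_trans[OF assms(1-4)] dcos_closed[OF assms(1-4)] by simp
qed

lemma dcos_induct [consumes 4, case_names base left right]:
  assumes I: "I \<subseteq> gens C" and J: "J \<subseteq> gens C" and x: "x \<in> carrier C" and "y \<in> dcos I J x"
    and base: "P x"
    and left: "\<And>s y. \<lbrakk>s \<in> I; y \<in> carrier C; P y\<rbrakk> \<Longrightarrow> P (s \<otimes> y)"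
    and right: "\<And>s y. \<lbrakk>s \<in> J; y \<in> carrier C; P y\<rbrakk> \<Longrightarrow> P (y \<otimes> s)"
  shows "P y"
proof -
  obtain u v where uv: "u \<in> par I" "v \<in> par J" "y = u \<otimes> x \<otimes> v" using assms(4) dcos_def by auto
  \<comment> \<open>Generalised over \<open>y\<close>: peeling the first letter \<open>s\<close> off
    \<open>v\<close> multiplies \<open>y\<close> by \<open>s\<close> on the right before the rest
    follows.\<close>
  have *: "P (y \<otimes> v)" if "y \<in> carrier C" "P y" for y
    using J uv(2) that
  proof (induction arbitrary: y rule: par_induct)
    case (step s v)
    have "s \<in> carrier C" "v \<in> carrier C" using step(1,2) J by blast+
    then show ?case using step.IH[of "y \<otimes> s"] step right by (simp add: m_assoc)
  qed simp
  have "P (u \<otimes> x)"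
    using I uv(1)
  proof (induction rule: par_induct)
    case (step s u)
    have "s \<in> carrier C" "u \<in> carrier C" using step(1,2) I by blast+
    then show ?case using step left[of s "u \<otimes> x"] x by (simp add: m_assoc)
  qed (use base x in simp)
  then show ?thesis using *[of "u \<otimes> x"] uv x par_elem[OF I] by simp
qed

text \<open>Each step of \<open>dcos_induct\<close> multiplies by a descent of \<open>z\<close>, and
  the lifting property keeps the product below \<open>z\<close>.\<close>

lemma dcos_le:
  assumes "I \<subseteq> gens C" "J \<subseteq> gens C" "x \<in> carrier C" "y \<in> dcos I J x"
    and "x \<preceq> z" "ldesc I z" "rdesc J z"
  shows "y \<preceq> z"
  using assms(1-4)
proof (induction rule: dcos_induct)
  case (left s y)
  then show ?case using lift_up[of y z s] assms(1,6) by (auto simp: ldesc_def)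
next
  case (right s y)
  then show ?case using lift_up_right[of y z s] assms(2,7) by (auto simp: rdesc_def)
qed (use assms in simp)

lemma le_dcos:
  assumes "I \<subseteq> gens C" "J \<subseteq> gens C" "x \<in> carrier C" "y \<in> dcos I J x"
    and "z \<preceq> x" "z \<in> carrier C" "\<forall>s \<in> I. len C z < len C (s \<otimes> z)" "\<forall>s \<in> J. len C z < len C (z \<otimes> s)"
  shows "z \<preceq> y"
  using assms(1-4)
proof (induction rule: dcos_induct)
  case (left s y)
  then show ?case using lift_down[of z y s] assms(1,6,7) by auto
next
  case (right s y)
  then show ?case using lift_down_right[of z y s] assms(2,6,8) by auto
qed (use assms in simp)

lemma max_elt_eqI:
  assumes "I \<subseteq> gens C" "J \<subseteq> gens C" "x \<in> carrier C" "z \<in> dcos I J x" "ldesc I z" "rdesc J z"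
  shows "max_elt C (dcos I J x, I, J) = z"
proof -
  have z: "z \<in> carrier C" using dcos_closed[OF assms(1-4)] .
  have "y \<preceq> z" if "y \<in> dcos I J x" for y
    using dcos_le[OF assms(1,2) z, of y z] that dcos_cong[OF assms(1-4)] assms(5,6) by simp
  then show ?thesis unfolding max_elt_def fst_conv using assms(4) by (intro the_equality) (blast intro: le_antisym)+
qed

text \<open>A double coset of finite parabolics is finite, so it has an element of largest length.
  Its descents follow from this choice, and the lifting property upgrades it to the Bruhat
  maximum.\<close>

lemma max_elt:
  assumes "is_coset C (p, I, J)"
  shows "max_elt C (p, I, J) \<in> p \<and> ldesc I (max_elt C (p, I, J)) \<and> rdesc J (max_elt C (p, I, J))"
proof -
  obtain x where fin: "finitary C I" "finitary C J" and x: "x \<in> carrier C" "p = dcos I J x"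
    using assms is_coset_iff by blast
  have I: "I \<subseteq> gens C" and J: "J \<subseteq> gens C" using fin finitaryD by blast+
  have "p = (\<lambda>(u, v). u \<otimes> x \<otimes> v) ` (par I \<times> par J)" using x(2) by (auto simp: dcos_def)
  then have "finite p" using finitaryD(2)[OF fin(1)] finitaryD(2)[OF fin(2)] by simp
  moreover have "x \<in> p" using dcos_self x by blast
  ultimately obtain z where z: "z \<in> p" "\<And>y. y \<in> p \<Longrightarrow> len C y \<le> len C z"
    using ex_max_len[of p x] by blast
  have zc: "z \<in> carrier C" using dcos_closed[OF I J x(1)] z(1) x(2) by simp
  have "ldesc I z"
    unfolding ldesc_def
  proof
    fix s assume s: "s \<in> I"
    then have "len C (s \<otimes> z) \<le> len C z" using z dcos_gen_left[OF I J x(1)] x(2) by simp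
    moreover have "len C (s \<otimes> z) \<noteq> len C z" using len_gen_neq s I zc by blast
    ultimately show "len C (s \<otimes> z) < len C z" by simp
  qed
  moreover have "rdesc J z"
    unfolding rdesc_def
  proof
    fix s assume s: "s \<in> J"
    then have "len C (z \<otimes> s) \<le> len C z" using z dcos_gen_right[OF I J x(1)] x(2) by simp
    moreover have "len C (z \<otimes> s) \<noteq> len C z" using len_gen_neq_right s J zc by blast
    ultimately show "len C (z \<otimes> s) < len C z" by simp
  qed
  ultimately show ?thesis using max_elt_eqI[OF I J x(1)] z(1) x(2) by simp
qed

lemma min_elt:
  assumes "is_coset C (p, I, J)"
  shows "min_elt C (p, I, J) \<in> p \<and> (\<forall>s \<in> I. len C (min_elt C (p, I, J)) < len C (s \<otimes> min_elt C (p, I, J))) \<and>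
    (\<forall>s \<in> J. len C (min_elt C (p, I, J)) < len C (min_elt C (p, I, J) \<otimes> s))"
proof -
  obtain x where fin: "finitary C I" "finitary C J" and x: "x \<in> carrier C" "p = dcos I J x"
    using assms is_coset_iff by blast
  have I: "I \<subseteq> gens C" and J: "J \<subseteq> gens C" using fin finitaryD by blast+
  obtain z where z: "z \<in> p" "\<And>y. y \<in> p \<Longrightarrow> len C z \<le> len C y"
    using ex_has_least_nat[of "\<lambda>y. y \<in> p" x "len C"] dcos_self x by metis
  have zc: "z \<in> carrier C" using dcos_closed[OF I J x(1)] z(1) x(2) by simp
  have 1: "\<forall>s \<in> I. len C z < len C (s \<otimes> z)"
  proof
    fix s assume s: "s \<in> I"
    then have "len C z \<le> len C (s \<otimes> z)" using z dcos_gen_left[OF I J x(1)] x(2) by simp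
    moreover have "len C (s \<otimes> z) \<noteq> len C z" using len_gen_neq s I zc by blast
    ultimately show "len C z < len C (s \<otimes> z)" by simp
  qed
  have 2: "\<forall>s \<in> J. len C z < len C (z \<otimes> s)"
  proof
    fix s assume s: "s \<in> J"
    then have "len C z \<le> len C (z \<otimes> s)" using z dcos_gen_right[OF I J x(1)] x(2) by simp
    moreover have "len C (z \<otimes> s) \<noteq> len C z" using len_gen_neq_right s J zc by blast
    ultimately show "len C z < len C (z \<otimes> s)" by simp
  qed
  have "z \<preceq> y" if "y \<in> p" for y
    using le_dcos[OF I J zc, of y z] that dcos_cong[OF I J x(1)] z(1) x(2) zc 1 2 by simp
  then have "min_elt C (p, I, J) = z"
    unfolding min_elt_def fst_conv using z(1) by (intro the_equality) (blast intro: le_antisym)+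
  then show ?thesis using z 1 2 by simp
qed

text \<open>Both inequalities are equivalent to the mixed one, minimum of \<open>p\<close> below
  maximum of \<open>q\<close>: lifting up climbs from the minimum of \<open>p\<close> within its
  coset, lifting down descends from the maximum of \<open>q\<close>.\<close>

lemma min_elt_le_iff:
  assumes p: "is_coset C (p, I, J)" and q: "is_coset C (q, I, J)"
  shows "min_elt C (p, I, J) \<preceq> min_elt C (q, I, J) \<longleftrightarrow> max_elt C (p, I, J) \<preceq> max_elt C (q, I, J)"
proof -
  have I: "I \<subseteq> gens C" and J: "J \<subseteq> gens C" using p is_coset_iff finitaryD by blast+
  obtain x where x: "x \<in> carrier C" "p = dcos I J x" using p is_coset_iff by blast
  obtain y where y: "y \<in> carrier C" "q = dcos I J y" using q is_coset_iff by blast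
  let ?p = "min_elt C (p, I, J)" and ?P = "max_elt C (p, I, J)"
  let ?q = "min_elt C (q, I, J)" and ?Q = "max_elt C (q, I, J)"
  note mp = min_elt[OF p] max_elt[OF p] and mq = min_elt[OF q] max_elt[OF q]
  have c: "?p \<in> carrier C" "?P \<in> carrier C" "?q \<in> carrier C" "?Q \<in> carrier C"
    using mp mq x y dcos_closed[OF I J] by blast+
  have dp: "p = dcos I J ?p" "p = dcos I J ?P" using dcos_cong[OF I J x(1)] mp x(2) by auto
  have dq: "q = dcos I J ?q" "q = dcos I J ?Q" using dcos_cong[OF I J y(1)] mq y(2) by auto
  have pP: "?p \<preceq> ?P" using dcos_le[OF I J c(2), of ?p ?P] dp mp by auto
  have qQ: "?q \<preceq> ?Q" using dcos_le[OF I J c(4), of ?q ?Q] dq mq by auto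
  show ?thesis
  proof
    assume "?p \<preceq> ?q"
    then have "?p \<preceq> ?Q" using qQ le_trans by blast
    then show "?P \<preceq> ?Q" using dcos_le[OF I J c(1), of ?P ?Q] dp(1) mp mq by auto
  next
    assume "?P \<preceq> ?Q"
    then have "?p \<preceq> ?Q" using pP le_trans by blast
    then show "?p \<preceq> ?q" using le_dcos[OF I J c(4), of ?q ?p] c(1) dq(2) mp mq by auto
  qed
qed

end

subsection \<open>Singlestep expressions\<close>

lemma expression_Nil [simp]: "\<not> expression C []"
  by (simp add: expression_def)

lemma expression_Cons2:
  "expression C (I # J # Is) \<longleftrightarrow> finitary C I \<and>
    ((\<exists>s. s \<notin> I \<and> J = insert s I) \<or> (\<exists>s. s \<notin> J \<and> I = insert s J)) \<and> expression C (J # Is)"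
  by (auto simp: expression_def)

lemma expression_step: "expression C (I # J # Is) \<Longrightarrow> I \<subset> J \<or> J \<subset> I"
  by (auto simp: expression_Cons2)

lemma expression_hd: "expression C Is \<Longrightarrow> finitary C (hd Is)"
  by (simp add: expression_def)

lemma expression_last: "expression C Is \<Longrightarrow> finitary C (last Is)"
  by (simp add: expression_def)

lemma expr_comp_simps [simp]:
  "Ps \<noteq> [] \<Longrightarrow> hd (Ps \<circ>\<^sub>e Qs) = hd Ps"
  "\<lbrakk>Ps \<noteq> []; Qs \<noteq> []; last Ps = hd Qs\<rbrakk> \<Longrightarrow> last (Ps \<circ>\<^sub>e Qs) = last Qs"
  "[I] \<circ>\<^sub>e Qs = I # tl Qs"
  "(I # J # Ps) \<circ>\<^sub>e Qs = I # ((J # Ps) \<circ>\<^sub>e Qs)"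
  "Ps \<circ>\<^sub>e Qs = [] \<longleftrightarrow> Ps = [] \<and> tl Qs = []"
  by (cases Qs; auto simp: expr_comp_def)+

lemma expression_comp:
  assumes "expression C P" "expression C Q" "last P = hd Q"
  shows "expression C (P \<circ>\<^sub>e Q)"
  using assms
proof (induction P rule: induct_list012)
  case (2 I)
  then show ?case by (cases Q) (auto simp: expression_def)
next
  case (3 I J P)
  then have "expression C ((J # P) \<circ>\<^sub>e Q)" by (simp add: expression_Cons2)
  moreover obtain L where "(J # P) \<circ>\<^sub>e Q = J # L" by (simp add: expr_comp_def)
  ultimately show ?case using 3(3) by (auto simp: expression_Cons2)
qed simp

text \<open>For a reduced expression, \<open>ell C (hd Is) + ascent C Is\<close> is the length of the maximal
  element: the turning points telescope.\<close>

fun ascent :: "('w, 'x) coxeter_scheme \<Rightarrow> 'w set list \<Rightarrow> int" where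
  "ascent C (I # J # Is) =
    (if I \<subset> J then int (ell C J) - int (ell C I) else 0) + ascent C (J # Is)"
| "ascent C _ = 0"

lemma ascent_comp:
  "\<lbrakk>P \<noteq> []; Q \<noteq> []; last P = hd Q\<rbrakk> \<Longrightarrow> ascent C (P \<circ>\<^sub>e Q) = ascent C P + ascent C Q"
proof (induction P rule: induct_list012)
  case (2 I)
  then show ?case by (cases Q) auto
next
  case (3 I J P)
  obtain L where "(J # P) \<circ>\<^sub>e Q = J # L" by (simp add: expr_comp_def)
  with 3 show ?case by simp
qed simp

context coxeter_sys
begin

text \<open>The second part treats a descending stretch whose peak \<open>K\<close> still waits for
  its valley; \<open>hd Is \<subseteq> K\<close> lets \<open>len_longest_quotient\<close> apply once
  the valley is reached. The last peak contributes \<open>longest C K\<close> undivided, so one full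
  length survives the telescoping. The claims on the shape of the turning lists select the right
  equation of \<open>turn_factors\<close>.\<close>

lemma turn_factors_len:
  "expression C Is \<Longrightarrow> (\<exists>K L Ks. turns_up Is = K # L # Ks) \<and>
    int (sum_list (map (len C) (turn_factors C (turns_up Is)))) = int (ell C (hd Is)) + ascent C Is"
  "\<lbrakk>expression C Is; finitary C K; hd Is \<subseteq> K\<rbrakk> \<Longrightarrow> turns_down Is \<noteq> [] \<and>
    int (sum_list (map (len C) (turn_factors C (K # turns_down Is)))) = int (ell C K) + ascent C Is"
proof (induction Is and Is arbitrary: and K rule: turns_up_turns_down.induct)
  case (3 I J Is)
  show ?case
  proof (cases "I \<subset> J")
    case True
    then show ?thesis using 3 by (auto simp: expression_Cons2)
  next
    case False
    then have "J \<subset> I" using expression_step 3(3) by blast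
    moreover have "turns_down (J # Is) \<noteq> []"
      "int (sum_list (map (len C) (turn_factors C (I # turns_down (J # Is))))) = int (ell C I) + ascent C (J # Is)"
      using 3(2)[OF False, of I] 3(3) \<open>J \<subset> I\<close> by (auto simp: expression_Cons2)
    ultimately show ?thesis using False by (auto simp: neq_Nil_conv)
  qed
next
  case (6 I J Is)
  show ?case
  proof (cases "J \<subset> I")
    case True
    moreover have "\<not> I \<subset> J" using True by blast
    moreover have "J \<subseteq> K" using True 6(5) by auto
    ultimately show ?thesis using 6(1)[OF True, of K] 6(3,4) by (auto simp: expression_Cons2)
  next
    case False
    then have IJ: "I \<subset> J" using expression_step 6(3) by blast
    have fin: "finitary C I" "expression C (J # Is)" using 6(3) by (auto simp: expression_Cons2)
    obtain K' L' Ks where t: "turns_up (J # Is) = K' # L' # Ks"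
      and s: "int (sum_list (map (len C) (turn_factors C (turns_up (J # Is))))) = int (ell C J) + ascent C (J # Is)"
      using 6(2)[OF False fin(2)] by auto
    have "turn_factors C (K # I # turns_up (J # Is))
        = (longest C K \<otimes> inv (longest C I)) # turn_factors C (turns_up (J # Is))"
      unfolding t by simp
    moreover have "int (len C (longest C K \<otimes> inv (longest C I))) = int (ell C K) - int (ell C I)"
      using len_longest_quotient[OF 6(4) fin(1)] 6(5) by simp
    ultimately show ?thesis using False IJ s by simp
  qed
qed (simp_all add: ell_def)

abbreviation SL :: "'w set list \<Rightarrow> 'w" where
  "SL Is \<equiv> star_list C (map (longest C) Is)"

lemma reduced_expr_len:
  assumes "reduced_expr C Is"
  shows "int (len C (SL Is)) = int (ell C (hd Is)) + ascent C Is"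
  using assms turn_factors_len(1)[of Is] by (auto simp: reduced_expr_def expresses_def)

lemma star_list_simps [simp]:
  "star_list C [] = \<one>" "star_list C (x # xs) = star C x (star_list C xs)"
  by (simp_all add: star_list_def)

lemma SL_closed [simp]: "\<forall>I \<in> set Is. finitary C I \<Longrightarrow> SL Is \<in> carrier C"
  by (induction Is) (simp_all add: star_list_def)

lemma SL_expression [simp]: "expression C Is \<Longrightarrow> SL Is \<in> carrier C"
  by (auto simp: expression_def)

lemma SL_append:
  "\<lbrakk>\<forall>I \<in> set Is. finitary C I; \<forall>I \<in> set Js. finitary C I\<rbrakk>
    \<Longrightarrow> SL (Is @ Js) = star C (SL Is) (SL Js)"
  by (induction Is) (simp_all add: star_assoc)

lemma SL_ldesc:
  assumes "expression C Is"
  shows "ldesc (hd Is) (SL Is)"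
proof -
  obtain I Js where Is: "Is = I # Js" using assms by (cases Is) auto
  have fin: "finitary C I" "\<forall>I \<in> set Js. finitary C I" using assms Is by (auto simp: expression_def)
  have I: "I \<subseteq> gens C" using finitaryD fin by blast
  show ?thesis
    using ldesc_iff_star_gen[OF I, of "SL Is"] ldesc_iff_star_gen[OF I, of "longest C I"]
      longest_par_ldesc[OF fin(1)] star_gen_star[of _ "longest C I" "SL Js"] fin I Is
    by (simp add: subset_iff)
qed

lemma star_ldesc:
  assumes "I \<subseteq> gens C" "x \<in> carrier C" "y \<in> carrier C" "ldesc I x"
  shows "ldesc I (star C x y)"
  using ldesc_iff_star_gen[OF assms(1)] star_gen_star[of _ x y] assms by (simp add: subset_iff)

lemma star_rdesc:
  assumes "I \<subseteq> gens C" "x \<in> carrier C" "y \<in> carrier C" "rdesc I y"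
  shows "rdesc I (star C x y)"
  using rdesc_iff_rstar[OF assms(1)] rstar_star[of _ x y] assms by (simp add: subset_iff)

lemma SL_rdesc:
  assumes "expression C Is"
  shows "rdesc (last Is) (SL Is)"
proof -
  have ne: "Is \<noteq> []" using assms by auto
  then have Is: "Is = butlast Is @ [last Is]" by simp
  have fin: "\<forall>I \<in> set (butlast Is). finitary C I" "finitary C (last Is)"
    using assms ne by (auto simp: expression_def dest: in_set_butlastD)
  have "SL Is = star C (SL (butlast Is)) (longest C (last Is))"
    using SL_append[OF fin(1), of "[last Is]"] fin(2) Is by simp
  then show ?thesis using star_rdesc[OF finitaryD(1)[OF fin(2)]] fin longest_rdesc[OF fin(2)] by simp
qed

text \<open>The composite lists the junction once, whereas the two separate products contain its
  longest element twice; the right descents of \<open>SL P\<close> absorb the surplus copy.\<close>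

lemma SL_comp:
  assumes P: "expression C P" and Q: "expression C Q" and PQ: "last P = hd Q"
  shows "SL (P \<circ>\<^sub>e Q) = star C (SL P) (SL Q)"
proof -
  obtain I Js where Q': "Q = I # Js" using Q by (cases Q) auto
  have fin: "\<forall>I \<in> set P. finitary C I" "finitary C I" "\<forall>I \<in> set Js. finitary C I"
    using P Q Q' by (auto simp: expression_def)
  have "SL (P \<circ>\<^sub>e Q) = star C (SL P) (SL Js)"
    using SL_append[OF fin(1,3)] Q' by (simp add: expr_comp_def)
  also have "SL P = star C (SL P) (longest C I)"
    using star_longest_right[OF fin(2) SL_expression[OF P]] SL_rdesc[OF P] PQ Q' by simp
  finally show ?thesis using fin P Q' by (simp add: star_assoc)
qed

text \<open>The double coset of the star product itself works, since the product has descents in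
  both end sets.\<close>

lemma ex_expresses:
  assumes "expression C Is"
  shows "\<exists>p. expresses C Is (p, hd Is, last Is)"
proof -
  let ?p = "dcos (hd Is) (last Is) (SL Is)"
  note fin = expression_hd[OF assms] expression_last[OF assms]
  have "is_coset C (?p, hd Is, last Is)" 
    unfolding is_coset_iff using fin SL_expression[OF assms] by blast
  moreover have "max_elt C (?p, hd Is, last Is) = SL Is"
    using finitaryD(1)[OF fin(1)] finitaryD(1)[OF fin(2)] SL_expression[OF assms]
    by (intro max_elt_eqI dcos_self SL_ldesc SL_rdesc assms)
  ultimately have "expresses C Is (?p, hd Is, last Is)"
    using assms by (simp add: expresses_def del: is_coset.simps)
  then show ?thesis ..
qed

lemma coset_eq_if_max_eq:
  assumes "is_coset C (p, I, J)" "is_coset C (q, I, J)" "max_elt C (p, I, J) = max_elt C (q, I, J)"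
  shows "p = q"
proof -
  have I: "I \<subseteq> gens C" and J: "J \<subseteq> gens C" using assms(1) is_coset_iff finitaryD by blast+
  obtain x where x: "x \<in> carrier C" "p = dcos I J x" using assms(1) is_coset_iff by blast
  obtain y where y: "y \<in> carrier C" "q = dcos I J y" using assms(2) is_coset_iff by blast
  have "dcos I J (max_elt C (p, I, J)) = p"
    using dcos_cong[OF I J x(1)] max_elt[OF assms(1)] x(2) by simp
  moreover have "dcos I J (max_elt C (q, I, J)) = q"
    using dcos_cong[OF I J y(1)] max_elt[OF assms(2)] y(2) by simp
  ultimately show ?thesis using assms(3) by argo
qed

text \<open>The order-theoretic input of the bimodule argument. Monotonicity cannot give strictness,
  as the star product may identify different factors; hence the count of lengths.\<close>

theorem coset_less_comp:
  assumes P: "reduced_expr C P" and Q: "reduced_expr C Q" "expresses C Q q" and R: "reduced_expr C R"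
    and comp: "last P = hd Q" "last Q = hd R"
    and red: "reduced_expr C (P \<circ>\<^sub>e Q \<circ>\<^sub>e R)" and pqr: "expresses C (P \<circ>\<^sub>e Q \<circ>\<^sub>e R) pqr"
    and M: "expresses C M q'" and less: "coset_less C q' q"
  shows "\<exists>x. expresses C (P \<circ>\<^sub>e M \<circ>\<^sub>e R) x \<and> coset_less C x pqr"
proof -
  have eP: "expression C P" and eQ: "expression C Q" and eR: "expression C R" and eM: "expression C M"
    using P Q R M by (auto simp: reduced_expr_def expresses_def)
  have ne: "P \<noteq> []" "Q \<noteq> []" "R \<noteq> []" "M \<noteq> []" using eP eQ eR eM by auto
  define I J where "I = hd Q" and "J = last Q"
  have finI: "finitary C I" and finJ: "finitary C J"
    unfolding I_def J_def using expression_hd[OF eQ] expression_last[OF eQ] by auto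
  obtain a where q: "q = (a, I, J)" using Q(2) I_def J_def by (cases q) (auto simp: expresses_def)
  obtain b where q': "q' = (b, I, J)"
    using less q by (cases q') (auto simp: coset_less_def coset_le_def)
  have hM: "hd M = I" "last M = J" using M q' by (auto simp: expresses_def)
  have cq: "is_coset C (a, I, J)" and cq': "is_coset C (b, I, J)"
    using Q(2) M q q' by (auto simp: expresses_def)
  have mq: "max_elt C (a, I, J) = SL Q" and mq': "max_elt C (b, I, J) = SL M"
    using Q(2) M q q' by (auto simp: expresses_def)
  have "SL M \<preceq> SL Q"
    using less min_elt_le_iff[OF cq' cq] mq mq' q q' by (simp add: coset_less_def coset_le_def)
  moreover have "SL M \<noteq> SL Q"
    using coset_eq_if_max_eq[OF cq' cq] mq mq' q q' less by (auto simp: coset_less_def)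
  ultimately have lenM: "len C (SL M) < len C (SL Q)" using le_len by blast
  have eQR: "expression C (Q \<circ>\<^sub>e R)" and eMR: "expression C (M \<circ>\<^sub>e R)"
    using expression_comp eQ eM eR comp hM J_def by auto
  have hQR: "last P = hd (Q \<circ>\<^sub>e R)" "last P = hd (M \<circ>\<^sub>e R)" using comp ne hM I_def by auto
  have ePMR: "expression C (P \<circ>\<^sub>e M \<circ>\<^sub>e R)" using expression_comp[OF eP eMR] hQR by simp
  have cl: "SL P \<in> carrier C" "SL Q \<in> carrier C" "SL R \<in> carrier C" "SL M \<in> carrier C"
    using eP eQ eR eM by auto
  have SQ: "SL (P \<circ>\<^sub>e Q \<circ>\<^sub>e R) = star C (SL P) (star C (SL Q) (SL R))"
    using SL_comp[OF eP eQR] SL_comp[OF eQ eR] hQR comp by simp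
  have SM: "SL (P \<circ>\<^sub>e M \<circ>\<^sub>e R) = star C (SL P) (star C (SL M) (SL R))"
    using SL_comp[OF eP eMR] SL_comp[OF eM eR] hQR comp hM J_def by simp
  have le: "SL (P \<circ>\<^sub>e M \<circ>\<^sub>e R) \<preceq> SL (P \<circ>\<^sub>e Q \<circ>\<^sub>e R)"
    unfolding SQ SM using \<open>SL M \<preceq> SL Q\<close> cl by (intro star_mono) auto
  \<comment> \<open>Ascents add under composition. The base terms \<open>ell C I\<close> of
    \<open>Q\<close> and \<open>ell C J\<close> of \<open>R\<close> occur in the separate lengths
    but not in that of the composite.\<close>
  have lenQ: "int (len C (SL (P \<circ>\<^sub>e Q \<circ>\<^sub>e R)))
      = int (len C (SL P)) + int (len C (SL Q)) + int (len C (SL R)) - int (ell C I) - int (ell C J)"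
    using reduced_expr_len[OF red] reduced_expr_len[OF P] reduced_expr_len[OF Q(1)] reduced_expr_len[OF R]
      ascent_comp[of P "Q \<circ>\<^sub>e R" C] ascent_comp[of Q R C] ne hQR comp I_def J_def by simp
  let ?T = "star C (SL M) (SL R)"
  \<comment> \<open>Splitting off the longest elements of the junctions gains the two corrections:
    \<open>?T\<close> has left descents \<open>I\<close> and \<open>SL M\<close> has right descents
    \<open>J\<close>, so both longest elements are absorbed below.\<close>
  obtain x where x: "x \<in> carrier C" "SL P = x \<otimes> longest C I" "len C (SL P) = len C x + ell C I"
    using longest_factor_right[OF finI cl(1)] SL_rdesc[OF eP] comp I_def by auto
  obtain y where y: "y \<in> carrier C" "SL R = longest C J \<otimes> y" "len C (SL R) = ell C J + len C y"
    using longest_factor[OF finJ cl(3)] SL_ldesc[OF eR] comp J_def by auto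
  have "SL P = star C x (longest C I)"
    using star_additive[OF x(1) longest_closed[OF finI]] x by (simp add: ell_def)
  moreover have "star C (longest C I) ?T = ?T"
    using star_longest[OF finI] star_ldesc[OF finitaryD(1)[OF finI] cl(4) cl(3)] SL_ldesc[OF eM] hM cl
    by simp
  ultimately have "star C (SL P) ?T = star C x ?T" using x(1) cl finI by (simp add: star_assoc)
  moreover have "SL R = star C (longest C J) y"
    using star_additive[OF longest_closed[OF finJ] y(1)] y by (simp add: ell_def)
  then have "?T = star C (SL M) y"
    using star_assoc[OF cl(4) longest_closed[OF finJ] y(1)] star_longest_right[OF finJ cl(4)]
      SL_rdesc[OF eM] hM by simp
  ultimately have "SL (P \<circ>\<^sub>e M \<circ>\<^sub>e R) = star C x (star C (SL M) y)" using SM by simp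
  \<comment> \<open>For the arbitrary expression \<open>M\<close> subadditivity is the available
    bound; it suffices because the composite with \<open>Q\<close> attains the corresponding
    value.\<close>
  moreover have "len C (star C x (star C (SL M) y)) \<le> len C x + (len C (SL M) + len C y)"
    using len_star_le[OF x(1), of "star C (SL M) y"] len_star_le[OF cl(4) y(1)] cl y(1) by simp
  ultimately have "len C (SL (P \<circ>\<^sub>e M \<circ>\<^sub>e R)) \<le> len C x + (len C (SL M) + len C y)" by simp
  then have lt: "len C (SL (P \<circ>\<^sub>e M \<circ>\<^sub>e R)) < len C (SL (P \<circ>\<^sub>e Q \<circ>\<^sub>e R))"
    using lenQ lenM x(3) y(3) by linarith
  have ends: "hd (P \<circ>\<^sub>e M \<circ>\<^sub>e R) = hd P" "last (P \<circ>\<^sub>e M \<circ>\<^sub>e R) = last R"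
    "hd (P \<circ>\<^sub>e Q \<circ>\<^sub>e R) = hd P" "last (P \<circ>\<^sub>e Q \<circ>\<^sub>e R) = last R"
    using ne hQR comp hM J_def by auto
  obtain z where z: "expresses C (P \<circ>\<^sub>e M \<circ>\<^sub>e R) (z, hd P, last R)"
    using ex_expresses[OF ePMR] ends by auto
  obtain c where c: "pqr = (c, hd P, last R)"
    using pqr ends by (cases pqr) (auto simp: expresses_def)
  have cz: "is_coset C (z, hd P, last R)" and cc: "is_coset C (c, hd P, last R)"
    and mz: "max_elt C (z, hd P, last R) = SL (P \<circ>\<^sub>e M \<circ>\<^sub>e R)"
    and mc: "max_elt C (c, hd P, last R) = SL (P \<circ>\<^sub>e Q \<circ>\<^sub>e R)"
    using z pqr c by (auto simp: expresses_def)
  have "z \<noteq> c" using mz mc lt by auto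
  moreover have "min_elt C (z, hd P, last R) \<preceq> min_elt C (c, hd P, last R)"
    using min_elt_le_iff[OF cz cc] le mz mc by simp
  ultimately have "coset_less C (z, hd P, last R) pqr"
    using c cz cc by (auto simp: coset_less_def coset_le_def)
  then show ?thesis using z by blast
qed

end

section \<open>Invariant polynomials\<close>

definition mono_eval :: "('v \<Rightarrow> 'a::comm_monoid_mult) \<Rightarrow> ('v \<Rightarrow>\<^sub>0 nat) \<Rightarrow> 'a" where
  "mono_eval \<sigma> m = (\<Prod>b \<in> Poly_Mapping.keys m. \<sigma> b ^ Poly_Mapping.lookup m b)"

lemma mono_eval_superset:
  "\<lbrakk>finite A; Poly_Mapping.keys m \<subseteq> A\<rbrakk> \<Longrightarrow> mono_eval \<sigma> m = (\<Prod>b \<in> A. \<sigma> b ^ Poly_Mapping.lookup m b)"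
  unfolding mono_eval_def by (rule prod.mono_neutral_left) (auto simp: in_keys_iff)

lemma mono_eval_add: "mono_eval \<sigma> (m + n) = mono_eval \<sigma> m * mono_eval \<sigma> n"
proof -
  let ?A = "Poly_Mapping.keys m \<union> Poly_Mapping.keys n"
  have fin: "finite ?A" by simp
  show ?thesis
    using mono_eval_superset[OF fin, of m \<sigma>] mono_eval_superset[OF fin, of n \<sigma>]
      mono_eval_superset[OF fin keys_add, of \<sigma>]
    by (simp add: lookup_add power_add prod.distrib)
qed

text \<open>The substitution homomorphism: \<open>pact\<close> is an instance by
  \<open>pact_eq\<close>, and multiplicativity is what makes the invariants a subring.\<close>

definition poly_eval :: "('v \<Rightarrow> ('v, 'k::comm_ring_1) mpoly) \<Rightarrow> ('v, 'k) mpoly \<Rightarrow> ('v, 'k) mpoly" where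
  "poly_eval \<sigma> f = (\<Sum>m \<in> Poly_Mapping.keys f.
     Poly_Mapping.single 0 (Poly_Mapping.lookup f m) * mono_eval \<sigma> m)"

text \<open>Sums over the supports of different polynomials become comparable over a common finite
  index set.\<close>

lemma poly_eval_superset:
  "\<lbrakk>finite A; Poly_Mapping.keys f \<subseteq> A\<rbrakk>
    \<Longrightarrow> poly_eval \<sigma> f = (\<Sum>m \<in> A. Poly_Mapping.single 0 (Poly_Mapping.lookup f m) * mono_eval \<sigma> m)"
  unfolding poly_eval_def by (rule sum.mono_neutral_left) (auto simp: in_keys_iff)

lemma poly_eval_add: "poly_eval \<sigma> (f + g) = poly_eval \<sigma> f + poly_eval \<sigma> g"
proof -
  let ?A = "Poly_Mapping.keys f \<union> Poly_Mapping.keys g"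
  have fin: "finite ?A" by simp
  show ?thesis
    using poly_eval_superset[OF fin, of f \<sigma>] poly_eval_superset[OF fin, of g \<sigma>]
      poly_eval_superset[OF fin keys_add, of \<sigma>]
    by (simp add: lookup_add single_add ring_distribs sum.distrib)
qed

lemma poly_eval_0 [simp]: "poly_eval \<sigma> 0 = 0"
  by (simp add: poly_eval_def)

lemma poly_eval_single: "poly_eval \<sigma> (Poly_Mapping.single m a) = Poly_Mapping.single 0 a * mono_eval \<sigma> m"
  by (simp add: poly_eval_def)

lemma poly_eval_1 [simp]: "poly_eval \<sigma> 1 = 1"
  using poly_eval_single[of \<sigma> 0 1] by (simp add: mono_eval_def)

lemma mpoly_induct [case_names zero single add]:
  fixes f :: "'a \<Rightarrow>\<^sub>0 'b::comm_monoid_add"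
  assumes "P 0" "\<And>m a. P (Poly_Mapping.single m a)" "\<And>f g. \<lbrakk>P f; P g\<rbrakk> \<Longrightarrow> P (f + g)"
  shows "P f"
proof -
  have *: "P (\<Sum>m \<in> A. Poly_Mapping.single m (Poly_Mapping.lookup f m))" if "finite A" for A
    using that by induction (use assms in auto)
  have "Poly_Mapping.lookup (\<Sum>m \<in> A. Poly_Mapping.single m (Poly_Mapping.lookup f m)) k
      = (if k \<in> A then Poly_Mapping.lookup f k else 0)" if "finite A" for A k
    using that by induction (auto simp: lookup_add lookup_single when_def)
  then have "f = (\<Sum>m \<in> Poly_Mapping.keys f. Poly_Mapping.single m (Poly_Mapping.lookup f m))"
    by (intro poly_mapping_eqI) (auto simp: in_keys_iff)
  then show ?thesis using *[of "Poly_Mapping.keys f"] by simp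
qed

lemma poly_eval_mult: "poly_eval \<sigma> (f * g) = poly_eval \<sigma> f * poly_eval \<sigma> g"
proof (induction f rule: mpoly_induct)
  case (single m a)
  show ?case
  proof (induction g rule: mpoly_induct)
    case (single n b)
    have const: "Poly_Mapping.single 0 (a * b) = Poly_Mapping.single 0 a * (Poly_Mapping.single 0 b :: ('a, 'b) mpoly)"
      by (simp add: mult_single)
    have "poly_eval \<sigma> (Poly_Mapping.single m a * Poly_Mapping.single n b)
        = Poly_Mapping.single 0 (a * b) * mono_eval \<sigma> (m + n)"
      by (simp only: mult_single poly_eval_single)
    also have "\<dots> = poly_eval \<sigma> (Poly_Mapping.single m a) * poly_eval \<sigma> (Poly_Mapping.single n b)"
      unfolding const mono_eval_add poly_eval_single by (simp only: mult_ac)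
    finally show ?case .
  qed (simp_all add: ring_distribs poly_eval_add)
qed (simp_all add: ring_distribs poly_eval_add)

lemma pact_eq: "pact H w = poly_eval (\<lambda>b. lin_poly H (\<lambda>v. coord H b (vact H (inv\<^bsub>H\<^esub> w) v)))"
  by (simp add: fun_eq_iff pact_def poly_eval_def mono_eval_def)

lemma Sym_simps [simp]:
  "0 \<in> Sym H" "1 \<in> Sym H"
  "\<lbrakk>f \<in> Sym H; g \<in> Sym H\<rbrakk> \<Longrightarrow> f + g \<in> Sym H"
  "\<lbrakk>f \<in> Sym H; g \<in> Sym H\<rbrakk> \<Longrightarrow> f * g \<in> Sym H"
proof -
  show "0 \<in> Sym H" "1 \<in> Sym H" by (simp_all add: Sym_def)
  show "f + g \<in> Sym H" if "f \<in> Sym H" "g \<in> Sym H"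
    using that keys_add[of f g] by (auto simp: Sym_def)
  show "f * g \<in> Sym H" if f: "f \<in> Sym H" and g: "g \<in> Sym H"
    unfolding Sym_def
  proof (rule CollectI, rule ballI)
    fix m assume "m \<in> Poly_Mapping.keys (f * g)"
    then obtain a b where "a \<in> Poly_Mapping.keys f" "b \<in> Poly_Mapping.keys g" "m = a + b"
      using keys_mult[of f g] by blast
    then show "Poly_Mapping.keys m \<subseteq> bas H"
      using f g keys_add[of a b] by (fastforce simp: Sym_def)
  qed
qed

lemma Sym_inv_simps [simp]:
  "0 \<in> Sym_inv H I" "1 \<in> Sym_inv H I"
  "\<lbrakk>f \<in> Sym_inv H I; g \<in> Sym_inv H I\<rbrakk> \<Longrightarrow> f + g \<in> Sym_inv H I"
  "\<lbrakk>f \<in> Sym_inv H I; g \<in> Sym_inv H I\<rbrakk> \<Longrightarrow> f * g \<in> Sym_inv H I"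
  by (simp_all add: Sym_inv_def pact_eq poly_eval_add poly_eval_mult)

lemma Sym_inv_antimono:
  assumes "I \<subseteq> J"
  shows "Sym_inv H J \<subseteq> Sym_inv H I"
proof -
  have "x \<in> generate H J" if "x \<in> generate H I" for x
    using that assms by induction (auto intro: generate.intros)
  then show ?thesis by (auto simp: Sym_inv_def)
qed

section \<open>Degrees of polynomials\<close>

definition mdegree :: "('v \<Rightarrow>\<^sub>0 nat) \<Rightarrow> nat" where
  "mdegree m = (\<Sum>b \<in> Poly_Mapping.keys m. Poly_Mapping.lookup m b)"

lemma mdegree_add: "mdegree (m + n) = mdegree m + mdegree n"
proof -
  have *: "mdegree k = (\<Sum>b \<in> A. Poly_Mapping.lookup k b)"
    if "finite A" "Poly_Mapping.keys k \<subseteq> A" for k :: "'a \<Rightarrow>\<^sub>0 nat" and A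
    unfolding mdegree_def using that by (intro sum.mono_neutral_left) (auto simp: in_keys_iff)
  let ?A = "Poly_Mapping.keys m \<union> Poly_Mapping.keys n"
  have fin: "finite ?A" by simp
  show ?thesis
    using *[OF fin, of m] *[OF fin, of n] *[OF fin keys_add]
    by (simp add: lookup_add sum.distrib)
qed

lemma Sym_deg_mdegree:
  "Sym_deg H n = {f \<in> Sym H. \<forall>m \<in> Poly_Mapping.keys f. int (2 * mdegree m) = n}"
  by (simp add: Sym_deg_def mdegree_def)

lemma Sym_deg_one: "1 \<in> Sym_deg H 0"
  by (simp add: Sym_deg_mdegree mdegree_def)

lemma Sym_deg_mult:
  assumes "f \<in> Sym_deg H m" "g \<in> Sym_deg H n"
  shows "f * g \<in> Sym_deg H (m + n)"
proof -
  have "int (2 * mdegree k) = m + n" if k: "k \<in> Poly_Mapping.keys (f * g)" for k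
  proof -
    obtain a b where "a \<in> Poly_Mapping.keys f" "b \<in> Poly_Mapping.keys g" "k = a + b"
      using keys_mult[of f g] k by blast
    then show ?thesis using assms by (fastforce simp: Sym_deg_mdegree mdegree_add)
  qed
  then show ?thesis using assms by (simp add: Sym_deg_mdegree)
qed

section \<open>Bott--Samelson bimodules\<close>

text \<open>Comparable neighbours make both adjacent invariant rings subrings of the tensor slot
  between them; the bimodule constructions rest on this.\<close>

definition nested :: "'w set list \<Rightarrow> bool" where
  "nested Is \<longleftrightarrow> Is \<noteq> [] \<and> successively (\<lambda>I J. I \<subseteq> J \<or> J \<subseteq> I) Is"

lemma expression_nested: "expression C Is \<Longrightarrow> nested Is"
  unfolding expression_def nested_def by (auto elim: successively_mono)

text \<open>The smaller of two neighbours has the larger invariant ring, which is the slot in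
  \<open>bs_slots\<close>; a list \<open>[I]\<close> keeps its one slot.\<close>

definition mids :: "'w set list \<Rightarrow> 'w set list" where
  "mids Is = (if length Is = 1 then Is else map2 (\<lambda>I J. if I \<subseteq> J then I else J) (butlast Is) (tl Is))"

lemma bs_slots_mids: "bs_slots H Is = map (Sym_inv H) (mids Is)"
proof (cases "length Is = 1")
  case True
  then show ?thesis by (auto simp: bs_slots_def mids_def length_Suc_conv)
next
  case False
  then show ?thesis by (intro nth_equalityI) (simp_all add: bs_slots_def mids_def)
qed

lemma length_mids: "length (mids Is) = (if length Is = 1 then 1 else length Is - 1)"
  by (simp add: mids_def)

lemma mids_subset:
  assumes "nested Is" "i < length (mids Is)"
  shows "mids Is ! i \<subseteq> Is ! i" and "Suc i < length Is \<Longrightarrow> mids Is ! i \<subseteq> Is ! Suc i"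
proof -
  have *: "Is ! i \<subseteq> Is ! Suc i \<or> Is ! Suc i \<subseteq> Is ! i" if "Suc i < length Is"
    using assms(1) that by (auto simp: nested_def successively_conv_nth)
  have eq: "mids Is ! i = (if Is ! i \<subseteq> Is ! Suc i then Is ! i else Is ! Suc i)" if "Suc i < length Is"
    using that assms(2) by (simp add: mids_def nth_butlast nth_tl)
  show "mids Is ! i \<subseteq> Is ! i"
  proof (cases "length Is = 1")
    case True
    then show ?thesis using assms(2) by (simp add: mids_def)
  next
    case False
    then have "Suc i < length Is" using assms(2) by (simp add: length_mids)
    then show ?thesis using * eq by auto
  qed
  show "Suc i < length Is \<Longrightarrow> mids Is ! i \<subseteq> Is ! Suc i" using * eq by auto
qed

section \<open>Tuples, chains and their classes\<close>

lemma in_listset: "xs \<in> listset As \<longleftrightarrow> length xs = length As \<and> (\<forall>i < length As. xs ! i \<in> As ! i)"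
proof (induction As arbitrary: xs)
  case (Cons A As)
  show ?case by (cases xs) (auto simp: set_Cons_def Cons less_Suc_eq_0_disj)
qed auto

lemma in_bs_tuples:
  "xs \<in> bs_tuples H Is \<longleftrightarrow>
    length xs = length (mids Is) \<and> (\<forall>i < length (mids Is). xs ! i \<in> Sym_inv H (mids Is ! i))"
  by (auto simp: in_listset bs_slots_mids)

lemma mids_nonempty: "nested Is \<Longrightarrow> 0 < length (mids Is)"
  by (cases Is) (auto simp: length_mids nested_def)

text \<open>Invariants reverse inclusions and a slot belongs to the smaller neighbour, so scalars
  from either side may be multiplied into it.\<close>

lemma slot_superset:
  assumes "nested Is" "i < length (mids Is)"
  shows "Sym_inv H (Is ! i) \<subseteq> Sym_inv H (mids Is ! i)"
    and "Suc i < length Is \<Longrightarrow> Sym_inv H (Is ! Suc i) \<subseteq> Sym_inv H (mids Is ! i)"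
  using mids_subset[OF assms] Sym_inv_antimono by blast+

lemma slot_superset_last:
  assumes "nested Is"
  shows "Sym_inv H (last Is) \<subseteq> Sym_inv H (mids Is ! (length (mids Is) - 1))"
proof (cases "length Is = 1")
  case True
  then show ?thesis by (cases Is) (auto simp: mids_def)
next
  case False
  have ne: "Is \<noteq> []" using assms by (simp add: nested_def)
  have l: "length (mids Is) = length Is - 1" using False by (simp add: length_mids)
  with mids_nonempty[OF assms] have "2 \<le> length Is" by simp
  then have "Suc (length (mids Is) - 1) = length Is - 1" using l by simp
  moreover have "last Is = Is ! (length Is - 1)" using ne by (simp add: last_conv_nth)
  ultimately show ?thesis
    using slot_superset(2)[OF assms, of "length (mids Is) - 1" H] mids_nonempty[OF assms] ne l
    by (metis One_nat_def Suc_pred diff_less length_greater_0_conv lessI)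
qed

text \<open>An update outside the range changes nothing, so the new entry is tested only at a valid
  index.\<close>

lemma tuple_update:
  "\<lbrakk>xs \<in> bs_tuples H Is; i < length (mids Is) \<Longrightarrow> x \<in> Sym_inv H (mids Is ! i)\<rbrakk>
    \<Longrightarrow> xs[i := x] \<in> bs_tuples H Is"
  unfolding in_bs_tuples by (metis length_list_update nth_list_update nth_list_update_neq)

lemma tuple_nth: "\<lbrakk>xs \<in> bs_tuples H Is; i < length (mids Is)\<rbrakk> \<Longrightarrow> xs ! i \<in> Sym_inv H (mids Is ! i)"
  by (simp add: in_bs_tuples)

lemma tuple_length: "xs \<in> bs_tuples H Is \<Longrightarrow> length xs = length (mids Is)"
  by (simp add: in_bs_tuples)

text \<open>Membership in the carrier of \<open>bs_free\<close>, phrased by supports to fit the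
  facts on \<open>frag_extend\<close>.\<close>

abbreviation chain :: "('w, 'v::ab_group_add, 'k::field) realization_data \<Rightarrow> 'w set list \<Rightarrow>
    (('v, 'k) mpoly list \<Rightarrow>\<^sub>0 int) \<Rightarrow> bool" where
  "chain H Is c \<equiv> Poly_Mapping.keys c \<subseteq> bs_tuples H Is"

lemma chain_diff: "\<lbrakk>chain H Is c; chain H Is d\<rbrakk> \<Longrightarrow> chain H Is (c - d)"
  using keys_diff[of c d] by blast

lemma chain_add: "\<lbrakk>chain H Is c; chain H Is d\<rbrakk> \<Longrightarrow> chain H Is (c + d)"
  using keys_add[of c d] by blast

lemma relators_chain:
  assumes "nested Is"
  shows "bs_relators H Is \<subseteq> carrier (bs_free H Is)"
proof
  fix r assume "r \<in> bs_relators H Is"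
  then consider
    (add) xs i x y where "r = frag_of (xs[i := x + y]) - frag_of (xs[i := x]) - frag_of (xs[i := y])"
      "xs \<in> bs_tuples H Is" "i < length xs" "x \<in> bs_slots H Is ! i" "y \<in> bs_slots H Is ! i"
  | (scal) xs i a where "r = frag_of (xs[i := xs ! i * a]) - frag_of (xs[Suc i := a * xs ! Suc i])"
      "xs \<in> bs_tuples H Is" "Suc i < length xs" "a \<in> Sym_inv H (Is ! Suc i)"
    unfolding bs_relators_def by blast
  then have "chain H Is r"
  proof cases
    case add
    then have "x \<in> Sym_inv H (mids Is ! i)" "y \<in> Sym_inv H (mids Is ! i)"
      using tuple_length[OF add(2)] by (auto simp: bs_slots_mids)
    then show ?thesis using add by (simp add: chain_diff tuple_update)
  next
    case scal
    have l: "Suc i < length (mids Is)" "Suc i < length Is"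
      using scal tuple_length[OF scal(2)] by (auto simp: length_mids split: if_splits)
    then have "a \<in> Sym_inv H (mids Is ! i)" "a \<in> Sym_inv H (mids Is ! Suc i)"
      using slot_superset[OF assms, of i H] slot_superset[OF assms, of "Suc i" H] scal(4) by auto
    then show ?thesis
      using scal l tuple_nth[OF scal(2)] by (simp add: chain_diff tuple_update)
  qed
  then show "r \<in> carrier (bs_free H Is)" by simp
qed

lemma bs_rel_subgroup: "nested Is \<Longrightarrow> subgroup (bs_rel H Is) (bs_free H Is)"
  unfolding bs_rel_def using relators_chain
  by (intro group.generate_is_subgroup group_free_Abelian_group)

lemma bs_rel_normal: "nested Is \<Longrightarrow> bs_rel H Is \<lhd> bs_free H Is"
  using comm_group.subgroup_imp_normal abelian_free_Abelian_group bs_rel_subgroup by blast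

text \<open>\<open>BS\<close> is a fresh record rather than an extension of the quotient group, so
  group facts pass through these field equations.\<close>

lemma BS_quotient:
  "carrier (BS H Is) = carrier (bs_free H Is Mod bs_rel H Is)"
  "monoid.mult (BS H Is) = monoid.mult (bs_free H Is Mod bs_rel H Is)"
  "one (BS H Is) = one (bs_free H Is Mod bs_rel H Is)"
  by (simp_all add: BS_def)

lemma BS_comm_group:
  assumes "nested Is"
  shows "comm_group (BS H Is)"
proof -
  interpret Q: comm_group "bs_free H Is Mod bs_rel H Is"
    using comm_group.abelian_FactGroup[OF abelian_free_Abelian_group bs_rel_subgroup[OF assms]] .
  show ?thesis
  proof (rule comm_groupI)
    show "\<exists>y \<in> carrier (BS H Is). y \<otimes>\<^bsub>BS H Is\<^esub> x = \<one>\<^bsub>BS H Is\<^esub>" if "x \<in> carrier (BS H Is)" for x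
      using that Q.l_inv_ex unfolding BS_quotient by blast
  qed (unfold BS_quotient, (fact Q.m_closed Q.one_closed Q.m_assoc Q.m_comm Q.l_one)+)
qed

lemma BS_group: "nested Is \<Longrightarrow> group (BS H Is)"
  using BS_comm_group comm_group.axioms(2) by blast

lemma BS_carrier: "carrier (BS H Is) = bs_class H Is ` {c. chain H Is c}"
  by (auto simp: BS_quotient carrier_FactGroup bs_class_def)

lemma bs_class_closed [simp]: "chain H Is c \<Longrightarrow> bs_class H Is c \<in> carrier (BS H Is)"
  by (auto simp: BS_carrier)

lemma BS_cases:
  assumes "U \<in> carrier (BS H Is)"
  obtains c where "chain H Is c" "U = bs_class H Is c"
  using assms by (auto simp: BS_carrier)

lemma bs_class_add:
  assumes "nested Is" "chain H Is c" "chain H Is d"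
  shows "bs_class H Is (c + d) = bs_class H Is c \<otimes>\<^bsub>BS H Is\<^esub> bs_class H Is d"
  using normal.rcos_sum[OF bs_rel_normal[OF assms(1)], of c H d] assms(2,3)
  by (simp add: bs_class_def BS_quotient)

lemma bs_class_zero:
  assumes "nested Is"
  shows "bs_class H Is 0 = \<one>\<^bsub>BS H Is\<^esub>"
proof -
  have "0 \<in> bs_rel H Is" using subgroup.one_closed[OF bs_rel_subgroup[OF assms]] by simp
  then have "bs_rel H Is #>\<^bsub>bs_free H Is\<^esub> 0 = bs_rel H Is"
    by (intro group.coset_join2 group_free_Abelian_group bs_rel_subgroup assms) simp
  then show ?thesis by (simp add: bs_class_def BS_quotient)
qed

lemma bs_class_diff:
  assumes "nested Is" "chain H Is c" "chain H Is d"
  shows "bs_class H Is (c - d) = bs_class H Is c \<otimes>\<^bsub>BS H Is\<^esub> inv\<^bsub>BS H Is\<^esub> bs_class H Is d"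
proof -
  interpret group "BS H Is" using BS_group[OF assms(1)] .
  have "bs_class H Is (c - d) \<otimes>\<^bsub>BS H Is\<^esub> bs_class H Is d = bs_class H Is c"
    using bs_class_add[OF assms(1) chain_diff[OF assms(2,3)] assms(3)] by simp
  then show ?thesis using assms chain_diff[OF assms(2,3)] by (metis bs_class_closed inv_solve_right)
qed

lemma bs_class_rel:
  assumes "nested Is" "chain H Is c" "c - d \<in> bs_rel H Is"
  shows "bs_class H Is c = bs_class H Is d"
proof -
  have "c \<in> bs_rel H Is #>\<^bsub>bs_free H Is\<^esub> d"
    unfolding r_coset_def using assms(3) by (auto intro!: bexI[of _ "c - d"])
  moreover have "chain H Is d"
    using subgroup.mem_carrier[OF bs_rel_subgroup[OF assms(1)] assms(3)] chain_diff[OF assms(2), of "c - d"]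
    by simp
  ultimately show ?thesis
    unfolding bs_class_def
    by (intro group.repr_independence[symmetric] group_free_Abelian_group bs_rel_subgroup assms(1)) simp_all
qed

lemma bs_class_mem:
  assumes "nested Is" "chain H Is c" "d \<in> bs_class H Is c"
  shows "chain H Is d \<and> bs_class H Is d = bs_class H Is c"
proof -
  have sub: "bs_rel H Is \<subseteq> carrier (bs_free H Is)"
    using subgroup.subset[OF bs_rel_subgroup[OF assms(1)]] .
  have "bs_class H Is c \<subseteq> carrier (bs_free H Is)"
    unfolding bs_class_def using assms(2)
    by (intro monoid.r_coset_subset_G group.is_monoid group_free_Abelian_group sub) simp
  then have "d \<in> carrier (bs_free H Is)" using assms(3) by (rule subsetD)
  then have "chain H Is d" by (simp only: carrier_free_Abelian_group_iff)
  moreover have "bs_class H Is c = bs_class H Is d"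
    using assms(2,3) unfolding bs_class_def
    by (intro group.repr_independence group_free_Abelian_group bs_rel_subgroup assms(1)) simp_all
  ultimately show ?thesis by simp
qed

lemma bs_class_self: "\<lbrakk>nested Is; chain H Is c\<rbrakk> \<Longrightarrow> c \<in> bs_class H Is c"
  unfolding bs_class_def
  by (rule group.rcos_self[OF group_free_Abelian_group _ bs_rel_subgroup]) auto

abbreviation pure :: "('w, 'v::ab_group_add, 'k::field) realization_data \<Rightarrow> 'w set list \<Rightarrow>
    ('v, 'k) mpoly list \<Rightarrow> ('v, 'k) bs_elt" where
  "pure H Is xs \<equiv> bs_class H Is (frag_of xs)"

lemma pure_add:
  assumes "nested Is" "xs \<in> bs_tuples H Is" "i < length (mids Is)"
    "x \<in> Sym_inv H (mids Is ! i)" "y \<in> Sym_inv H (mids Is ! i)"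
  shows "pure H Is (xs[i := x + y]) = pure H Is (xs[i := x]) \<otimes>\<^bsub>BS H Is\<^esub> pure H Is (xs[i := y])"
proof -
  have t: "xs[i := x + y] \<in> bs_tuples H Is" "xs[i := x] \<in> bs_tuples H Is" "xs[i := y] \<in> bs_tuples H Is"
    using assms by (simp_all add: tuple_update)
  have "frag_of (xs[i := x + y]) - frag_of (xs[i := x]) - frag_of (xs[i := y]) \<in> bs_relators H Is"
    unfolding bs_relators_def using assms tuple_length[OF assms(2)]
    by (intro UnI1 CollectI exI[of _ xs] exI[of _ i] exI[of _ x] exI[of _ y]) (simp add: bs_slots_mids)
  then have "frag_of (xs[i := x + y]) - (frag_of (xs[i := x]) + frag_of (xs[i := y])) \<in> bs_rel H Is"
    unfolding bs_rel_def by (simp add: generate.incl diff_diff_eq)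
  then have "pure H Is (xs[i := x + y]) = bs_class H Is (frag_of (xs[i := x]) + frag_of (xs[i := y]))"
    using t by (intro bs_class_rel assms(1)) simp_all
  also have "\<dots> = pure H Is (xs[i := x]) \<otimes>\<^bsub>BS H Is\<^esub> pure H Is (xs[i := y])"
    using t by (intro bs_class_add assms(1)) auto
  finally show ?thesis .
qed

lemma mid_scalar:
  assumes "nested Is" "Suc i < length (mids Is)" "a \<in> Sym_inv H (Is ! Suc i)"
  shows "a \<in> Sym_inv H (mids Is ! i)" "a \<in> Sym_inv H (mids Is ! Suc i)"
proof -
  have "Suc i < length Is" using assms(2) by (auto simp: length_mids split: if_splits)
  then show "a \<in> Sym_inv H (mids Is ! i)" "a \<in> Sym_inv H (mids Is ! Suc i)"
    using slot_superset[OF assms(1), of i H] slot_superset[OF assms(1), of "Suc i" H] assms(2,3) by auto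
qed

lemma pure_scalar:
  assumes "nested Is" "xs \<in> bs_tuples H Is" "Suc i < length (mids Is)" "a \<in> Sym_inv H (Is ! Suc i)"
  shows "pure H Is (xs[i := xs ! i * a]) = pure H Is (xs[Suc i := a * xs ! Suc i])"
proof (rule bs_class_rel[OF assms(1)])
  show "chain H Is (frag_of (xs[i := xs ! i * a]))"
    using assms mid_scalar[OF assms(1,3,4)] by (simp add: tuple_update tuple_nth)
  have "frag_of (xs[i := xs ! i * a]) - frag_of (xs[Suc i := a * xs ! Suc i]) \<in> bs_relators H Is"
    unfolding bs_relators_def using assms tuple_length[OF assms(2)]
    by (intro UnI2 CollectI exI[of _ xs] exI[of _ i] exI[of _ a]) simp
  then show "frag_of (xs[i := xs ! i * a]) - frag_of (xs[Suc i := a * xs ! Suc i]) \<in> bs_rel H Is"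
    unfolding bs_rel_def by (rule generate.incl)
qed

lemma hom_cong_carrier:
  assumes "group G" "h \<in> hom G K" "\<And>x. x \<in> carrier G \<Longrightarrow> f x = h x"
  shows "f \<in> hom G K"
proof (rule homI)
  interpret group G by (rule assms(1))
  fix x y assume "x \<in> carrier G" "y \<in> carrier G"
  then show "f x \<in> carrier K" "f (x \<otimes>\<^bsub>G\<^esub> y) = f x \<otimes>\<^bsub>K\<^esub> f y"
    using assms(2,3) by (simp_all add: hom_in_carrier hom_mult)
qed

lemmas chain_induct [consumes 1, case_names zero diff pure] = free_Abelian_group_induct

lemma BS_group_hom:
  "\<lbrakk>nested Is; nested Js; h \<in> hom (BS H Is) (BS H Js)\<rbrakk> \<Longrightarrow> group_hom (BS H Is) (BS H Js) h"
  by (intro group_hom.intro group_hom_axioms.intro BS_group)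

subsection \<open>Universal property\<close>

text \<open>Functions on tuples that respect both families in \<open>bs_relators\<close>; these are
  the ones that factor through the tensor product.\<close>

definition balanced_map :: "('w, 'v::ab_group_add, 'k::field) realization_data \<Rightarrow> 'w set list \<Rightarrow>
    ('a, 'b) monoid_scheme \<Rightarrow> (('v, 'k) mpoly list \<Rightarrow> 'a) \<Rightarrow> bool" where
  "balanced_map H Is A \<phi> \<longleftrightarrow> (\<forall>xs \<in> bs_tuples H Is. \<phi> xs \<in> carrier A) \<and>
     (\<forall>xs \<in> bs_tuples H Is. \<forall>i < length (mids Is).
        \<forall>x \<in> Sym_inv H (mids Is ! i). \<forall>y \<in> Sym_inv H (mids Is ! i).
        \<phi> (xs[i := x + y]) = \<phi> (xs[i := x]) \<otimes>\<^bsub>A\<^esub> \<phi> (xs[i := y])) \<and>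
     (\<forall>xs \<in> bs_tuples H Is. \<forall>i. Suc i < length (mids Is) \<longrightarrow>
        (\<forall>a \<in> Sym_inv H (Is ! Suc i). \<phi> (xs[i := xs ! i * a]) = \<phi> (xs[Suc i := a * xs ! Suc i])))"

lemma balanced_mapI:
  assumes "\<And>xs. xs \<in> bs_tuples H Is \<Longrightarrow> \<phi> xs \<in> carrier A"
    and "\<And>xs i x y. \<lbrakk>xs \<in> bs_tuples H Is; i < length (mids Is); x \<in> Sym_inv H (mids Is ! i);
      y \<in> Sym_inv H (mids Is ! i)\<rbrakk> \<Longrightarrow> \<phi> (xs[i := x + y]) = \<phi> (xs[i := x]) \<otimes>\<^bsub>A\<^esub> \<phi> (xs[i := y])"
    and "\<And>xs i a. \<lbrakk>xs \<in> bs_tuples H Is; Suc i < length (mids Is); a \<in> Sym_inv H (Is ! Suc i)\<rbrakk>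
      \<Longrightarrow> \<phi> (xs[i := xs ! i * a]) = \<phi> (xs[Suc i := a * xs ! Suc i])"
  shows "balanced_map H Is A \<phi>"
  using assms by (simp add: balanced_map_def)

lemma balanced_mapD:
  assumes "balanced_map H Is A \<phi>"
  shows "xs \<in> bs_tuples H Is \<Longrightarrow> \<phi> xs \<in> carrier A"
    and "\<lbrakk>xs \<in> bs_tuples H Is; i < length (mids Is); x \<in> Sym_inv H (mids Is ! i);
      y \<in> Sym_inv H (mids Is ! i)\<rbrakk> \<Longrightarrow> \<phi> (xs[i := x + y]) = \<phi> (xs[i := x]) \<otimes>\<^bsub>A\<^esub> \<phi> (xs[i := y])"
    and "\<lbrakk>xs \<in> bs_tuples H Is; Suc i < length (mids Is); a \<in> Sym_inv H (Is ! Suc i)\<rbrakk>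
      \<Longrightarrow> \<phi> (xs[i := xs ! i * a]) = \<phi> (xs[Suc i := a * xs ! Suc i])"
  using assms by (simp_all add: balanced_map_def)

lemma pure_balanced: "nested Is \<Longrightarrow> balanced_map H Is (BS H Is) (pure H Is)"
  by (intro balanced_mapI) (simp_all add: pure_add pure_scalar)

lemma balanced_map_hom:
  assumes "balanced_map H Is A \<phi>" "h \<in> hom A B"
  shows "balanced_map H Is B (\<lambda>xs. h (\<phi> xs))"
proof (rule balanced_mapI)
  fix xs assume xs: "xs \<in> bs_tuples H Is"
  show "h (\<phi> xs) \<in> carrier B" using balanced_mapD(1)[OF assms(1) xs] assms(2) by (auto simp: hom_def)
  show "h (\<phi> (xs[i := x + y])) = h (\<phi> (xs[i := x])) \<otimes>\<^bsub>B\<^esub> h (\<phi> (xs[i := y]))"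
    if "i < length (mids Is)" "x \<in> Sym_inv H (mids Is ! i)" "y \<in> Sym_inv H (mids Is ! i)" for i x y
    using balanced_mapD(2)[OF assms(1) xs that] balanced_mapD(1)[OF assms(1)] that xs
    by (simp add: tuple_update hom_mult[OF assms(2)])
  show "h (\<phi> (xs[i := xs ! i * a])) = h (\<phi> (xs[Suc i := a * xs ! Suc i]))"
    if "Suc i < length (mids Is)" "a \<in> Sym_inv H (Is ! Suc i)" for i a
    using balanced_mapD(3)[OF assms(1) xs that] by simp
qed

text \<open>Extend freely to the free abelian group, check that both families of relators go to the
  identity, and pass to the quotient.\<close>

lemma BS_universal:
  assumes Is: "nested Is" and A: "comm_group A" and \<phi>: "balanced_map H Is A \<phi>"
  shows "\<exists>h \<in> hom (BS H Is) A. \<forall>xs \<in> bs_tuples H Is. h (pure H Is xs) = \<phi> xs"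
proof -
  interpret A: comm_group A by (rule A)
  have "\<phi> ` bs_tuples H Is \<subseteq> carrier A" using balanced_mapD(1)[OF \<phi>] by blast
  then obtain g where g: "g \<in> hom (bs_free H Is) A" "\<And>xs. xs \<in> bs_tuples H Is \<Longrightarrow> g (frag_of xs) = \<phi> xs"
    using A.free_Abelian_group_universal by blast
  interpret g: group_hom "bs_free H Is" A g
    using g(1) by (simp add: group_hom_def group_hom_axioms_def)
  have diff: "g (c - d) = g c \<otimes>\<^bsub>A\<^esub> inv\<^bsub>A\<^esub> g d" if "chain H Is c" "chain H Is d" for c d
    using g.hom_mult[of c "- d"] g.hom_inv[of d] that by simp
  have "r \<in> kernel (bs_free H Is) A g" if "r \<in> bs_relators H Is" for r
  proof -
    have rc: "r \<in> carrier (bs_free H Is)" using relators_chain[OF Is] that by blast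
    from that consider
      (add) xs i x y where "r = frag_of (xs[i := x + y]) - frag_of (xs[i := x]) - frag_of (xs[i := y])"
        "xs \<in> bs_tuples H Is" "i < length xs" "x \<in> bs_slots H Is ! i" "y \<in> bs_slots H Is ! i"
    | (scal) xs i a where "r = frag_of (xs[i := xs ! i * a]) - frag_of (xs[Suc i := a * xs ! Suc i])"
        "xs \<in> bs_tuples H Is" "Suc i < length xs" "a \<in> Sym_inv H (Is ! Suc i)"
      unfolding bs_relators_def by blast
    then have "g r = \<one>\<^bsub>A\<^esub>"
    proof cases
      case add
      have i: "i < length (mids Is)" using add(2,3) tuple_length by metis
      have xy: "x \<in> Sym_inv H (mids Is ! i)" "y \<in> Sym_inv H (mids Is ! i)"
        using add(4,5) i by (auto simp: bs_slots_mids)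
      have t: "xs[i := x + y] \<in> bs_tuples H Is" "xs[i := x] \<in> bs_tuples H Is" "xs[i := y] \<in> bs_tuples H Is"
        using add(2) xy by (simp_all add: tuple_update)
      have c: "\<phi> (xs[i := x]) \<in> carrier A" "\<phi> (xs[i := y]) \<in> carrier A"
        using balanced_mapD(1)[OF \<phi>] t by auto
      have "g r = (\<phi> (xs[i := x]) \<otimes>\<^bsub>A\<^esub> \<phi> (xs[i := y])) \<otimes>\<^bsub>A\<^esub> inv\<^bsub>A\<^esub> \<phi> (xs[i := x]) \<otimes>\<^bsub>A\<^esub> inv\<^bsub>A\<^esub> \<phi> (xs[i := y])"
        unfolding add(1) using t g(2) balanced_mapD(2)[OF \<phi> add(2) i xy]
        by (simp add: diff chain_diff)
      moreover have "\<phi> (xs[i := x]) \<otimes>\<^bsub>A\<^esub> \<phi> (xs[i := y]) \<otimes>\<^bsub>A\<^esub> inv\<^bsub>A\<^esub> \<phi> (xs[i := x]) = \<phi> (xs[i := y])"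
        using c A.m_comm[OF c] by (simp add: A.m_assoc)
      ultimately show ?thesis using c by simp
    next
      case scal
      have i: "Suc i < length (mids Is)" using scal(2,3) tuple_length by metis
      have t: "xs[i := xs ! i * a] \<in> bs_tuples H Is" "xs[Suc i := a * xs ! Suc i] \<in> bs_tuples H Is"
        using scal(2) mid_scalar[OF Is i scal(4)] tuple_nth[OF scal(2)] i by (simp_all add: tuple_update)
      show ?thesis
        unfolding scal(1) using t g(2) balanced_mapD(3)[OF \<phi> scal(2) i scal(4)] balanced_mapD(1)[OF \<phi>]
        by (simp add: diff)
    qed
    with rc show ?thesis by (simp add: kernel_def)
  qed
  then have "bs_rel H Is \<subseteq> kernel (bs_free H Is) A g"
    unfolding bs_rel_def
    by (intro group.generate_subgroup_incl group_free_Abelian_group g.subgroup_kernel) blast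
  then obtain h where "h \<in> hom (bs_free H Is Mod bs_rel H Is) A"
      "\<And>c. c \<in> carrier (bs_free H Is) \<Longrightarrow> h (bs_class H Is c) = g c"
    using g.FactGroup_universal_kernel[OF bs_rel_normal[OF Is]] unfolding bs_class_def by metis
  moreover from this(1) have "h \<in> hom (BS H Is) A" by (simp add: hom_def BS_quotient)
  ultimately show ?thesis using g(2) by (intro bexI[of _ h]) simp_all
qed

lemma BS_induct [consumes 2, case_names pure one diff]:
  assumes Is: "nested Is" and "U \<in> carrier (BS H Is)"
    and "\<And>xs. xs \<in> bs_tuples H Is \<Longrightarrow> P (pure H Is xs)"
    and "P \<one>\<^bsub>BS H Is\<^esub>"
    and "\<And>U V. \<lbrakk>U \<in> carrier (BS H Is); V \<in> carrier (BS H Is); P U; P V\<rbrakk>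
      \<Longrightarrow> P (U \<otimes>\<^bsub>BS H Is\<^esub> inv\<^bsub>BS H Is\<^esub> V)"
  shows "P U"
proof -
  obtain c where c: "chain H Is c" "U = bs_class H Is c" using assms(2) by (rule BS_cases)
  have "P (bs_class H Is c)"
    using c(1)
  proof (induction rule: chain_induct)
    case (diff c d)
    then show ?case using assms(5) by (simp add: bs_class_diff[OF Is])
  qed (use assms(3,4) bs_class_zero[OF Is, of H] in auto)
  then show ?thesis using c(2) by simp
qed

lemma BS_hom_eqI:
  assumes Is: "nested Is" and A: "group A" and f: "f \<in> hom (BS H Is) A" and g: "g \<in> hom (BS H Is) A"
    and "\<And>xs. xs \<in> bs_tuples H Is \<Longrightarrow> f (pure H Is xs) = g (pure H Is xs)"
    and "U \<in> carrier (BS H Is)"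
  shows "f U = g U"
proof -
  interpret f: group_hom "BS H Is" A f
    using BS_group[OF Is] A f by (simp add: group_hom_def group_hom_axioms_def)
  interpret g: group_hom "BS H Is" A g
    using BS_group[OF Is] A g by (simp add: group_hom_def group_hom_axioms_def)
  show ?thesis using Is assms(6) by (induction rule: BS_induct) (simp_all add: assms(5))
qed

text \<open>If every representative yields the value of one function of the class, all the united
  sets coincide, and \<open>U\<close> does contain a representative. This evaluates the unions in
  the definition of \<open>BS\<close>.\<close>

lemma union_class:
  assumes Is: "nested Is" and U: "U \<in> carrier (BS H Is)"
    and eq: "\<And>c. chain H Is c \<Longrightarrow> F c = h (bs_class H Is c)"
  shows "(\<Union>c \<in> U. F c) = h U"
proof -
  obtain c where c: "chain H Is c" "U = bs_class H Is c" using U by (rule BS_cases)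
  have "F d = h U" if "d \<in> U" for d
    using bs_class_mem[OF Is c(1), of d] that eq[of d] c(2) by simp
  moreover have "c \<in> U" using bs_class_self[OF Is c(1)] c(2) by simp
  ultimately show ?thesis by blast
qed

lemma chain_frag_extend:
  assumes "\<And>xs. xs \<in> bs_tuples H Is \<Longrightarrow> chain H Js (F xs)" "chain H Is c"
  shows "chain H Js (frag_extend F c)"
  using assms keys_frag_extend[of F c] by blast

lemma frag_extend_hom:
  assumes Is: "nested Is" and Js: "nested Js"
    and g: "\<And>xs. xs \<in> bs_tuples H Is \<Longrightarrow> g xs \<in> bs_tuples H Js"
    and h: "h \<in> hom (BS H Is) (BS H Js)" "\<And>xs. xs \<in> bs_tuples H Is \<Longrightarrow> h (pure H Is xs) = pure H Js (g xs)"
    and "chain H Is c"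
  shows "bs_class H Js (frag_extend (\<lambda>xs. frag_of (g xs)) c) = h (bs_class H Is c)"
  using assms(6)
proof (induction rule: chain_induct)
  case zero
  show ?case
    using group_hom.hom_one[OF BS_group_hom[OF Is Js h(1)]] bs_class_zero[OF Is, of H]
      bs_class_zero[OF Js, of H] by simp
next
  case (diff c d)
  interpret h: group_hom "BS H Is" "BS H Js" h by (rule BS_group_hom[OF Is Js h(1)])
  have "chain H Js (frag_extend (\<lambda>xs. frag_of (g xs)) e)" if "chain H Is e" for e
    using chain_frag_extend[OF _ that, where F = "\<lambda>xs. frag_of (g xs)" and Js = Js] g by simp
  with diff show ?case
    by (simp add: frag_extend_diff bs_class_diff[OF Is] bs_class_diff[OF Js])
qed (use h(2) in simp)

text \<open>Commutativity of the polynomial ring lets the extra factor pass the scalars that move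
  between neighbouring slots.\<close>

lemma scale_balanced:
  assumes Is: "nested Is" and j: "j < length (mids Is)" and a: "a \<in> Sym_inv H (mids Is ! j)"
  shows "balanced_map H Is (BS H Is) (\<lambda>xs. pure H Is (xs[j := xs ! j * a]))"
proof (rule balanced_mapI)
  fix xs assume xs: "xs \<in> bs_tuples H Is"
  let ?z = "xs[j := xs ! j * a]"
  have z: "?z \<in> bs_tuples H Is" using xs j a by (simp add: tuple_update tuple_nth)
  then show "pure H Is ?z \<in> carrier (BS H Is)" by simp
  \<comment> \<open>Changing slot \<open>i\<close> before or after scaling slot \<open>j\<close>
    agrees, except that for \<open>i = j\<close> the new entry has to be scaled too.\<close>
  have upd: "(xs[i := x])[j := (xs[i := x]) ! j * a] = ?z[i := if i = j then x * a else x]"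
    if "i < length (mids Is)" for i x
    using that j tuple_length[OF xs] by (auto simp: list_update_swap)
  show "pure H Is ((xs[i := x + y])[j := (xs[i := x + y]) ! j * a]) =
      pure H Is ((xs[i := x])[j := (xs[i := x]) ! j * a]) \<otimes>\<^bsub>BS H Is\<^esub>
      pure H Is ((xs[i := y])[j := (xs[i := y]) ! j * a])"
    if i: "i < length (mids Is)" and x: "x \<in> Sym_inv H (mids Is ! i)" and y: "y \<in> Sym_inv H (mids Is ! i)"
    for i x y
  proof (cases "i = j")
    case True
    then show ?thesis
      unfolding upd[OF i] using pure_add[OF Is z i, of "x * a" "y * a"] x y a by (simp add: distrib_right)
  next
    case False
    then show ?thesis unfolding upd[OF i] using pure_add[OF Is z i x y] by simp
  qed
  show "pure H Is ((xs[i := xs ! i * b])[j := (xs[i := xs ! i * b]) ! j * a]) =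
      pure H Is ((xs[Suc i := b * xs ! Suc i])[j := (xs[Suc i := b * xs ! Suc i]) ! j * a])"
    if i: "Suc i < length (mids Is)" and b: "b \<in> Sym_inv H (Is ! Suc i)" for i b
  proof -
    have "?z[i := if i = j then xs ! i * b * a else xs ! i * b] = ?z[i := ?z ! i * b]"
      using i tuple_length[OF xs] by (auto simp: mult_ac)
    moreover have "?z[Suc i := if Suc i = j then b * xs ! Suc i * a else b * xs ! Suc i]
        = ?z[Suc i := b * ?z ! Suc i]"
      using i tuple_length[OF xs] by (auto simp: mult_ac)
    ultimately show ?thesis
      using upd[of i] upd[OF i] pure_scalar[OF Is z i b] i by simp
  qed
qed

lemma scale_hom:
  assumes Is: "nested Is" and j: "j < length (mids Is)" and a: "a \<in> Sym_inv H (mids Is ! j)"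
  defines "F \<equiv> \<lambda>U. \<Union>c \<in> U. bs_class H Is (frag_extend (\<lambda>xs. frag_of (xs[j := xs ! j * a])) c)"
  shows "F \<in> hom (BS H Is) (BS H Is)"
    and "\<And>xs. xs \<in> bs_tuples H Is \<Longrightarrow> F (pure H Is xs) = pure H Is (xs[j := xs ! j * a])"
proof -
  obtain h where h: "h \<in> hom (BS H Is) (BS H Is)"
      "\<And>xs. xs \<in> bs_tuples H Is \<Longrightarrow> h (pure H Is xs) = pure H Is (xs[j := xs ! j * a])"
    using BS_universal[OF Is BS_comm_group[OF Is] scale_balanced[OF Is j a]] by blast
  have t: "xs[j := xs ! j * a] \<in> bs_tuples H Is" if "xs \<in> bs_tuples H Is" for xs
    using that j a by (simp add: tuple_update tuple_nth)
  have F: "F U = h U" if "U \<in> carrier (BS H Is)" for U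
    unfolding F_def by (rule union_class[OF Is that]) (rule frag_extend_hom[OF Is Is t h])
  show "F \<in> hom (BS H Is) (BS H Is)"
    using hom_cong_carrier[OF BS_group[OF Is] h(1) F] .
  show "F (pure H Is xs) = pure H Is (xs[j := xs ! j * a])" if "xs \<in> bs_tuples H Is" for xs
    using that h(2) F by simp
qed

subsection \<open>Left and right multiplication\<close>

lemma balanced_map_cong:
  assumes "balanced_map H Is A \<psi>" "nested Is" "\<And>xs. xs \<in> bs_tuples H Is \<Longrightarrow> \<phi> xs = \<psi> xs"
  shows "balanced_map H Is A \<phi>"
proof (rule balanced_mapI)
  fix xs assume xs: "xs \<in> bs_tuples H Is"
  show "\<phi> xs \<in> carrier A" using balanced_mapD(1)[OF assms(1) xs] assms(3)[OF xs] by simp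
  show "\<phi> (xs[i := x + y]) = \<phi> (xs[i := x]) \<otimes>\<^bsub>A\<^esub> \<phi> (xs[i := y])"
    if "i < length (mids Is)" "x \<in> Sym_inv H (mids Is ! i)" "y \<in> Sym_inv H (mids Is ! i)" for i x y
    using balanced_mapD(2)[OF assms(1) xs that] assms(3) tuple_update[OF xs] that by simp
  show "\<phi> (xs[i := xs ! i * a]) = \<phi> (xs[Suc i := a * xs ! Suc i])"
    if i: "Suc i < length (mids Is)" and a: "a \<in> Sym_inv H (Is ! Suc i)" for i a
  proof -
    have "xs[i := xs ! i * a] \<in> bs_tuples H Is" "xs[Suc i := a * xs ! Suc i] \<in> bs_tuples H Is"
      using mid_scalar[OF assms(2) i a] tuple_nth[OF xs] i by (simp_all add: tuple_update xs)
    then show ?thesis using balanced_mapD(3)[OF assms(1) xs i a] assms(3) by simp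
  qed
qed

lemma BS_mem_chain:
  assumes "nested Is" "U \<in> carrier (BS H Is)" "c \<in> U"
  shows "chain H Is c"
proof -
  obtain d where "chain H Is d" "U = bs_class H Is d" using assms(2) by (rule BS_cases)
  then show ?thesis using bs_class_mem[OF assms(1)] assms(3) by blast
qed

text \<open>The actions of \<open>BS\<close> are written with \<open>hd\<close>, \<open>tl\<close>,
  \<open>butlast\<close> and \<open>last\<close>; on tuples of the bimodule these are indexed
  updates, and \<open>frag_extend\<close> sees no other lists on a chain.\<close>

lemma scale_hom_cong:
  assumes Is: "nested Is" and j: "j < length (mids Is)" and a: "a \<in> Sym_inv H (mids Is ! j)"
    and G: "\<And>xs. xs \<in> bs_tuples H Is \<Longrightarrow> G xs = xs[j := xs ! j * a]"
  defines "F \<equiv> \<lambda>U. \<Union>c \<in> U. bs_class H Is (frag_extend (\<lambda>xs. frag_of (G xs)) c)"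
  shows "F \<in> hom (BS H Is) (BS H Is)"
    and "\<And>xs. xs \<in> bs_tuples H Is \<Longrightarrow> F (pure H Is xs) = pure H Is (xs[j := xs ! j * a])"
proof -
  let ?E = "\<lambda>U. \<Union>c \<in> U. bs_class H Is (frag_extend (\<lambda>xs. frag_of (xs[j := xs ! j * a])) c)"
  have eq: "F U = ?E U" if "U \<in> carrier (BS H Is)" for U
    unfolding F_def
  proof (rule SUP_cong)
    fix c assume c: "c \<in> U"
    have "chain H Is c" using BS_mem_chain[OF Is that c] .
    then have "frag_extend (\<lambda>xs. frag_of (G xs)) c = frag_extend (\<lambda>xs. frag_of (xs[j := xs ! j * a])) c"
      using G by (intro frag_extend_eq) (metis subsetD)
    then show "bs_class H Is (frag_extend (\<lambda>xs. frag_of (G xs)) c)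
        = bs_class H Is (frag_extend (\<lambda>xs. frag_of (xs[j := xs ! j * a])) c)" by (rule arg_cong)
  qed (rule HOL.refl)
  show "F \<in> hom (BS H Is) (BS H Is)"
    using hom_cong_carrier[OF BS_group[OF Is] scale_hom(1)[OF Is j a] eq] .
  show "F (pure H Is xs) = pure H Is (xs[j := xs ! j * a])" if "xs \<in> bs_tuples H Is" for xs
    using that eq scale_hom(2)[OF Is j a] by simp
qed

lemma tuple_nonempty: "\<lbrakk>nested Is; xs \<in> bs_tuples H Is\<rbrakk> \<Longrightarrow> xs \<noteq> []"
  using tuple_length mids_nonempty by fastforce

lemma hd_scalar:
  assumes "nested Is" "a \<in> Sym_inv H (hd Is)"
  shows "a \<in> Sym_inv H (mids Is ! 0)"
  using slot_superset(1)[OF assms(1) mids_nonempty[OF assms(1)], of H] assms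
  by (auto simp: nested_def hd_conv_nth)

lemma last_scalar:
  "\<lbrakk>nested Is; a \<in> Sym_inv H (last Is)\<rbrakk> \<Longrightarrow> a \<in> Sym_inv H (mids Is ! (length (mids Is) - 1))"
  using slot_superset_last by blast

lemma hd_update:
  "\<lbrakk>nested Is; xs \<in> bs_tuples H Is\<rbrakk> \<Longrightarrow> (a * hd xs) # tl xs = xs[0 := xs ! 0 * a]"
  using tuple_nonempty[of Is xs H] by (cases xs) (auto simp: mult.commute)

lemma last_update:
  assumes "nested Is" "xs \<in> bs_tuples H Is"
  shows "butlast xs @ [last xs * a] = xs[length (mids Is) - 1 := xs ! (length (mids Is) - 1) * a]"
  using tuple_nonempty[OF assms] tuple_length[OF assms(2)]
  by (cases xs rule: rev_cases) (auto simp: nth_append list_update_append)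

lemma lact_hom:
  assumes "nested Is" "a \<in> Sym_inv H (hd Is)"
  shows "lact (BS H Is) a \<in> hom (BS H Is) (BS H Is)"
    and "xs \<in> bs_tuples H Is \<Longrightarrow> lact (BS H Is) a (pure H Is xs) = pure H Is (xs[0 := xs ! 0 * a])"
  using scale_hom_cong[OF assms(1) mids_nonempty[OF assms(1)] hd_scalar[OF assms] hd_update[OF assms(1)]]
  by (simp_all add: BS_def)

lemma ract_hom:
  assumes "nested Is" "a \<in> Sym_inv H (last Is)"
  shows "(\<lambda>U. ract (BS H Is) U a) \<in> hom (BS H Is) (BS H Is)"
    and "xs \<in> bs_tuples H Is \<Longrightarrow> ract (BS H Is) (pure H Is xs) a
      = pure H Is (xs[length (mids Is) - 1 := xs ! (length (mids Is) - 1) * a])"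
  using scale_hom_cong[OF assms(1) _ last_scalar[OF assms] last_update[OF assms(1)]]
    mids_nonempty[OF assms(1)]
  by (simp_all add: BS_def)

subsection \<open>Tensor products\<close>

definition glueable :: "'w set list \<Rightarrow> 'w set list \<Rightarrow> bool" where
  "glueable P Q \<longleftrightarrow> nested P \<and> nested Q \<and> last P = hd Q"

lemma glueableD:
  assumes "glueable P Q"
  shows "nested P" "nested Q" "last P = hd Q" "P \<noteq> []" "Q \<noteq> []"
  using assms by (auto simp: glueable_def nested_def)

lemma glueable_nested:
  assumes "glueable P Q"
  shows "nested (P \<circ>\<^sub>e Q)"
proof -
  note g = glueableD[OF assms]
  obtain Q' where Q: "Q = last P # Q'" using g by (cases Q) auto
  have "successively (\<lambda>I J. I \<subseteq> J \<or> J \<subseteq> I) (last P # Q')"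
    using g(2) Q unfolding nested_def by metis
  moreover have "P \<circ>\<^sub>e Q = P @ Q'" using Q by (metis expr_comp_def list.sel(3))
  moreover have "successively (\<lambda>I J. I \<subseteq> J \<or> J \<subseteq> I) P" using g(1) by (simp add: nested_def)
  ultimately show ?thesis
    using g(4) by (cases Q') (simp_all add: nested_def successively_append_iff)
qed

lemma comp_butlast_tl:
  assumes "glueable P Q" "length P \<noteq> 1" "length Q \<noteq> 1"
  shows "butlast (P \<circ>\<^sub>e Q) = butlast P @ butlast Q" "tl (P \<circ>\<^sub>e Q) = tl P @ tl Q"
proof -
  note g = glueableD[OF assms(1)]
  obtain P' l where P: "P = P' @ [l]" using g by (metis append_butlast_last_id)
  obtain Q' where Q: "Q = l # Q'" using g P by (cases Q) auto
  have "Q' \<noteq> []" using Q assms(3) by auto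
  then show "butlast (P \<circ>\<^sub>e Q) = butlast P @ butlast Q"
    unfolding P Q by (simp add: expr_comp_def butlast_append)
  show "tl (P \<circ>\<^sub>e Q) = tl P @ tl Q" using g by (simp add: expr_comp_def)
qed

text \<open>A list without steps still owns one slot, its invariant ring, which merges into a slot
  of the other factor; slots concatenate only when both lists have steps. Constructions on
  composites split accordingly.\<close>

lemma glueable_cases:
  assumes "glueable P Q"
  obtains (left) "length P = 1" "P \<circ>\<^sub>e Q = Q" "mids P = P" "P = [hd Q]"
  | (right) "length P \<noteq> 1" "length Q = 1" "P \<circ>\<^sub>e Q = P" "mids Q = Q" "Q = [last P]"
  | (both) "length P \<noteq> 1" "length Q \<noteq> 1" "mids (P \<circ>\<^sub>e Q) = mids P @ mids Q"
      "length P = Suc (length (mids P))"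
proof -
  note g = glueableD[OF assms]
  consider "length P = 1" | "length P \<noteq> 1" "length Q = 1" | "length P \<noteq> 1" "length Q \<noteq> 1" by blast
  then show thesis
  proof cases
    case 1
    then have "P = [hd Q]" using g by (cases P) auto
    then show thesis using g left by (cases Q) (auto simp: mids_def expr_comp_def)
  next
    case 2
    then have "Q = [last P]" using g by (cases Q) auto
    then show thesis using 2 right by (auto simp: mids_def expr_comp_def)
  next
    case 3
    have lP: "length P = Suc (length (mids P))" using 3 g by (simp add: length_mids Suc_diff_1)
    note bt = comp_butlast_tl[OF assms 3]
    have "length (P \<circ>\<^sub>e Q) \<noteq> 1" using lP mids_nonempty[OF g(1)] by (simp add: expr_comp_def)
    moreover have "length (butlast P) = length (tl P)" by simp
    ultimately have "mids (P \<circ>\<^sub>e Q) = mids P @ mids Q"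
      using 3 unfolding mids_def bt by (simp add: zip_append)
    then show thesis using both 3 lP by blast
  qed
qed

lemma glue_forms:
  assumes PQ: "glueable P Q" and xs: "xs \<in> bs_tuples H P" and ys: "ys \<in> bs_tuples H Q"
  shows "length P = 1 \<Longrightarrow> bs_glue P Q xs ys = ys[0 := ys ! 0 * hd xs]"
    and "\<lbrakk>length P \<noteq> 1; length Q = 1\<rbrakk> \<Longrightarrow>
      bs_glue P Q xs ys = xs[length (mids P) - 1 := xs ! (length (mids P) - 1) * hd ys]"
    and "\<lbrakk>length P \<noteq> 1; length Q \<noteq> 1\<rbrakk> \<Longrightarrow> bs_glue P Q xs ys = xs @ ys"
  using hd_update[OF glueableD(2)[OF PQ] ys] last_update[OF glueableD(1)[OF PQ] xs]
  by (simp_all add: bs_glue_def)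

lemma append_tuple:
  assumes "mids (P \<circ>\<^sub>e Q) = mids P @ mids Q" "xs \<in> bs_tuples H P" "ys \<in> bs_tuples H Q"
  shows "xs @ ys \<in> bs_tuples H (P \<circ>\<^sub>e Q)"
  using assms(2,3) unfolding in_bs_tuples assms(1) by (auto simp: nth_append)

lemma split_tuple:
  assumes "mids (P \<circ>\<^sub>e Q) = mids P @ mids Q" "zs \<in> bs_tuples H (P \<circ>\<^sub>e Q)"
  shows "take (length (mids P)) zs \<in> bs_tuples H P" "drop (length (mids P)) zs \<in> bs_tuples H Q"
proof -
  have l: "length zs = length (mids P) + length (mids Q)"
    and n: "\<And>i. i < length (mids P) + length (mids Q) \<Longrightarrow> zs ! i \<in> Sym_inv H ((mids P @ mids Q) ! i)"
    using assms(2) unfolding in_bs_tuples assms(1) by auto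
  show "take (length (mids P)) zs \<in> bs_tuples H P"
    unfolding in_bs_tuples
  proof (intro conjI allI impI)
    fix i assume "i < length (mids P)"
    then show "take (length (mids P)) zs ! i \<in> Sym_inv H (mids P ! i)"
      using n[of i] by (simp add: nth_append)
  qed (use l in simp)
  show "drop (length (mids P)) zs \<in> bs_tuples H Q"
    unfolding in_bs_tuples
  proof (intro conjI allI impI)
    fix i assume "i < length (mids Q)"
    then show "drop (length (mids P)) zs ! i \<in> Sym_inv H (mids Q ! i)"
      using l n[of "length (mids P) + i"] by (simp add: nth_append)
  qed (use l in simp)
qed

lemma single_tuple:
  assumes "length Is = 1"
  shows "xs \<in> bs_tuples H Is \<longleftrightarrow> (\<exists>x \<in> Sym_inv H (hd Is). xs = [x])"
  using assms by (auto simp: in_bs_tuples mids_def length_Suc_conv)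

lemma single_hd: "\<lbrakk>length Is = 1; xs \<in> bs_tuples H Is\<rbrakk> \<Longrightarrow> hd xs \<in> Sym_inv H (hd Is)"
  using single_tuple[of Is xs H] by auto

lemma glue_tuple:
  assumes PQ: "glueable P Q" and xs: "xs \<in> bs_tuples H P" and ys: "ys \<in> bs_tuples H Q"
  shows "bs_glue P Q xs ys \<in> bs_tuples H (P \<circ>\<^sub>e Q)"
  using PQ
proof (cases rule: glueable_cases)
  case left
  have "hd xs \<in> Sym_inv H (hd Q)" using single_hd[OF left(1) xs] glueableD[OF PQ] left(4) by (metis list.sel(1))
  then have a: "hd xs \<in> Sym_inv H (mids Q ! 0)" using hd_scalar glueableD(2)[OF PQ] by blast
  show ?thesis
    unfolding left(2) glue_forms(1)[OF PQ xs ys left(1)]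
    by (intro tuple_update ys Sym_inv_simps(4) a tuple_nth mids_nonempty glueableD(2)[OF PQ])
next
  case right
  have "hd ys \<in> Sym_inv H (last P)" using single_hd[OF right(2) ys] glueableD(3)[OF PQ] by simp
  then have a: "hd ys \<in> Sym_inv H (mids P ! (length (mids P) - 1))"
    using last_scalar glueableD(1)[OF PQ] by blast
  show ?thesis
    unfolding right(3) glue_forms(2)[OF PQ xs ys right(1,2)]
    by (intro tuple_update xs Sym_inv_simps(4) a tuple_nth)
next
  case both
  then show ?thesis using glue_forms(3)[OF PQ xs ys] append_tuple[OF both(3) xs ys] by simp
qed

lemma comp_nth:
  assumes "length P = Suc (length (mids P))"
  shows "i < length (mids P) \<Longrightarrow> (P \<circ>\<^sub>e Q) ! Suc i = P ! Suc i"
    and "Suc i < length Q \<Longrightarrow> (P \<circ>\<^sub>e Q) ! Suc (length (mids P) + i) = Q ! Suc i"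
  using assms by (simp_all add: expr_comp_def nth_append nth_tl)

text \<open>With the right tuple fixed, gluing is balanced in the left one, so the tensor can be
  passed to classes one argument at a time.\<close>

lemma glue_balanced_left:
  assumes PQ: "glueable P Q" and ys: "ys \<in> bs_tuples H Q"
  shows "balanced_map H P (BS H (P \<circ>\<^sub>e Q)) (\<lambda>xs. pure H (P \<circ>\<^sub>e Q) (bs_glue P Q xs ys))"
  using PQ
proof (cases rule: glueable_cases)
  case left
  note nQ = glueableD(2)[OF PQ]
  show ?thesis
  proof (rule balanced_mapI)
    fix xs assume xs: "xs \<in> bs_tuples H P"
    then show "pure H (P \<circ>\<^sub>e Q) (bs_glue P Q xs ys) \<in> carrier (BS H (P \<circ>\<^sub>e Q))"
      using glue_tuple[OF PQ xs ys] by simp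
    obtain x0 where x0: "xs = [x0]" using xs single_tuple[OF left(1)] by blast
    fix i x y assume i: "i < length (mids P)" and x: "x \<in> Sym_inv H (mids P ! i)" and y: "y \<in> Sym_inv H (mids P ! i)"
    have "i = 0" "mids P ! i = hd Q" using i left(1,3,4) by auto
    then have "x \<in> Sym_inv H (mids Q ! 0)" "y \<in> Sym_inv H (mids Q ! 0)" using x y hd_scalar[OF nQ] by auto
    then have "pure H Q (ys[0 := ys ! 0 * x + ys ! 0 * y])
        = pure H Q (ys[0 := ys ! 0 * x]) \<otimes>\<^bsub>BS H Q\<^esub> pure H Q (ys[0 := ys ! 0 * y])"
      using tuple_nth[OF ys mids_nonempty[OF nQ]] by (intro pure_add nQ ys mids_nonempty) simp_all
    then show "pure H (P \<circ>\<^sub>e Q) (bs_glue P Q (xs[i := x + y]) ys) =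
        pure H (P \<circ>\<^sub>e Q) (bs_glue P Q (xs[i := x]) ys) \<otimes>\<^bsub>BS H (P \<circ>\<^sub>e Q)\<^esub>
        pure H (P \<circ>\<^sub>e Q) (bs_glue P Q (xs[i := y]) ys)"
      using left(1,2) x0 \<open>i = 0\<close> hd_update[OF nQ ys] by (simp add: bs_glue_def distrib_left)
  \<comment> \<open>A single slot has no inner tensor sign, so the condition on moving scalars is
    vacuous.\<close>
  qed (use left in simp)
next
  case right
  have "hd ys \<in> Sym_inv H (last P)" using single_hd[OF right(2) ys] glueableD(3)[OF PQ] by simp
  then have a: "hd ys \<in> Sym_inv H (mids P ! (length (mids P) - 1))" using last_scalar glueableD(1)[OF PQ] by blast
  have "balanced_map H P (BS H P) (\<lambda>xs. pure H P (xs[length (mids P) - 1 := xs ! (length (mids P) - 1) * hd ys]))"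
    using mids_nonempty[OF glueableD(1)[OF PQ]] by (intro scale_balanced glueableD(1)[OF PQ] a) simp
  then show ?thesis
    unfolding right(3) using glue_forms(2)[OF PQ _ ys right(1,2)]
    by (elim balanced_map_cong) (simp_all add: glueableD(1)[OF PQ])
next
  case both
  let ?R = "P \<circ>\<^sub>e Q"
  note nR = glueable_nested[OF PQ]
  have "balanced_map H P (BS H ?R) (\<lambda>xs. pure H ?R (xs @ ys))"
  proof (rule balanced_mapI)
    fix xs assume xs: "xs \<in> bs_tuples H P"
    note t = append_tuple[OF both(3) xs ys] and l = tuple_length[OF xs]
    show "pure H ?R (xs @ ys) \<in> carrier (BS H ?R)" using t by simp
    show "pure H ?R (xs[i := x + y] @ ys) = pure H ?R (xs[i := x] @ ys) \<otimes>\<^bsub>BS H ?R\<^esub> pure H ?R (xs[i := y] @ ys)"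
      if "i < length (mids P)" "x \<in> Sym_inv H (mids P ! i)" "y \<in> Sym_inv H (mids P ! i)" for i x y
      using pure_add[OF nR t, of i x y] that l both(3) by (simp add: list_update_append nth_append)
    show "pure H ?R (xs[i := xs ! i * a] @ ys) = pure H ?R (xs[Suc i := a * xs ! Suc i] @ ys)"
      if "Suc i < length (mids P)" "a \<in> Sym_inv H (P ! Suc i)" for i a
      using pure_scalar[OF nR t, of i a] that l both(3) comp_nth(1)[OF both(4), of i Q]
      by (simp add: list_update_append nth_append)
  qed
  then show ?thesis
    using glue_forms(3)[OF PQ _ ys both(1,2)] by (elim balanced_map_cong) (simp_all add: glueableD(1)[OF PQ])
qed

lemma glue_balanced_right:
  assumes PQ: "glueable P Q" and xs: "xs \<in> bs_tuples H P"
  shows "balanced_map H Q (BS H (P \<circ>\<^sub>e Q)) (\<lambda>ys. pure H (P \<circ>\<^sub>e Q) (bs_glue P Q xs ys))"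
  using PQ
proof (cases rule: glueable_cases)
  case left
  have "hd xs \<in> Sym_inv H (hd Q)" using single_hd[OF left(1) xs] glueableD[OF PQ] left(4) by (metis list.sel(1))
  then have a: "hd xs \<in> Sym_inv H (mids Q ! 0)" using hd_scalar glueableD(2)[OF PQ] by blast
  have "balanced_map H Q (BS H Q) (\<lambda>ys. pure H Q (ys[0 := ys ! 0 * hd xs]))"
    by (intro scale_balanced glueableD(2)[OF PQ] a mids_nonempty)
  then show ?thesis
    unfolding left(2) using glue_forms(1)[OF PQ xs _ left(1)]
    by (elim balanced_map_cong) (simp_all add: glueableD(2)[OF PQ])
next
  case right
  note nP = glueableD(1)[OF PQ]
  let ?n = "length (mids P) - 1"
  show ?thesis
  proof (rule balanced_mapI)
    fix ys assume ys: "ys \<in> bs_tuples H Q"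
    then show "pure H (P \<circ>\<^sub>e Q) (bs_glue P Q xs ys) \<in> carrier (BS H (P \<circ>\<^sub>e Q))"
      using glue_tuple[OF PQ xs ys] by simp
    obtain y0 where y0: "ys = [y0]" using ys single_tuple[OF right(2)] by blast
    fix i x y assume i: "i < length (mids Q)" and x: "x \<in> Sym_inv H (mids Q ! i)" and y: "y \<in> Sym_inv H (mids Q ! i)"
    have "i = 0" "mids Q ! i = last P" using i right(2,4,5) by auto
    then have "x \<in> Sym_inv H (mids P ! ?n)" "y \<in> Sym_inv H (mids P ! ?n)" using x y last_scalar[OF nP] by auto
    then have "pure H P (xs[?n := xs ! ?n * (x + y)])
        = pure H P (xs[?n := xs ! ?n * x]) \<otimes>\<^bsub>BS H P\<^esub> pure H P (xs[?n := xs ! ?n * y])"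
      unfolding distrib_left using tuple_nth[OF xs, of ?n] mids_nonempty[OF nP] by (intro pure_add nP xs) simp_all
    then show "pure H (P \<circ>\<^sub>e Q) (bs_glue P Q xs (ys[i := x + y])) =
        pure H (P \<circ>\<^sub>e Q) (bs_glue P Q xs (ys[i := x])) \<otimes>\<^bsub>BS H (P \<circ>\<^sub>e Q)\<^esub>
        pure H (P \<circ>\<^sub>e Q) (bs_glue P Q xs (ys[i := y]))"
      using right(1-3) y0 \<open>i = 0\<close> last_update[OF nP xs] by (simp add: bs_glue_def)
  qed (use right in simp)
next
  case both
  let ?R = "P \<circ>\<^sub>e Q" and ?n = "length (mids P)"
  note nR = glueable_nested[OF PQ] and lx = tuple_length[OF xs]
  have "balanced_map H Q (BS H ?R) (\<lambda>ys. pure H ?R (xs @ ys))"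
  proof (rule balanced_mapI)
    fix ys assume ys: "ys \<in> bs_tuples H Q"
    note t = append_tuple[OF both(3) xs ys] and l = tuple_length[OF ys]
    have upd: "(xs @ ys)[?n + i := y] = xs @ ys[i := y]" "(xs @ ys) ! (?n + i) = ys ! i" for i y
      using lx by (simp_all add: list_update_append nth_append)
    show "pure H ?R (xs @ ys) \<in> carrier (BS H ?R)" using t by simp
    show "pure H ?R (xs @ ys[i := x + y]) = pure H ?R (xs @ ys[i := x]) \<otimes>\<^bsub>BS H ?R\<^esub> pure H ?R (xs @ ys[i := y])"
      if "i < length (mids Q)" "x \<in> Sym_inv H (mids Q ! i)" "y \<in> Sym_inv H (mids Q ! i)" for i x y
      using pure_add[OF nR t, of "?n + i" x y] that l both(3) by (simp add: upd)
    show "pure H ?R (xs @ ys[i := ys ! i * a]) = pure H ?R (xs @ ys[Suc i := a * ys ! Suc i])"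
      if i: "Suc i < length (mids Q)" and a: "a \<in> Sym_inv H (Q ! Suc i)" for i a
    proof -
      have "Suc i < length Q" using i both(2) by (simp add: length_mids split: if_splits)
      then show ?thesis
        using pure_scalar[OF nR t, of "?n + i" a] i a l both(3) comp_nth(2)[OF both(4), of i Q]
          upd(1)[of "Suc i"] upd(2)[of "Suc i"] by (simp add: upd)
    qed
  qed
  then show ?thesis
    using glue_forms(3)[OF PQ xs _ both(1,2)] by (elim balanced_map_cong) (simp_all add: glueableD(2)[OF PQ])
qed

text \<open>If both lists have steps, this is the relator at the junction, which sits at position
  \<open>length (mids P)\<close> of the composite; otherwise both sides multiply \<open>a\<close>
  into the same slot.\<close>

lemma glue_middle:
  assumes PQ: "glueable P Q" and xs: "xs \<in> bs_tuples H P" and ys: "ys \<in> bs_tuples H Q"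
    and a: "a \<in> Sym_inv H (last P)"
  shows "pure H (P \<circ>\<^sub>e Q) (bs_glue P Q (xs[length (mids P) - 1 := xs ! (length (mids P) - 1) * a]) ys)
    = pure H (P \<circ>\<^sub>e Q) (bs_glue P Q xs (ys[0 := ys ! 0 * a]))"
proof -
  note nP = glueableD(1)[OF PQ] and nQ = glueableD(2)[OF PQ]
  let ?n = "length (mids P) - 1"
  have xs': "xs[?n := xs ! ?n * a] \<in> bs_tuples H P"
    using last_scalar[OF nP a] mids_nonempty[OF nP] tuple_nth[OF xs, of ?n] by (simp add: tuple_update xs)
  have aQ: "a \<in> Sym_inv H (hd Q)" using a glueableD(3)[OF PQ] by simp
  have ys': "ys[0 := ys ! 0 * a] \<in> bs_tuples H Q"
    using hd_scalar[OF nQ aQ] mids_nonempty[OF nQ] tuple_nth[OF ys, of 0] by (simp add: tuple_update ys)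
  have ne: "xs \<noteq> []" "ys \<noteq> []" using tuple_nonempty nP nQ xs ys by blast+
  from PQ show ?thesis
  proof (cases rule: glueable_cases)
    case left
    obtain x0 where "xs = [x0]" using xs single_tuple[OF left(1)] by blast
    then show ?thesis using left(1,3) ne(2) by (cases ys) (simp_all add: bs_glue_def mult_ac)
  next
    case right
    obtain y0 where y0: "ys = [y0]" using ys single_tuple[OF right(2)] by blast
    then show ?thesis
      using glue_forms(2)[OF PQ xs' ys right(1,2)] glue_forms(2)[OF PQ xs ys' right(1,2)]
        tuple_length[OF xs] mids_nonempty[OF nP] by (simp add: mult_ac)
  next
    case both
    let ?R = "P \<circ>\<^sub>e Q"
    note t = append_tuple[OF both(3) xs ys]
    have n: "Suc ?n = length (mids P)" using mids_nonempty[OF nP] by simp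
    have "?R ! Suc ?n = P ! Suc ?n" using comp_nth(1)[OF both(4), of ?n Q] n by simp
    also have "\<dots> = last P" using n both(4) glueableD(4)[OF PQ] by (simp add: last_conv_nth)
    finally have "a \<in> Sym_inv H (?R ! Suc ?n)" using a by simp
    moreover have "Suc ?n < length (mids ?R)" using n both(3) mids_nonempty[OF nQ] by simp
    ultimately have "pure H ?R ((xs @ ys)[?n := (xs @ ys) ! ?n * a])
        = pure H ?R ((xs @ ys)[Suc ?n := a * (xs @ ys) ! Suc ?n])"
      by (intro pure_scalar glueable_nested[OF PQ] t)
    moreover have "(xs @ ys)[?n := (xs @ ys) ! ?n * a] = xs[?n := xs ! ?n * a] @ ys"
      using n tuple_length[OF xs] by (simp add: list_update_append nth_append)
    moreover have "(xs @ ys)[Suc ?n := a * (xs @ ys) ! Suc ?n] = xs @ ys[0 := ys ! 0 * a]"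
      unfolding n using tuple_length[OF xs] by (simp add: list_update_append nth_append mult.commute)
    ultimately show ?thesis
      using glue_forms(3)[OF PQ xs' ys both(1,2)] glue_forms(3)[OF PQ xs ys' both(1,2)] by simp
  qed
qed

section \<open>Well-definedness of the tensor of two elements\<close>

lemma frag_extend_fun_diff:
  "frag_extend (\<lambda>x. f x - g x) c = frag_extend f c - frag_extend g c"
proof -
  have "Poly_Mapping.keys c \<subseteq> UNIV" by simp
  then show ?thesis by (induction c rule: frag_induction) (simp_all add: frag_extend_diff)
qed

text \<open>The bilinear extension of \<open>bs_glue\<close> to representatives, that is, the inner
  expression of \<open>bs_tensor\<close>.\<close>

definition glue_chain :: "'w set list \<Rightarrow> 'w set list \<Rightarrow> (('v, 'k::field) mpoly list \<Rightarrow>\<^sub>0 int) \<Rightarrow>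
    (('v, 'k) mpoly list \<Rightarrow>\<^sub>0 int) \<Rightarrow> (('v, 'k) mpoly list \<Rightarrow>\<^sub>0 int)" where
  "glue_chain P Q c d = frag_extend (\<lambda>xs. frag_extend (\<lambda>ys. frag_of (bs_glue P Q xs ys)) d) c"

lemma glue_chain_simps:
  "glue_chain P Q 0 d = 0"
  "glue_chain P Q (c - c') d = glue_chain P Q c d - glue_chain P Q c' d"
  "glue_chain P Q c 0 = 0"
  "glue_chain P Q c (d - d') = glue_chain P Q c d - glue_chain P Q c d'"
  "glue_chain P Q (frag_of xs) d = frag_extend (\<lambda>ys. frag_of (bs_glue P Q xs ys)) d"
  "glue_chain P Q c (frag_of ys) = frag_extend (\<lambda>xs. frag_of (bs_glue P Q xs ys)) c"
  using frag_extend_fun_diff[of "\<lambda>x. 0" "\<lambda>x. 0" c]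
  by (simp_all add: glue_chain_def frag_extend_diff frag_extend_fun_diff)

lemma glue_chain_chain:
  assumes PQ: "glueable P Q" and c: "chain H P c" and d: "chain H Q d"
  shows "chain H (P \<circ>\<^sub>e Q) (glue_chain P Q c d)"
  unfolding glue_chain_def
proof (rule chain_frag_extend[OF _ c])
  fix xs assume xs: "xs \<in> bs_tuples H P"
  show "chain H (P \<circ>\<^sub>e Q) (frag_extend (\<lambda>ys. frag_of (bs_glue P Q xs ys)) d)"
  proof (rule chain_frag_extend[OF _ d])
    fix ys assume "ys \<in> bs_tuples H Q"
    then show "chain H (P \<circ>\<^sub>e Q) (frag_of (bs_glue P Q xs ys))" using glue_tuple[OF PQ xs] by simp
  qed
qed

text \<open>For a single tuple on the left, the universal property gives a homomorphism on the right
  factor, which depends on the class only; differences extend this to all chains.\<close>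

lemma glue_chain_cong_right:
  assumes PQ: "glueable P Q" and c: "chain H P c" and d: "chain H Q d" "chain H Q d'"
    and eq: "bs_class H Q d = bs_class H Q d'"
  shows "bs_class H (P \<circ>\<^sub>e Q) (glue_chain P Q c d) = bs_class H (P \<circ>\<^sub>e Q) (glue_chain P Q c d')"
  using c
proof (induction rule: chain_induct)
  case (diff c c')
  then show ?case using PQ d
    by (simp add: glue_chain_simps bs_class_diff glueable_nested glue_chain_chain)
next
  case (pure xs)
  note nQ = glueableD(2)[OF PQ] and nR = glueable_nested[OF PQ]
  obtain h where h: "h \<in> hom (BS H Q) (BS H (P \<circ>\<^sub>e Q))"
      "\<And>ys. ys \<in> bs_tuples H Q \<Longrightarrow> h (pure H Q ys) = pure H (P \<circ>\<^sub>e Q) (bs_glue P Q xs ys)"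
    using BS_universal[OF nQ BS_comm_group[OF nR] glue_balanced_right[OF PQ pure]] by blast
  have "bs_class H (P \<circ>\<^sub>e Q) (frag_extend (\<lambda>ys. frag_of (bs_glue P Q xs ys)) e) = h (bs_class H Q e)"
    if "chain H Q e" for e
    by (rule frag_extend_hom[OF nQ nR glue_tuple[OF PQ pure] h that])
  then show ?case using d eq by (simp add: glue_chain_simps)
qed (simp add: glue_chain_simps)

lemma glue_chain_cong_left:
  assumes PQ: "glueable P Q" and d: "chain H Q d" and c: "chain H P c" "chain H P c'"
    and eq: "bs_class H P c = bs_class H P c'"
  shows "bs_class H (P \<circ>\<^sub>e Q) (glue_chain P Q c d) = bs_class H (P \<circ>\<^sub>e Q) (glue_chain P Q c' d)"
  using d
proof (induction rule: chain_induct)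
  case (diff d d')
  then show ?case using PQ c
    by (simp add: glue_chain_simps bs_class_diff glueable_nested glue_chain_chain)
next
  case (pure ys)
  note nP = glueableD(1)[OF PQ] and nR = glueable_nested[OF PQ]
  obtain h where h: "h \<in> hom (BS H P) (BS H (P \<circ>\<^sub>e Q))"
      "\<And>xs. xs \<in> bs_tuples H P \<Longrightarrow> h (pure H P xs) = pure H (P \<circ>\<^sub>e Q) (bs_glue P Q xs ys)"
    using BS_universal[OF nP BS_comm_group[OF nR] glue_balanced_left[OF PQ pure]] by blast
  have "bs_class H (P \<circ>\<^sub>e Q) (frag_extend (\<lambda>xs. frag_of (bs_glue P Q xs ys)) e) = h (bs_class H P e)"
    if "chain H P e" for e
    by (rule frag_extend_hom[OF nP nR glue_tuple[OF PQ _ pure] h that])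
  then show ?case using c eq by (simp add: glue_chain_simps)
qed (simp add: glue_chain_simps)

text \<open>Changing the representatives one argument at a time shows that all the united classes
  coincide.\<close>

lemma bs_tensor_class:
  assumes PQ: "glueable P Q" and c: "chain H P c" and d: "chain H Q d"
  shows "bs_tensor H P Q (bs_class H P c) (bs_class H Q d) = bs_class H (P \<circ>\<^sub>e Q) (glue_chain P Q c d)"
proof -
  note nP = glueableD(1)[OF PQ] and nQ = glueableD(2)[OF PQ]
  have eq: "bs_class H (P \<circ>\<^sub>e Q) (glue_chain P Q c' d') = bs_class H (P \<circ>\<^sub>e Q) (glue_chain P Q c d)"
    if "c' \<in> bs_class H P c" "d' \<in> bs_class H Q d" for c' d'
  proof -
    have c': "chain H P c'" "bs_class H P c' = bs_class H P c" using bs_class_mem[OF nP c that(1)] by auto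
    have d': "chain H Q d'" "bs_class H Q d' = bs_class H Q d" using bs_class_mem[OF nQ d that(2)] by auto
    show ?thesis
      using glue_chain_cong_left[OF PQ d'(1) c'(1) c c'(2)] glue_chain_cong_right[OF PQ c d'(1) d d'(2)]
      by (rule HOL.trans)
  qed
  have "bs_tensor H P Q (bs_class H P c) (bs_class H Q d)
      = (\<Union>c' \<in> bs_class H P c. \<Union>d' \<in> bs_class H Q d. bs_class H (P \<circ>\<^sub>e Q) (glue_chain P Q c' d'))"
    unfolding bs_tensor_def glue_chain_def ..
  also have "\<dots> = (\<Union>c' \<in> bs_class H P c. \<Union>d' \<in> bs_class H Q d. bs_class H (P \<circ>\<^sub>e Q) (glue_chain P Q c d))"
    using eq by (intro SUP_cong HOL.refl) auto
  also have "\<dots> = bs_class H (P \<circ>\<^sub>e Q) (glue_chain P Q c d)"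
    using bs_class_self[OF nP c] bs_class_self[OF nQ d] by blast
  finally show ?thesis .
qed

lemma bs_tensor_pure:
  "\<lbrakk>glueable P Q; xs \<in> bs_tuples H P; ys \<in> bs_tuples H Q\<rbrakk>
    \<Longrightarrow> bs_tensor H P Q (pure H P xs) (pure H Q ys) = pure H (P \<circ>\<^sub>e Q) (bs_glue P Q xs ys)"
  by (simp add: bs_tensor_class glue_chain_simps)

lemma bs_tensor_closed:
  assumes "glueable P Q" "U \<in> carrier (BS H P)" "V \<in> carrier (BS H Q)"
  shows "bs_tensor H P Q U V \<in> carrier (BS H (P \<circ>\<^sub>e Q))"
proof -
  obtain c where "chain H P c" "U = bs_class H P c" using assms(2) by (rule BS_cases)
  moreover obtain d where "chain H Q d" "V = bs_class H Q d" using assms(3) by (rule BS_cases)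
  ultimately show ?thesis using assms(1) by (simp add: bs_tensor_class glue_chain_chain)
qed

lemma glue_chain_add:
  "glue_chain P Q (c + c') d = glue_chain P Q c d + glue_chain P Q c' d"
  "glue_chain P Q c (d + d') = glue_chain P Q c d + glue_chain P Q c d'"
proof -
  show "glue_chain P Q (c + c') d = glue_chain P Q c d + glue_chain P Q c' d"
    by (simp add: glue_chain_def frag_extend_add)
  have "glue_chain P Q c ((d + d') - d') = glue_chain P Q c (d + d') - glue_chain P Q c d'"
    by (simp only: glue_chain_simps)
  then show "glue_chain P Q c (d + d') = glue_chain P Q c d + glue_chain P Q c d'"
    by (simp add: algebra_simps)
qed

lemma bs_tensor_hom_left:
  assumes PQ: "glueable P Q" and V: "V \<in> carrier (BS H Q)"
  shows "(\<lambda>U. bs_tensor H P Q U V) \<in> hom (BS H P) (BS H (P \<circ>\<^sub>e Q))"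
proof (rule homI)
  fix U U' assume U: "U \<in> carrier (BS H P)" "U' \<in> carrier (BS H P)"
  show "bs_tensor H P Q U V \<in> carrier (BS H (P \<circ>\<^sub>e Q))" using bs_tensor_closed[OF PQ U(1) V] .
  obtain c where c: "chain H P c" "U = bs_class H P c" using U(1) by (rule BS_cases)
  obtain c' where c': "chain H P c'" "U' = bs_class H P c'" using U(2) by (rule BS_cases)
  obtain d where d: "chain H Q d" "V = bs_class H Q d" using V by (rule BS_cases)
  have "bs_class H P (c + c') = U \<otimes>\<^bsub>BS H P\<^esub> U'"
    using bs_class_add[OF glueableD(1)[OF PQ] c(1) c'(1)] c c' by simp
  then show "bs_tensor H P Q (U \<otimes>\<^bsub>BS H P\<^esub> U') V
      = bs_tensor H P Q U V \<otimes>\<^bsub>BS H (P \<circ>\<^sub>e Q)\<^esub> bs_tensor H P Q U' V"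
    using bs_tensor_class[OF PQ chain_add[OF c(1) c'(1)] d(1)] bs_tensor_class[OF PQ c(1) d(1)]
      bs_tensor_class[OF PQ c'(1) d(1)] c(2) c'(2) d(2)
      bs_class_add[OF glueable_nested[OF PQ] glue_chain_chain[OF PQ c(1) d(1)] glue_chain_chain[OF PQ c'(1) d(1)]]
    by (simp add: glue_chain_add)
qed

lemma bs_tensor_hom_right:
  assumes PQ: "glueable P Q" and U: "U \<in> carrier (BS H P)"
  shows "(\<lambda>V. bs_tensor H P Q U V) \<in> hom (BS H Q) (BS H (P \<circ>\<^sub>e Q))"
proof (rule homI)
  fix V V' assume V: "V \<in> carrier (BS H Q)" "V' \<in> carrier (BS H Q)"
  show "bs_tensor H P Q U V \<in> carrier (BS H (P \<circ>\<^sub>e Q))" using bs_tensor_closed[OF PQ U V(1)] .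
  obtain c where c: "chain H P c" "U = bs_class H P c" using U by (rule BS_cases)
  obtain d where d: "chain H Q d" "V = bs_class H Q d" using V(1) by (rule BS_cases)
  obtain d' where d': "chain H Q d'" "V' = bs_class H Q d'" using V(2) by (rule BS_cases)
  have "bs_class H Q (d + d') = V \<otimes>\<^bsub>BS H Q\<^esub> V'"
    using bs_class_add[OF glueableD(2)[OF PQ] d(1) d'(1)] d d' by simp
  then show "bs_tensor H P Q U (V \<otimes>\<^bsub>BS H Q\<^esub> V')
      = bs_tensor H P Q U V \<otimes>\<^bsub>BS H (P \<circ>\<^sub>e Q)\<^esub> bs_tensor H P Q U V'"
    using bs_tensor_class[OF PQ c(1) chain_add[OF d(1) d'(1)]] bs_tensor_class[OF PQ c(1) d(1)]
      bs_tensor_class[OF PQ c(1) d'(1)] c(2) d(2) d'(2)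
      bs_class_add[OF glueable_nested[OF PQ] glue_chain_chain[OF PQ c(1) d(1)] glue_chain_chain[OF PQ c(1) d'(1)]]
    by (simp add: glue_chain_add)
qed

text \<open>Pure tensors generate each factor, so agreement spreads first in \<open>U\<close>
  against a pure second argument, then in \<open>V\<close>.\<close>

lemma hom_eqI2:
  assumes PQ: "nested P" "nested Q" and A: "group A"
    and F: "\<And>V. V \<in> carrier (BS H Q) \<Longrightarrow> (\<lambda>U. F U V) \<in> hom (BS H P) A"
      "\<And>U. U \<in> carrier (BS H P) \<Longrightarrow> (\<lambda>V. F U V) \<in> hom (BS H Q) A"
    and G: "\<And>V. V \<in> carrier (BS H Q) \<Longrightarrow> (\<lambda>U. G U V) \<in> hom (BS H P) A"
      "\<And>U. U \<in> carrier (BS H P) \<Longrightarrow> (\<lambda>V. G U V) \<in> hom (BS H Q) A"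
    and eq: "\<And>xs ys. \<lbrakk>xs \<in> bs_tuples H P; ys \<in> bs_tuples H Q\<rbrakk>
      \<Longrightarrow> F (pure H P xs) (pure H Q ys) = G (pure H P xs) (pure H Q ys)"
    and U: "U \<in> carrier (BS H P)" and V: "V \<in> carrier (BS H Q)"
  shows "F U V = G U V"
proof -
  have "F U (pure H Q ys) = G U (pure H Q ys)" if "ys \<in> bs_tuples H Q" for ys
    using BS_hom_eqI[OF PQ(1) A F(1) G(1) _ U, of "pure H Q ys" "pure H Q ys"] eq that by simp
  then show ?thesis using BS_hom_eqI[OF PQ(2) A F(2)[OF U] G(2)[OF U] _ V] by simp
qed

lemma hom_comp: "\<lbrakk>f \<in> hom G K; g \<in> hom K L\<rbrakk> \<Longrightarrow> (\<lambda>x. g (f x)) \<in> hom G L"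
  using hom_compose[of f G K g L] by (simp add: o_def)

lemma lact_closed: "\<lbrakk>nested Is; a \<in> Sym_inv H (hd Is); U \<in> carrier (BS H Is)\<rbrakk>
    \<Longrightarrow> lact (BS H Is) a U \<in> carrier (BS H Is)"
  using lact_hom(1) by (blast intro: hom_in_carrier)

lemma ract_closed: "\<lbrakk>nested Is; a \<in> Sym_inv H (last Is); U \<in> carrier (BS H Is)\<rbrakk>
    \<Longrightarrow> ract (BS H Is) U a \<in> carrier (BS H Is)"
  using hom_in_carrier[OF ract_hom(1)] by blast

lemma lact_tuple:
  assumes "nested Is" "xs \<in> bs_tuples H Is" "a \<in> Sym_inv H (hd Is)"
  shows "xs[0 := xs ! 0 * a] \<in> bs_tuples H Is"
  using assms hd_scalar[OF assms(1,3)] tuple_nth[OF assms(2)] by (intro tuple_update) auto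

lemma ract_tuple:
  assumes "nested Is" "xs \<in> bs_tuples H Is" "a \<in> Sym_inv H (last Is)"
  shows "xs[length (mids Is) - 1 := xs ! (length (mids Is) - 1) * a] \<in> bs_tuples H Is"
  using assms last_scalar[OF assms(1,3)] tuple_nth[OF assms(2)] by (intro tuple_update) auto

text \<open>Both sides are additive in each argument, so the case of pure tensors,
  \<open>glue_middle\<close>, suffices.\<close>

lemma bs_tensor_middle:
  assumes PQ: "glueable P Q" and a: "a \<in> Sym_inv H (last P)"
    and U: "U \<in> carrier (BS H P)" and V: "V \<in> carrier (BS H Q)"
  shows "bs_tensor H P Q (ract (BS H P) U a) V = bs_tensor H P Q U (lact (BS H Q) a V)"
proof -
  note nP = glueableD(1)[OF PQ] and nQ = glueableD(2)[OF PQ]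
  have aQ: "a \<in> Sym_inv H (hd Q)" using a glueableD(3)[OF PQ] by simp
  show ?thesis
  proof (rule hom_eqI2[OF nP nQ BS_group[OF glueable_nested[OF PQ]] _ _ _ _ _ U V])
    fix V assume V: "V \<in> carrier (BS H Q)"
    show "(\<lambda>U. bs_tensor H P Q (ract (BS H P) U a) V) \<in> hom (BS H P) (BS H (P \<circ>\<^sub>e Q))"
      using hom_comp[OF ract_hom(1)[OF nP a] bs_tensor_hom_left[OF PQ V]] .
    show "(\<lambda>U. bs_tensor H P Q U (lact (BS H Q) a V)) \<in> hom (BS H P) (BS H (P \<circ>\<^sub>e Q))"
      using bs_tensor_hom_left[OF PQ lact_closed[OF nQ aQ V]] .
  next
    fix U assume U: "U \<in> carrier (BS H P)"
    show "(\<lambda>V. bs_tensor H P Q (ract (BS H P) U a) V) \<in> hom (BS H Q) (BS H (P \<circ>\<^sub>e Q))"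
      using bs_tensor_hom_right[OF PQ ract_closed[OF nP a U]] .
    show "(\<lambda>V. bs_tensor H P Q U (lact (BS H Q) a V)) \<in> hom (BS H Q) (BS H (P \<circ>\<^sub>e Q))"
      using hom_comp[OF lact_hom(1)[OF nQ aQ] bs_tensor_hom_right[OF PQ U]] .
  next
    fix xs ys assume xs: "xs \<in> bs_tuples H P" and ys: "ys \<in> bs_tuples H Q"
    show "bs_tensor H P Q (ract (BS H P) (pure H P xs) a) (pure H Q ys)
        = bs_tensor H P Q (pure H P xs) (lact (BS H Q) a (pure H Q ys))"
      using ract_hom(2)[OF nP a xs] lact_hom(2)[OF nQ aQ ys] glue_middle[OF PQ xs ys a]
        bs_tensor_pure[OF PQ ract_tuple[OF nP xs a] ys] bs_tensor_pure[OF PQ xs lact_tuple[OF nQ ys aQ]]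
      by simp
  qed
qed

lemma glue_lact:
  assumes PQ: "glueable P Q" and xs: "xs \<in> bs_tuples H P" and ys: "ys \<in> bs_tuples H Q"
  shows "(bs_glue P Q xs ys)[0 := bs_glue P Q xs ys ! 0 * a] = bs_glue P Q (xs[0 := xs ! 0 * a]) ys"
proof -
  have ne: "xs \<noteq> []" "ys \<noteq> []" using tuple_nonempty glueableD(1,2)[OF PQ] xs ys by blast+
  then obtain x xs' y ys' where [simp]: "xs = x # xs'" "ys = y # ys'" by (meson list.exhaust)
  show ?thesis by (cases xs') (simp_all add: bs_glue_def mult_ac)
qed

lemma glue_last:
  assumes "xs \<noteq> []" "ys \<noteq> []" "length Q = 1 \<Longrightarrow> length ys = 1" "length P = 1 \<Longrightarrow> length xs = 1"
  shows "butlast (bs_glue P Q xs ys) @ [last (bs_glue P Q xs ys) * a]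
    = bs_glue P Q xs (butlast ys @ [last ys * a])"
proof -
  obtain y ys' where [simp]: "ys = y # ys'" using assms(2) by (meson list.exhaust)
  show ?thesis using assms(3) by (cases ys') (auto simp: bs_glue_def mult_ac butlast_append)
qed

lemma lact_tensor:
  assumes PQ: "glueable P Q" and a: "a \<in> Sym_inv H (hd P)"
    and U: "U \<in> carrier (BS H P)" and V: "V \<in> carrier (BS H Q)"
  shows "lact (BS H (P \<circ>\<^sub>e Q)) a (bs_tensor H P Q U V) = bs_tensor H P Q (lact (BS H P) a U) V"
proof -
  note nP = glueableD(1)[OF PQ] and nQ = glueableD(2)[OF PQ] and nR = glueable_nested[OF PQ]
  have aR: "a \<in> Sym_inv H (hd (P \<circ>\<^sub>e Q))" using a glueableD(4)[OF PQ] by simp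
  show ?thesis
  proof (rule hom_eqI2[OF nP nQ BS_group[OF nR] _ _ _ _ _ U V])
    fix V assume V: "V \<in> carrier (BS H Q)"
    show "(\<lambda>U. lact (BS H (P \<circ>\<^sub>e Q)) a (bs_tensor H P Q U V)) \<in> hom (BS H P) (BS H (P \<circ>\<^sub>e Q))"
      using hom_comp[OF bs_tensor_hom_left[OF PQ V] lact_hom(1)[OF nR aR]] .
    show "(\<lambda>U. bs_tensor H P Q (lact (BS H P) a U) V) \<in> hom (BS H P) (BS H (P \<circ>\<^sub>e Q))"
      using hom_comp[OF lact_hom(1)[OF nP a] bs_tensor_hom_left[OF PQ V]] .
  next
    fix U assume U: "U \<in> carrier (BS H P)"
    show "(\<lambda>V. lact (BS H (P \<circ>\<^sub>e Q)) a (bs_tensor H P Q U V)) \<in> hom (BS H Q) (BS H (P \<circ>\<^sub>e Q))"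
      using hom_comp[OF bs_tensor_hom_right[OF PQ U] lact_hom(1)[OF nR aR]] .
    show "(\<lambda>V. bs_tensor H P Q (lact (BS H P) a U) V) \<in> hom (BS H Q) (BS H (P \<circ>\<^sub>e Q))"
      using bs_tensor_hom_right[OF PQ lact_closed[OF nP a U]] .
  next
    fix xs ys assume xs: "xs \<in> bs_tuples H P" and ys: "ys \<in> bs_tuples H Q"
    show "lact (BS H (P \<circ>\<^sub>e Q)) a (bs_tensor H P Q (pure H P xs) (pure H Q ys))
        = bs_tensor H P Q (lact (BS H P) a (pure H P xs)) (pure H Q ys)"
      using bs_tensor_pure[OF PQ xs ys] lact_hom(2)[OF nR aR glue_tuple[OF PQ xs ys]]
        lact_hom(2)[OF nP a xs] bs_tensor_pure[OF PQ lact_tuple[OF nP xs a] ys] glue_lact[OF PQ xs ys, of a]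
      by simp
  qed
qed

lemma ract_tensor:
  assumes PQ: "glueable P Q" and a: "a \<in> Sym_inv H (last Q)"
    and U: "U \<in> carrier (BS H P)" and V: "V \<in> carrier (BS H Q)"
  shows "ract (BS H (P \<circ>\<^sub>e Q)) (bs_tensor H P Q U V) a = bs_tensor H P Q U (ract (BS H Q) V a)"
proof -
  note nP = glueableD(1)[OF PQ] and nQ = glueableD(2)[OF PQ] and nR = glueable_nested[OF PQ]
  have aR: "a \<in> Sym_inv H (last (P \<circ>\<^sub>e Q))" using a glueableD(3-5)[OF PQ] by simp
  show ?thesis
  proof (rule hom_eqI2[OF nP nQ BS_group[OF nR] _ _ _ _ _ U V])
    fix V assume V: "V \<in> carrier (BS H Q)"
    show "(\<lambda>U. ract (BS H (P \<circ>\<^sub>e Q)) (bs_tensor H P Q U V) a) \<in> hom (BS H P) (BS H (P \<circ>\<^sub>e Q))"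
      using hom_comp[OF bs_tensor_hom_left[OF PQ V] ract_hom(1)[OF nR aR]] .
    show "(\<lambda>U. bs_tensor H P Q U (ract (BS H Q) V a)) \<in> hom (BS H P) (BS H (P \<circ>\<^sub>e Q))"
      using bs_tensor_hom_left[OF PQ ract_closed[OF nQ a V]] .
  next
    fix U assume U: "U \<in> carrier (BS H P)"
    show "(\<lambda>V. ract (BS H (P \<circ>\<^sub>e Q)) (bs_tensor H P Q U V) a) \<in> hom (BS H Q) (BS H (P \<circ>\<^sub>e Q))"
      using hom_comp[OF bs_tensor_hom_right[OF PQ U] ract_hom(1)[OF nR aR]] .
    show "(\<lambda>V. bs_tensor H P Q U (ract (BS H Q) V a)) \<in> hom (BS H Q) (BS H (P \<circ>\<^sub>e Q))"
      using hom_comp[OF ract_hom(1)[OF nQ a] bs_tensor_hom_right[OF PQ U]] .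
  next
    fix xs ys assume xs: "xs \<in> bs_tuples H P" and ys: "ys \<in> bs_tuples H Q"
    have ne: "xs \<noteq> []" "ys \<noteq> []" using tuple_nonempty nP nQ xs ys by blast+
    have "length Q = 1 \<Longrightarrow> length ys = 1" "length P = 1 \<Longrightarrow> length xs = 1"
      using tuple_length[OF xs] tuple_length[OF ys] by (simp_all add: length_mids)
    then show "ract (BS H (P \<circ>\<^sub>e Q)) (bs_tensor H P Q (pure H P xs) (pure H Q ys)) a
        = bs_tensor H P Q (pure H P xs) (ract (BS H Q) (pure H Q ys) a)"
      using bs_tensor_pure[OF PQ xs ys] ract_hom(2)[OF nR aR glue_tuple[OF PQ xs ys]]
        ract_hom(2)[OF nQ a ys] bs_tensor_pure[OF PQ xs ract_tuple[OF nQ ys a]]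
        glue_last[OF ne, of Q P a] last_update[OF nR glue_tuple[OF PQ xs ys]] last_update[OF nQ ys]
      by simp
  qed
qed

section \<open>Cutting a tuple of a composite in two\<close>

lemma one_tuple: "length Is = 1 \<Longrightarrow> [1] \<in> bs_tuples H Is"
  by (simp add: single_tuple)

text \<open>A factor with no steps contributes the unit.\<close>

definition split_left :: "'w set list \<Rightarrow> 'w set list \<Rightarrow> 'r::comm_ring_1 list \<Rightarrow> 'r list" where
  "split_left P Q zs = (if length P = 1 then [1] else if length Q = 1 then zs else take (length P - 1) zs)"

definition split_right :: "'w set list \<Rightarrow> 'w set list \<Rightarrow> 'r::comm_ring_1 list \<Rightarrow> 'r list" where
  "split_right P Q zs = (if length P = 1 then zs else if length Q = 1 then [1] else drop (length P - 1) zs)"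

text \<open>Cutting at the junction is a section of \<open>bs_glue\<close>. Hence tensors generate
  the composite, which yields the uniqueness of tensor products of maps.\<close>

lemma split_glue:
  assumes PQ: "glueable P Q" and zs: "zs \<in> bs_tuples H (P \<circ>\<^sub>e Q)"
  shows "split_left P Q zs \<in> bs_tuples H P" "split_right P Q zs \<in> bs_tuples H Q"
    "bs_glue P Q (split_left P Q zs) (split_right P Q zs) = zs"
proof -
  have ne: "zs \<noteq> []" using tuple_nonempty[OF glueable_nested[OF PQ] zs] .
  have "split_left P Q zs \<in> bs_tuples H P \<and> split_right P Q zs \<in> bs_tuples H Q \<and>
    bs_glue P Q (split_left P Q zs) (split_right P Q zs) = zs"
    using PQ
  proof (cases rule: glueable_cases)
    case left
    then show ?thesis using zs ne one_tuple[OF left(1), of H] by (simp add: split_left_def split_right_def bs_glue_def)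
  next
    case right
    then show ?thesis using zs ne one_tuple[OF right(2), of H] by (simp add: split_left_def split_right_def bs_glue_def)
  next
    case both
    then show ?thesis using split_tuple[OF both(3) zs] by (simp add: split_left_def split_right_def bs_glue_def)
  qed
  then show "split_left P Q zs \<in> bs_tuples H P" "split_right P Q zs \<in> bs_tuples H Q"
    "bs_glue P Q (split_left P Q zs) (split_right P Q zs) = zs" by auto
qed

lemma bs_tensor_generate:
  assumes PQ: "glueable P Q" and A: "group A" and f: "f \<in> hom (BS H (P \<circ>\<^sub>e Q)) A" and g: "g \<in> hom (BS H (P \<circ>\<^sub>e Q)) A"
    and eq: "\<And>U V. \<lbrakk>U \<in> carrier (BS H P); V \<in> carrier (BS H Q)\<rbrakk>
      \<Longrightarrow> f (bs_tensor H P Q U V) = g (bs_tensor H P Q U V)"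
    and W: "W \<in> carrier (BS H (P \<circ>\<^sub>e Q))"
  shows "f W = g W"
proof (rule BS_hom_eqI[OF glueable_nested[OF PQ] A f g _ W])
  fix zs assume "zs \<in> bs_tuples H (P \<circ>\<^sub>e Q)"
  note split_glue[OF PQ this]
  then show "f (pure H (P \<circ>\<^sub>e Q) zs) = g (pure H (P \<circ>\<^sub>e Q) zs)"
    using eq[of "pure H P (split_left P Q zs)" "pure H Q (split_right P Q zs)"]
      bs_tensor_pure[OF PQ, of "split_left P Q zs" H "split_right P Q zs"] by simp
qed

subsection \<open>Tensor products of bimodule maps\<close>

text \<open>Elements of \<open>Hom\<close> are sums of maps of various degrees; forgetting degrees
  and extensionality leaves the linearity from which a tensor product of maps is built.\<close>

definition bimap :: "'r set \<Rightarrow> 'r set \<Rightarrow> ('r, 'm) gr_bimodule \<Rightarrow> ('r, 'n) gr_bimodule \<Rightarrow>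
    ('m \<Rightarrow> 'n) \<Rightarrow> bool" where
  "bimap A B M N f \<longleftrightarrow> f \<in> hom M N \<and>
     (\<forall>a \<in> A. \<forall>x \<in> carrier M. f (lact M a x) = lact N a (f x)) \<and>
     (\<forall>b \<in> B. \<forall>x \<in> carrier M. f (ract M x b) = ract N (f x) b)"

lemma bimapD:
  assumes "bimap A B M N f"
  shows "f \<in> hom M N" "x \<in> carrier M \<Longrightarrow> f x \<in> carrier N"
    "\<lbrakk>a \<in> A; x \<in> carrier M\<rbrakk> \<Longrightarrow> f (lact M a x) = lact N a (f x)"
    "\<lbrakk>b \<in> B; x \<in> carrier M\<rbrakk> \<Longrightarrow> f (ract M x b) = ract N (f x) b"
  using assms by (auto simp: bimap_def hom_in_carrier)

abbreviation bs_bimap :: "('w, 'v::ab_group_add, 'k::field) realization_data \<Rightarrow> 'w set list \<Rightarrow>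
    'w set list \<Rightarrow> (('v, 'k) bs_elt \<Rightarrow> ('v, 'k) bs_elt) \<Rightarrow> bool" where
  "bs_bimap H P P' \<equiv> bimap (Sym_inv H (hd P)) (Sym_inv H (last P)) (BS H P) (BS H P')"

lemma bs_id_apply [simp]: "U \<in> carrier (BS H P) \<Longrightarrow> bs_id H P U = U"
  by (simp add: bs_id_def)

lemma bs_id_bimap:
  assumes "nested P"
  shows "bs_bimap H P P (bs_id H P)"
proof -
  have "bs_id H P \<in> hom (BS H P) (BS H P)"
    by (rule hom_cong_carrier[OF BS_group[OF assms], of "\<lambda>x. x"]) (auto simp: hom_def)
  then show ?thesis
    using lact_closed[OF assms, where H = H] ract_closed[OF assms, where H = H] by (simp add: bimap_def)
qed

text \<open>Source and target lists share their ends, so \<open>f\<close> and \<open>g\<close> are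
  linear over the same junction ring, and this makes their tensor product balanced.\<close>

locale tensor_maps =
  fixes H :: "('w, 'v::ab_group_add, 'k::field) realization_data"
    and P Q P' Q' :: "'w set list"
    and f g :: "('v, 'k) bs_elt \<Rightarrow> ('v, 'k) bs_elt"
  assumes PQ: "glueable P Q" and PQ': "glueable P' Q'"
    and ends: "hd P' = hd P" "last P' = last P" "hd Q' = hd Q" "last Q' = last Q"
    and f: "bs_bimap H P P' f" and g: "bs_bimap H Q Q' g"
begin

lemmas nP = glueableD(1)[OF PQ] and nQ = glueableD(2)[OF PQ] and nR = glueable_nested[OF PQ]
lemmas nR' = glueable_nested[OF PQ']

abbreviation T :: "('v, 'k) bs_elt \<Rightarrow> ('v, 'k) bs_elt \<Rightarrow> ('v, 'k) bs_elt" where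
  "T U V \<equiv> bs_tensor H P' Q' (f U) (g V)"

lemma T_hom_left: "V \<in> carrier (BS H Q) \<Longrightarrow> (\<lambda>U. T U V) \<in> hom (BS H P) (BS H (P' \<circ>\<^sub>e Q'))"
  by (rule hom_comp[OF bimapD(1)[OF f] bs_tensor_hom_left[OF PQ' bimapD(2)[OF g]]])

lemma T_hom_right: "U \<in> carrier (BS H P) \<Longrightarrow> (\<lambda>V. T U V) \<in> hom (BS H Q) (BS H (P' \<circ>\<^sub>e Q'))"
  by (rule hom_comp[OF bimapD(1)[OF g] bs_tensor_hom_right[OF PQ' bimapD(2)[OF f]]])

lemma T_middle:
  assumes "a \<in> Sym_inv H (last P)" "U \<in> carrier (BS H P)" "V \<in> carrier (BS H Q)"
  shows "T (ract (BS H P) U a) V = T U (lact (BS H Q) a V)"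
proof -
  have "a \<in> Sym_inv H (hd Q)" "a \<in> Sym_inv H (last P')" using assms(1) glueableD(3)[OF PQ] ends by auto
  then show ?thesis
    using bs_tensor_middle[OF PQ', of a H "f U" "g V"] bimapD[OF f] bimapD[OF g] assms by simp
qed

lemma T_balanced:
  assumes both: "mids (P \<circ>\<^sub>e Q) = mids P @ mids Q" "length P = Suc (length (mids P))"
    and nQ1: "length Q \<noteq> 1"
  shows "balanced_map H (P \<circ>\<^sub>e Q) (BS H (P' \<circ>\<^sub>e Q'))
    (\<lambda>zs. T (pure H P (take (length (mids P)) zs)) (pure H Q (drop (length (mids P)) zs)))"
    (is "balanced_map H ?R ?A ?\<phi>")
proof -
  let ?n = "length (mids P)"
  have n0: "0 < ?n" using mids_nonempty[OF nP] .
  have bl: "balanced_map H P ?A (\<lambda>xs. T (pure H P xs) (pure H Q ys))" if "ys \<in> bs_tuples H Q" for ys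
    using balanced_map_hom[OF pure_balanced[OF nP] T_hom_left] that by simp
  have br: "balanced_map H Q ?A (\<lambda>ys. T (pure H P xs) (pure H Q ys))" if "xs \<in> bs_tuples H P" for xs
    using balanced_map_hom[OF pure_balanced[OF nQ] T_hom_right] that by simp
  show ?thesis
  proof (rule balanced_mapI)
    fix zs assume zs: "zs \<in> bs_tuples H ?R"
    let ?x = "take ?n zs" and ?y = "drop ?n zs"
    note x = split_tuple(1)[OF both(1) zs] and y = split_tuple(2)[OF both(1) zs]
    have lz: "length zs = ?n + length (mids Q)" using tuple_length[OF zs] both(1) by simp
    show "?\<phi> zs \<in> carrier ?A" using balanced_mapD(1)[OF bl[OF y] x] .
    show "?\<phi> (zs[i := s + t]) = ?\<phi> (zs[i := s]) \<otimes>\<^bsub>?A\<^esub> ?\<phi> (zs[i := t])"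
      if i: "i < length (mids ?R)" and s: "s \<in> Sym_inv H (mids ?R ! i)" and t: "t \<in> Sym_inv H (mids ?R ! i)"
      for i s t
    proof (cases "i < ?n")
      case True
      then show ?thesis
        using balanced_mapD(2)[OF bl[OF y] x, of i s t] s t both(1) by (simp add: take_update_swap nth_append)
    next
      case False
      then show ?thesis
        using balanced_mapD(2)[OF br[OF x] y, of "i - ?n" s t] s t i both(1)
        by (simp add: drop_update_swap nth_append)
    qed
    show "?\<phi> (zs[i := zs ! i * a]) = ?\<phi> (zs[Suc i := a * zs ! Suc i])"
      if i: "Suc i < length (mids ?R)" and a: "a \<in> Sym_inv H (?R ! Suc i)" for i a
    proof -
      \<comment> \<open>The scalar moves inside the left factor, across the junction, or inside the
        right factor; the middle case is \<open>T_middle\<close>.\<close>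
      consider "Suc i < ?n" | "Suc i = ?n" | "?n \<le> i" by linarith
      then show ?thesis
      proof cases
        case 1
        then show ?thesis
          using balanced_mapD(3)[OF bl[OF y] x, of i a] a comp_nth(1)[OF both(2), of i Q]
          by (simp add: take_update_swap)
      next
        case 2
        have "P ! Suc i = last P" using 2 both(2) glueableD(4)[OF PQ] by (simp add: last_conv_nth)
        then have aP: "a \<in> Sym_inv H (last P)" using a comp_nth(1)[OF both(2), of i Q] 2 by simp
        then have aQ: "a \<in> Sym_inv H (hd Q)" using glueableD(3)[OF PQ] by simp
        have eq: "i = ?n - 1" using 2 by simp
        have 1: "ract (BS H P) (pure H P ?x) a = pure H P (?x[i := zs ! i * a])"
          using ract_hom(2)[OF nP aP x] eq n0 by simp
        have 2: "lact (BS H Q) a (pure H Q ?y) = pure H Q (?y[0 := a * zs ! Suc i])"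
          using lact_hom(2)[OF nQ aQ y] \<open>Suc i = ?n\<close> lz mids_nonempty[OF nQ] by (simp add: mult.commute)
        show ?thesis
          using T_middle[OF aP, of "pure H P ?x" "pure H Q ?y"] x y 1 2 \<open>Suc i = ?n\<close>
          by (simp add: take_update_swap drop_update_swap list_update_beyond)
      next
        case 3
        then obtain j where j: "i = ?n + j" using le_Suc_ex by blast
        have jQ: "Suc j < length (mids Q)" using i j both(1) by simp
        then have "Suc j < length Q" using nQ1 by (simp add: length_mids split: if_splits)
        then show ?thesis
          using balanced_mapD(3)[OF br[OF x] y jQ, of a] a j comp_nth(2)[OF both(2), of j Q] lz jQ
          by (simp add: drop_update_swap)
      qed
    qed
  qed
qed

text \<open>When one factor has no steps, the composite is the other factor and inserting the unit
  gives the map: the missing scalar is moved across the junction by \<open>T_middle\<close>.\<close>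

lemma tensor_map_pure:
  "\<exists>h \<in> hom (BS H (P \<circ>\<^sub>e Q)) (BS H (P' \<circ>\<^sub>e Q')). \<forall>xs \<in> bs_tuples H P. \<forall>ys \<in> bs_tuples H Q.
     h (pure H (P \<circ>\<^sub>e Q) (bs_glue P Q xs ys)) = T (pure H P xs) (pure H Q ys)"
  using PQ
proof (cases rule: glueable_cases)
  case left
  have one: "[1] \<in> bs_tuples H P" using one_tuple[OF left(1)] .
  then have onec: "pure H P [1] \<in> carrier (BS H P)" by simp
  show ?thesis
  proof (intro bexI[of _ "\<lambda>V. T (pure H P [1]) V"] ballI)
    show "(\<lambda>V. T (pure H P [1]) V) \<in> hom (BS H (P \<circ>\<^sub>e Q)) (BS H (P' \<circ>\<^sub>e Q'))"
      unfolding left(2) by (rule T_hom_right[OF onec])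
    fix xs ys assume xs: "xs \<in> bs_tuples H P" and ys: "ys \<in> bs_tuples H Q"
    obtain x where x: "xs = [x]" using xs single_tuple[OF left(1)] by blast
    have xQ: "x \<in> Sym_inv H (hd Q)"
      using single_hd[OF left(1) xs] x left(4) by (metis list.sel(1))
    then have xP: "x \<in> Sym_inv H (last P)" using glueableD(3)[OF PQ] by simp
    have "pure H (P \<circ>\<^sub>e Q) (bs_glue P Q xs ys) = lact (BS H Q) x (pure H Q ys)"
      unfolding left(2) using lact_hom(2)[OF nQ xQ ys] glue_forms(1)[OF PQ xs ys left(1)] x by simp
    moreover have "ract (BS H P) (pure H P [1]) x = pure H P xs"
      using ract_hom(2)[OF nP xP one] left(1,3) x by simp
    ultimately show "T (pure H P [1]) (pure H (P \<circ>\<^sub>e Q) (bs_glue P Q xs ys)) = T (pure H P xs) (pure H Q ys)"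
      using T_middle[OF xP onec, of "pure H Q ys"] ys by simp
  qed
next
  case right
  have one: "[1] \<in> bs_tuples H Q" using one_tuple[OF right(2)] .
  then have onec: "pure H Q [1] \<in> carrier (BS H Q)" by simp
  show ?thesis
  proof (intro bexI[of _ "\<lambda>U. T U (pure H Q [1])"] ballI)
    show "(\<lambda>U. T U (pure H Q [1])) \<in> hom (BS H (P \<circ>\<^sub>e Q)) (BS H (P' \<circ>\<^sub>e Q'))"
      unfolding right(3) by (rule T_hom_left[OF onec])
    fix xs ys assume xs: "xs \<in> bs_tuples H P" and ys: "ys \<in> bs_tuples H Q"
    obtain y where y: "ys = [y]" using ys single_tuple[OF right(2)] by blast
    have yQ: "y \<in> Sym_inv H (hd Q)" using single_hd[OF right(2) ys] y by simp
    then have yP: "y \<in> Sym_inv H (last P)" using glueableD(3)[OF PQ] by simp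
    have "pure H (P \<circ>\<^sub>e Q) (bs_glue P Q xs ys) = ract (BS H P) (pure H P xs) y"
      unfolding right(3) using ract_hom(2)[OF nP yP xs] glue_forms(2)[OF PQ xs ys right(1,2)] y by simp
    moreover have "lact (BS H Q) y (pure H Q [1]) = pure H Q ys"
      using lact_hom(2)[OF nQ yQ one] y by simp
    ultimately show "T (pure H (P \<circ>\<^sub>e Q) (bs_glue P Q xs ys)) (pure H Q [1]) = T (pure H P xs) (pure H Q ys)"
      using T_middle[OF yP _ onec, of "pure H P xs"] xs by simp
  qed
next
  case both
  obtain h where h: "h \<in> hom (BS H (P \<circ>\<^sub>e Q)) (BS H (P' \<circ>\<^sub>e Q'))"
    and eq: "\<And>zs. zs \<in> bs_tuples H (P \<circ>\<^sub>e Q) \<Longrightarrow> h (pure H (P \<circ>\<^sub>e Q) zs)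
      = T (pure H P (take (length (mids P)) zs)) (pure H Q (drop (length (mids P)) zs))"
    using BS_universal[OF nR BS_comm_group[OF nR'] T_balanced[OF both(3,4,2)]] by blast
  show ?thesis
  proof (intro bexI[OF _ h] ballI)
    fix xs ys assume xs: "xs \<in> bs_tuples H P" and ys: "ys \<in> bs_tuples H Q"
    then show "h (pure H (P \<circ>\<^sub>e Q) (bs_glue P Q xs ys)) = T (pure H P xs) (pure H Q ys)"
      using eq[OF glue_tuple[OF PQ xs ys]] glue_forms(3)[OF PQ xs ys both(1,2)] tuple_length[OF xs] by simp
  qed
qed

lemma tensor_map_exists:
  "\<exists>h \<in> hom (BS H (P \<circ>\<^sub>e Q)) (BS H (P' \<circ>\<^sub>e Q')).
     \<forall>U \<in> carrier (BS H P). \<forall>V \<in> carrier (BS H Q). h (bs_tensor H P Q U V) = T U V"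
proof -
  obtain h where h: "h \<in> hom (BS H (P \<circ>\<^sub>e Q)) (BS H (P' \<circ>\<^sub>e Q'))"
    and eq: "\<And>xs ys. \<lbrakk>xs \<in> bs_tuples H P; ys \<in> bs_tuples H Q\<rbrakk>
      \<Longrightarrow> h (pure H (P \<circ>\<^sub>e Q) (bs_glue P Q xs ys)) = T (pure H P xs) (pure H Q ys)"
    using tensor_map_pure by blast
  show ?thesis
  proof (intro bexI[OF _ h] ballI)
    fix U V assume U: "U \<in> carrier (BS H P)" and V: "V \<in> carrier (BS H Q)"
    show "h (bs_tensor H P Q U V) = T U V"
    proof (rule hom_eqI2[OF nP nQ BS_group[OF nR'] _ _ T_hom_left T_hom_right _ U V])
      show "(\<lambda>U. h (bs_tensor H P Q U V)) \<in> hom (BS H P) (BS H (P' \<circ>\<^sub>e Q'))" if "V \<in> carrier (BS H Q)" for V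
        using hom_comp[OF bs_tensor_hom_left[OF PQ that] h] .
      show "(\<lambda>V. h (bs_tensor H P Q U V)) \<in> hom (BS H Q) (BS H (P' \<circ>\<^sub>e Q'))" if "U \<in> carrier (BS H P)" for U
        using hom_comp[OF bs_tensor_hom_right[OF PQ that] h] .
      show "h (bs_tensor H P Q (pure H P xs) (pure H Q ys)) = T (pure H P xs) (pure H Q ys)"
        if "xs \<in> bs_tuples H P" "ys \<in> bs_tuples H Q" for xs ys
        using bs_tensor_pure[OF PQ that] eq[OF that] by simp
    qed
  qed
qed

abbreviation "tmap \<equiv> bs_tensor_map H P Q P' Q' f g"

text \<open>Existence and uniqueness together justify the definite description in
  \<open>bs_tensor_map\<close>.\<close>

lemma tensor_map:
  shows tmap_hom: "tmap \<in> hom (BS H (P \<circ>\<^sub>e Q)) (BS H (P' \<circ>\<^sub>e Q'))"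
    and tmap_ext: "tmap \<in> extensional (carrier (BS H (P \<circ>\<^sub>e Q)))"
    and tmap_tensor: "\<lbrakk>U \<in> carrier (BS H P); V \<in> carrier (BS H Q)\<rbrakk> \<Longrightarrow> tmap (bs_tensor H P Q U V) = T U V"
proof -
  let ?S = "carrier (BS H (P \<circ>\<^sub>e Q))"
  let ?C = "\<lambda>h. h \<in> hom (BS H (P \<circ>\<^sub>e Q)) (BS H (P' \<circ>\<^sub>e Q')) \<and> h \<in> extensional ?S \<and>
    (\<forall>U \<in> carrier (BS H P). \<forall>V \<in> carrier (BS H Q). h (bs_tensor H P Q U V) = T U V)"
  obtain h where h: "h \<in> hom (BS H (P \<circ>\<^sub>e Q)) (BS H (P' \<circ>\<^sub>e Q'))"
    and eq: "\<And>U V. \<lbrakk>U \<in> carrier (BS H P); V \<in> carrier (BS H Q)\<rbrakk> \<Longrightarrow> h (bs_tensor H P Q U V) = T U V"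
    using tensor_map_exists by blast
  \<comment> \<open>Restriction meets the extensionality clause, which pins the map down outside the
    carrier.\<close>
  have r1: "restrict h ?S \<in> hom (BS H (P \<circ>\<^sub>e Q)) (BS H (P' \<circ>\<^sub>e Q'))"
    by (rule hom_cong_carrier[OF BS_group[OF nR] h]) simp
  have r2: "restrict h ?S (bs_tensor H P Q U V) = T U V"
    if U: "U \<in> carrier (BS H P)" and V: "V \<in> carrier (BS H Q)" for U V
    using restrict_apply'[OF bs_tensor_closed[OF PQ U V]] eq[OF U V] by (rule HOL.trans)
  have ex: "?C (restrict h ?S)" by (intro conjI ballI r1 restrict_extensional r2)
  moreover have "k = restrict h ?S" if k: "?C k" for k
  proof (rule extensionalityI[of _ ?S])
    fix W assume W: "W \<in> ?S"
    show "k W = restrict h ?S W"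
    proof (rule bs_tensor_generate[OF PQ BS_group[OF nR'] _ r1 _ W])
      fix U V assume U: "U \<in> carrier (BS H P)" and V: "V \<in> carrier (BS H Q)"
      show "k (bs_tensor H P Q U V) = restrict h ?S (bs_tensor H P Q U V)"
        using k U V r2[OF U V] by simp
    qed (use k in simp)
  qed (use k in simp_all)
  ultimately have "?C tmap" unfolding bs_tensor_map_def by (rule theI)
  then show "tmap \<in> hom (BS H (P \<circ>\<^sub>e Q)) (BS H (P' \<circ>\<^sub>e Q'))" "tmap \<in> extensional ?S"
    "\<lbrakk>U \<in> carrier (BS H P); V \<in> carrier (BS H Q)\<rbrakk> \<Longrightarrow> tmap (bs_tensor H P Q U V) = T U V"
    by simp_all
qed

text \<open>Both sides of each linearity law are additive in the argument, and tensors generate the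
  composite.\<close>

lemma tmap_bimap: "bs_bimap H (P \<circ>\<^sub>e Q) (P' \<circ>\<^sub>e Q') tmap"
proof -
  let ?R = "P \<circ>\<^sub>e Q" and ?R' = "P' \<circ>\<^sub>e Q'"
  have hds: "hd ?R = hd P" "last ?R = last Q" "hd ?R' = hd P" "last ?R' = last Q"
    using glueableD[OF PQ] glueableD[OF PQ'] ends by auto
  have l: "tmap (lact (BS H ?R) a W) = lact (BS H ?R') a (tmap W)"
    if a: "a \<in> Sym_inv H (hd P)" and W: "W \<in> carrier (BS H ?R)" for a W
  proof (rule bs_tensor_generate[OF PQ BS_group[OF nR'] _ _ _ W])
    have aR: "a \<in> Sym_inv H (hd ?R)" and aR': "a \<in> Sym_inv H (hd ?R')" and aP': "a \<in> Sym_inv H (hd P')"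
      using a hds ends by simp_all
    show "(\<lambda>W. tmap (lact (BS H ?R) a W)) \<in> hom (BS H ?R) (BS H ?R')"
      using hom_comp[OF lact_hom(1)[OF nR aR] tmap_hom] .
    show "(\<lambda>W. lact (BS H ?R') a (tmap W)) \<in> hom (BS H ?R) (BS H ?R')"
      using hom_comp[OF tmap_hom lact_hom(1)[OF nR' aR']] .
    fix U V assume U: "U \<in> carrier (BS H P)" and V: "V \<in> carrier (BS H Q)"
    show "tmap (lact (BS H ?R) a (bs_tensor H P Q U V)) = lact (BS H ?R') a (tmap (bs_tensor H P Q U V))"
      using lact_tensor[OF PQ a U V] lact_tensor[OF PQ' aP' bimapD(2)[OF f U] bimapD(2)[OF g V]]
        tmap_tensor[OF U V] tmap_tensor[OF lact_closed[OF nP a U] V] bimapD(3)[OF f a U] by simp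
  qed
  have r: "tmap (ract (BS H ?R) W a) = ract (BS H ?R') (tmap W) a"
    if a: "a \<in> Sym_inv H (last Q)" and W: "W \<in> carrier (BS H ?R)" for a W
  proof (rule bs_tensor_generate[OF PQ BS_group[OF nR'] _ _ _ W])
    have aR: "a \<in> Sym_inv H (last ?R)" and aR': "a \<in> Sym_inv H (last ?R')" and aQ': "a \<in> Sym_inv H (last Q')"
      using a hds ends by simp_all
    show "(\<lambda>W. tmap (ract (BS H ?R) W a)) \<in> hom (BS H ?R) (BS H ?R')"
      using hom_comp[OF ract_hom(1)[OF nR aR] tmap_hom] .
    show "(\<lambda>W. ract (BS H ?R') (tmap W) a) \<in> hom (BS H ?R) (BS H ?R')"
      using hom_comp[OF tmap_hom ract_hom(1)[OF nR' aR']] .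
    fix U V assume U: "U \<in> carrier (BS H P)" and V: "V \<in> carrier (BS H Q)"
    show "tmap (ract (BS H ?R) (bs_tensor H P Q U V) a) = ract (BS H ?R') (tmap (bs_tensor H P Q U V)) a"
      using ract_tensor[OF PQ a U V] ract_tensor[OF PQ' aQ' bimapD(2)[OF f U] bimapD(2)[OF g V]]
        tmap_tensor[OF U V] tmap_tensor[OF U ract_closed[OF nQ a V]] bimapD(4)[OF g a V] by simp
  qed
  show ?thesis using l r tmap_hom unfolding bimap_def hds by blast
qed

end

subsection \<open>Grading\<close>

text \<open>The degrees are existentially quantified since the zero polynomial lies in every
  \<open>Sym_deg\<close>, so a tuple need not determine them.\<close>

definition homog :: "('w, 'v::ab_group_add, 'k::field) realization_data \<Rightarrow> 'w set list \<Rightarrow> int \<Rightarrow>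
    ('v, 'k) mpoly list \<Rightarrow> bool" where
  "homog H Is n xs \<longleftrightarrow> xs \<in> bs_tuples H Is \<and> (\<exists>ds. length ds = length xs \<and>
     (\<forall>i < length xs. xs ! i \<in> Sym_deg H (ds ! i + bs_shifts H Is ! i)) \<and> sum_list ds = n)"

lemma homog_tuple: "homog H Is n xs \<Longrightarrow> xs \<in> bs_tuples H Is"
  by (simp add: homog_def)

lemma homogI:
  assumes "xs \<in> bs_tuples H Is" "length ds = length xs" "sum_list ds = n"
    "\<And>i. i < length xs \<Longrightarrow> xs ! i \<in> Sym_deg H (ds ! i + bs_shifts H Is ! i)"
  shows "homog H Is n xs"
  using assms unfolding homog_def by blast

lemma homogD:
  "homog H Is n xs \<Longrightarrow> \<exists>ds. length ds = length xs \<and> sum_list ds = n \<and>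
    (\<forall>i < length xs. xs ! i \<in> Sym_deg H (ds ! i + bs_shifts H Is ! i))"
  unfolding homog_def by blast

text \<open>The quotient group and \<open>BS\<close> are records of different types with equal
  fields, and generation depends on these fields alone.\<close>

lemma generate_record_cong:
  fixes G :: "('a, 'b) monoid_scheme" and K :: "('a, 'c) monoid_scheme"
  assumes eq: "carrier G = carrier K" "monoid.mult G = monoid.mult K" "one G = one K"
  shows "generate G A \<subseteq> generate K A"
proof
  have minv: "inv\<^bsub>G\<^esub> x = inv\<^bsub>K\<^esub> x" for x by (simp add: m_inv_def eq)
  fix x assume "x \<in> generate G A"
  then show "x \<in> generate K A"
  proof induction
    case one
    show ?case unfolding eq by (rule generate.one)
  next
    case (inv h)
    then show ?case unfolding minv by (rule generate.inv)
  next
    case (eng a b)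
    show ?case unfolding eq using eng.IH by (rule generate.eng)
  qed (rule generate.incl)
qed

lemma gpart_homog: "gpart (BS H Is) n = generate (BS H Is) {pure H Is xs | xs. homog H Is n xs}"
proof -
  let ?A = "{pure H Is xs | xs. homog H Is n xs}"
  have A: "{bs_class H Is (frag_of xs) | xs ds. xs \<in> bs_tuples H Is \<and> length ds = length xs \<and>
      (\<forall>i < length xs. xs ! i \<in> Sym_deg H (ds ! i + bs_shifts H Is ! i)) \<and> sum_list ds = n} = ?A"
    unfolding homog_def by blast
  have "gpart (BS H Is) n = generate (bs_free H Is Mod bs_rel H Is) ?A"
    unfolding A[symmetric] by (simp add: BS_def)
  also have "\<dots> = generate (BS H Is) ?A"
    by (intro subset_antisym generate_record_cong) (simp_all only: BS_quotient)
  finally show ?thesis .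
qed

lemma homog_carrier: "{pure H Is xs | xs. homog H Is n xs} \<subseteq> carrier (BS H Is)"
  using homog_tuple by fastforce

lemma pure_gpart: "homog H Is n xs \<Longrightarrow> pure H Is xs \<in> gpart (BS H Is) n"
  unfolding gpart_homog by (rule generate.incl) blast

lemma gpart_closed: "nested Is \<Longrightarrow> U \<in> gpart (BS H Is) n \<Longrightarrow> U \<in> carrier (BS H Is)"
  unfolding gpart_homog by (rule group.generate_in_carrier[OF BS_group homog_carrier])

text \<open>A homogeneous part is a generated subgroup, so degrees are checked on homogeneous pure
  tensors.\<close>

lemma hom_gpart:
  assumes Is: "nested Is" and Js: "nested Js" and h: "h \<in> hom (BS H Is) (BS H Js)"
    and gen: "\<And>xs. homog H Is m xs \<Longrightarrow> h (pure H Is xs) \<in> gpart (BS H Js) n"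
    and "U \<in> gpart (BS H Is) m"
  shows "h U \<in> gpart (BS H Js) n"
proof -
  interpret h: group_hom "BS H Is" "BS H Js" h by (rule BS_group_hom[OF Is Js h])
  note cl = group.generate_in_carrier[OF BS_group[OF Is] homog_carrier]
  note minv = group.generate_m_inv_closed[OF BS_group[OF Js] homog_carrier]
  have "h U \<in> generate (BS H Js) {pure H Js xs | xs. homog H Js n xs}"
    using assms(5) unfolding gpart_homog
  proof induction
    case one
    show ?case using generate.one[of "BS H Js"] by simp
  next
    case (incl V)
    then show ?case using gen unfolding gpart_homog by blast
  next
    case (inv V)
    then have V: "V \<in> carrier (BS H Is)" using homog_carrier by blast
    have "h V \<in> generate (BS H Js) {pure H Js xs | xs. homog H Js n xs}"
      using inv gen unfolding gpart_homog by blast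
    then show ?case using minv V by simp
  next
    case (eng V W)
    then show ?case using cl[OF eng.hyps(1)] cl[OF eng.hyps(2)] by (simp add: generate.eng)
  qed
  then show ?thesis unfolding gpart_homog .
qed

lemma bs_shifts_single: "length Is = 1 \<Longrightarrow> bs_shifts H Is = [0]"
  by (simp add: bs_shifts_def)

lemma length_bs_shifts: "length (bs_shifts H Is) = length (mids Is)"
  by (simp add: bs_shifts_def length_mids)

lemma bs_shifts_comp:
  assumes PQ: "glueable P Q" and "length P \<noteq> 1" "length Q \<noteq> 1" "length P = Suc (length (mids P))"
  shows "bs_shifts H (P \<circ>\<^sub>e Q) = bs_shifts H P @ bs_shifts H Q"
proof -
  have "length (P \<circ>\<^sub>e Q) \<noteq> 1"
    using assms(4) mids_nonempty[OF glueableD(1)[OF PQ]] by (simp add: expr_comp_def)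
  moreover have "length (butlast P) = length (tl P)" by simp
  ultimately show ?thesis
    using assms(2,3) unfolding bs_shifts_def comp_butlast_tl[OF assms(1-3)] by (simp add: zip_append)
qed

lemma homog_one: "length Is = 1 \<Longrightarrow> homog H Is 0 [1]"
  by (rule homogI[of _ _ _ "[0]"]) (simp_all add: one_tuple bs_shifts_single Sym_deg_one)

text \<open>The list of degrees is cut at the junction along with the tuple; a factor without steps
  receives the unit, of degree 0.\<close>

lemma homog_split:
  assumes PQ: "glueable P Q" and zs: "homog H (P \<circ>\<^sub>e Q) n zs"
  shows "\<exists>m. homog H P m (split_left P Q zs) \<and> homog H Q (n - m) (split_right P Q zs)"
  using PQ
proof (cases rule: glueable_cases)
  case left
  then show ?thesis
    using zs homog_one[OF left(1), of H] by (intro exI[of _ 0]) (simp add: split_left_def split_right_def)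
next
  case right
  then show ?thesis
    using zs homog_one[OF right(2), of H] by (intro exI[of _ n]) (simp add: split_left_def split_right_def)
next
  case both
  let ?n = "length (mids P)"
  have t: "zs \<in> bs_tuples H (P \<circ>\<^sub>e Q)" using zs by (rule homog_tuple)
  have l: "length zs = ?n + length (mids Q)" using tuple_length[OF t] both(3) by simp
  obtain ds where ds: "length ds = length zs" "sum_list ds = n"
    "\<And>i. i < length zs \<Longrightarrow> zs ! i \<in> Sym_deg H (ds ! i + bs_shifts H (P \<circ>\<^sub>e Q) ! i)"
    using homogD[OF zs] by blast
  note sh = bs_shifts_comp[OF PQ both(1,2,4), of H]
  have "homog H P (sum_list (take ?n ds)) (take ?n zs)"
  proof (rule homogI[of _ _ _ "take ?n ds"])
    fix i assume "i < length (take ?n zs)"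
    then show "take ?n zs ! i \<in> Sym_deg H (take ?n ds ! i + bs_shifts H P ! i)"
      using ds(1) ds(3)[of i] sh l by (simp add: nth_append length_bs_shifts)
  qed (use split_tuple(1)[OF both(3) t] ds(1) in simp_all)
  moreover have "homog H Q (sum_list (drop ?n ds)) (drop ?n zs)"
  proof (rule homogI[of _ _ _ "drop ?n ds"])
    fix i assume "i < length (drop ?n zs)"
    then show "drop ?n zs ! i \<in> Sym_deg H (drop ?n ds ! i + bs_shifts H Q ! i)"
      using ds(1) ds(3)[of "?n + i"] sh l by (simp add: nth_append length_bs_shifts)
  qed (use split_tuple(2)[OF both(3) t] ds(1) in simp_all)
  moreover have "sum_list (drop ?n ds) = n - sum_list (take ?n ds)"
    using ds(2) sum_list_append[of "take ?n ds" "drop ?n ds"] by simp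
  ultimately show ?thesis
    using both by (intro exI[of _ "sum_list (take ?n ds)"]) (simp add: split_left_def split_right_def)
qed

lemma homog_scale:
  assumes xs: "homog H Is n xs" and j: "j < length xs" and a: "a \<in> Sym_deg H m"
    and t: "xs[j := xs ! j * a] \<in> bs_tuples H Is"
  shows "homog H Is (n + m) (xs[j := xs ! j * a])"
proof -
  obtain ds where ds: "length ds = length xs" "sum_list ds = n"
    "\<And>i. i < length xs \<Longrightarrow> xs ! i \<in> Sym_deg H (ds ! i + bs_shifts H Is ! i)"
    using homogD[OF xs] by blast
  show ?thesis
  proof (rule homogI[OF t, of "ds[j := ds ! j + m]"])
    show "sum_list (ds[j := ds ! j + m]) = n + m"
    proof -
      have "ds = take j ds @ ds ! j # drop (Suc j) ds" using j ds(1) by (simp add: id_take_nth_drop)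
      then have "n = sum_list (take j ds) + ds ! j + sum_list (drop (Suc j) ds)"
        using ds(2) by (metis add.assoc sum_list.Cons sum_list_append)
      moreover have "ds[j := ds ! j + m] = take j ds @ (ds ! j + m) # drop (Suc j) ds"
        using j ds(1) by (simp add: upd_conv_take_nth_drop)
      ultimately show ?thesis by simp
    qed
    fix i assume i: "i < length (xs[j := xs ! j * a])"
    have "xs ! j * a \<in> Sym_deg H ((ds ! j + bs_shifts H Is ! j) + m)"
      using ds(3)[OF j] a by (rule Sym_deg_mult)
    then show "xs[j := xs ! j * a] ! i \<in> Sym_deg H (ds[j := ds ! j + m] ! i + bs_shifts H Is ! i)"
      using i j ds(1) ds(3)[of i] by (cases "i = j") (simp_all add: algebra_simps)
  qed (use ds(1) in simp)
qed

lemma homog_single: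
  assumes "length Is = 1" "homog H Is n xs"
  shows "hd xs \<in> Sym_deg H n"
proof -
  obtain x where x: "xs = [x]" using single_tuple[OF assms(1)] homog_tuple[OF assms(2)] by blast
  obtain ds where "length ds = length xs" "sum_list ds = n"
    "\<And>i. i < length xs \<Longrightarrow> xs ! i \<in> Sym_deg H (ds ! i + bs_shifts H Is ! i)"
    using homogD[OF assms(2)] by blast
  then show ?thesis using x bs_shifts_single[OF assms(1), of H] by (auto simp: length_Suc_conv)
qed

lemma homog_glue:
  assumes PQ: "glueable P Q" and xs: "homog H P m xs" and ys: "homog H Q k ys"
  shows "homog H (P \<circ>\<^sub>e Q) (m + k) (bs_glue P Q xs ys)"
proof -
  note tx = homog_tuple[OF xs] and ty = homog_tuple[OF ys]
  note t = glue_tuple[OF PQ tx ty]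
  note nP = glueableD(1)[OF PQ] and nQ = glueableD(2)[OF PQ]
  from PQ show ?thesis
  proof (cases rule: glueable_cases)
    case left
    note eq = glue_forms(1)[OF PQ tx ty left(1)]
    have "0 < length ys" using tuple_nonempty[OF nQ ty] by simp
    then have "homog H Q (k + m) (ys[0 := ys ! 0 * hd xs])"
      using homog_scale[OF ys _ homog_single[OF left(1) xs]] t unfolding eq left(2) by blast
    then show ?thesis unfolding eq left(2) by (simp add: add.commute)
  next
    case right
    note eq = glue_forms(2)[OF PQ tx ty right(1,2)]
    have "length (mids P) - 1 < length xs" using tuple_length[OF tx] mids_nonempty[OF nP] by simp
    then show ?thesis
      using homog_scale[OF xs _ homog_single[OF right(2) ys]] t unfolding eq right(3) by blast
  next
    case both
    obtain ds where ds: "length ds = length xs" "sum_list ds = m"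
      "\<And>i. i < length xs \<Longrightarrow> xs ! i \<in> Sym_deg H (ds ! i + bs_shifts H P ! i)"
      using homogD[OF xs] by blast
    obtain es where es: "length es = length ys" "sum_list es = k"
      "\<And>i. i < length ys \<Longrightarrow> ys ! i \<in> Sym_deg H (es ! i + bs_shifts H Q ! i)"
      using homogD[OF ys] by blast
    note eq = glue_forms(3)[OF PQ tx ty both(1,2)] and sh = bs_shifts_comp[OF PQ both(1,2,4), of H]
    have lsh: "length (bs_shifts H P) = length xs" using tuple_length[OF tx] by (simp add: length_bs_shifts)
    show ?thesis
      unfolding eq
    proof (rule homogI[of _ _ _ "ds @ es"])
      show "xs @ ys \<in> bs_tuples H (P \<circ>\<^sub>e Q)" using t unfolding eq .
      fix i assume "i < length (xs @ ys)"
      then show "(xs @ ys) ! i \<in> Sym_deg H ((ds @ es) ! i + bs_shifts H (P \<circ>\<^sub>e Q) ! i)"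
        using ds(1,3) es(3)[of "i - length xs"] unfolding sh by (auto simp: nth_append lsh)
    qed (use ds es in simp_all)
  qed
qed

lemma bs_tensor_gpart:
  assumes PQ: "glueable P Q" and U: "U \<in> gpart (BS H P) m" and V: "V \<in> gpart (BS H Q) k"
  shows "bs_tensor H P Q U V \<in> gpart (BS H (P \<circ>\<^sub>e Q)) (m + k)"
proof -
  note nP = glueableD(1)[OF PQ] and nQ = glueableD(2)[OF PQ] and nR = glueable_nested[OF PQ]
  show ?thesis
  proof (rule hom_gpart[OF nQ nR bs_tensor_hom_right[OF PQ gpart_closed[OF nP U]] _ V])
    fix ys assume ys: "homog H Q k ys"
    note ty = homog_tuple[OF ys]
    show "bs_tensor H P Q U (pure H Q ys) \<in> gpart (BS H (P \<circ>\<^sub>e Q)) (m + k)"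
    proof (rule hom_gpart[OF nP nR bs_tensor_hom_left[OF PQ] _ U])
      show "pure H Q ys \<in> carrier (BS H Q)" using ty by simp
      show "bs_tensor H P Q (pure H P xs) (pure H Q ys) \<in> gpart (BS H (P \<circ>\<^sub>e Q)) (m + k)"
        if xs: "homog H P m xs" for xs
        unfolding bs_tensor_pure[OF PQ homog_tuple[OF xs] ty] by (rule pure_gpart[OF homog_glue[OF PQ xs ys]])
    qed
  qed
qed

lemma (in tensor_maps) tmap_gpart:
  assumes fi: "\<And>n. f ` gpart (BS H P) n \<subseteq> gpart (BS H P') (n + i)"
    and gj: "\<And>n. g ` gpart (BS H Q) n \<subseteq> gpart (BS H Q') (n + j)"
  shows "tmap ` gpart (BS H (P \<circ>\<^sub>e Q)) n \<subseteq> gpart (BS H (P' \<circ>\<^sub>e Q')) (n + (i + j))"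
proof
  fix W' assume "W' \<in> tmap ` gpart (BS H (P \<circ>\<^sub>e Q)) n"
  then obtain W where W: "W \<in> gpart (BS H (P \<circ>\<^sub>e Q)) n" "W' = tmap W" by blast
  have "tmap W \<in> gpart (BS H (P' \<circ>\<^sub>e Q')) (n + (i + j))"
  proof (rule hom_gpart[OF nR nR' tmap_hom _ W(1)])
    fix zs assume zs: "homog H (P \<circ>\<^sub>e Q) n zs"
    note s = split_glue[OF PQ homog_tuple[OF zs]]
    obtain m where m: "homog H P m (split_left P Q zs)" "homog H Q (n - m) (split_right P Q zs)"
      using homog_split[OF PQ zs] by blast
    have "pure H (P \<circ>\<^sub>e Q) zs = bs_tensor H P Q (pure H P (split_left P Q zs)) (pure H Q (split_right P Q zs))"
      using bs_tensor_pure[OF PQ s(1,2)] s(3) by simp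
    then have "tmap (pure H (P \<circ>\<^sub>e Q) zs) = T (pure H P (split_left P Q zs)) (pure H Q (split_right P Q zs))"
      using tmap_tensor s(1,2) by simp
    also have "\<dots> \<in> gpart (BS H (P' \<circ>\<^sub>e Q')) ((m + i) + ((n - m) + j))"
      using fi[of m] gj[of "n - m"] pure_gpart[OF m(1)] pure_gpart[OF m(2)]
      by (intro bs_tensor_gpart[OF PQ']) blast+
    finally show "tmap (pure H (P \<circ>\<^sub>e Q) zs) \<in> gpart (BS H (P' \<circ>\<^sub>e Q')) (n + (i + j))"
      by (simp add: algebra_simps)
  qed
  then show "W' \<in> gpart (BS H (P' \<circ>\<^sub>e Q')) (n + (i + j))" using W(2) by simp
qed

text \<open>Written with \<open>n + 0\<close> to match the degree condition of
  \<open>tmap_gpart\<close> for degree 0.\<close>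

lemma bs_id_gpart: "nested P \<Longrightarrow> bs_id H P ` gpart (BS H P) n \<subseteq> gpart (BS H P) (n + 0)"
  using gpart_closed by fastforce

subsection \<open>Sandwiching a bimodule map\<close>

lemma hom_finprod:
  assumes G: "comm_group G" and K: "comm_group K" and h: "h \<in> hom G K"
    and "finite A" "\<phi> \<in> A \<rightarrow> carrier G"
  shows "h (finprod G \<phi> A) = finprod K (\<lambda>i. h (\<phi> i)) A"
proof -
  interpret G: comm_group G by (rule G)
  interpret K: comm_group K by (rule K)
  interpret group_hom G K h using h by (simp add: group_hom_def group_hom_axioms_def G.is_group K.is_group)
  show ?thesis
    using assms(4,5)
  proof (induction A rule: finite_induct)
    case (insert i A)
    then have "h (finprod G \<phi> (insert i A)) = h (\<phi> i) \<otimes>\<^bsub>K\<^esub> h (finprod G \<phi> A)"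
      by (simp add: Pi_iff)
    moreover have "finprod K (\<lambda>i. h (\<phi> i)) (insert i A) = h (\<phi> i) \<otimes>\<^bsub>K\<^esub> finprod K (\<lambda>i. h (\<phi> i)) A"
      using insert by (simp add: Pi_iff)
    ultimately show ?case using insert by (simp add: Pi_iff)
  qed simp
qed

text \<open>Elements of \<open>Hom\<close> are pointwise finite sums; commutativity of the target
  makes such sums additive.\<close>

lemma finprod_hom:
  assumes M: "group M" and N: "comm_group N" and \<psi>: "\<And>i. i \<in> A \<Longrightarrow> \<psi> i \<in> hom M N"
  shows "(\<lambda>x. finprod N (\<lambda>i. \<psi> i x) A) \<in> hom M N"
proof (rule homI)
  interpret N: comm_group N by (rule N)
  fix x y assume x: "x \<in> carrier M" and y: "y \<in> carrier M"
  have cl: "\<psi> i z \<in> carrier N" if "i \<in> A" "z \<in> carrier M" for i z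
    using hom_in_carrier[OF \<psi>] that by blast
  show "finprod N (\<lambda>i. \<psi> i x) A \<in> carrier N"
    using cl x by (intro N.finprod_closed) blast
  have "finprod N (\<lambda>i. \<psi> i (x \<otimes>\<^bsub>M\<^esub> y)) A = finprod N (\<lambda>i. \<psi> i x \<otimes>\<^bsub>N\<^esub> \<psi> i y) A"
    using cl x y by (intro N.finprod_cong') (auto simp: hom_mult[OF \<psi>])
  also have "\<dots> = finprod N (\<lambda>i. \<psi> i x) A \<otimes>\<^bsub>N\<^esub> finprod N (\<lambda>i. \<psi> i y) A"
    using cl x y by (intro N.finprod_multf) blast+
  finally show "finprod N (\<lambda>i. \<psi> i (x \<otimes>\<^bsub>M\<^esub> y)) A
      = finprod N (\<lambda>i. \<psi> i x) A \<otimes>\<^bsub>N\<^esub> finprod N (\<lambda>i. \<psi> i y) A" .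
qed

lemma Hom_deg_bimap: "f \<in> Hom_deg A B i M N \<Longrightarrow> bimap A B M N f"
  by (auto simp: Hom_deg_def bimap_def)

text \<open>With \<open>P\<close> and \<open>R\<close> fixed, tensoring with their identities is an
  additive functor in the middle factor. The middle list stays variable because a morphism is to be
  factored through other expressions.\<close>

locale sandwich =
  fixes H :: "('w, 'v::ab_group_add, 'k::field) realization_data" and P R :: "'w set list"
  assumes nested_ends: "nested P" "nested R"
begin

definition fits :: "'w set list \<Rightarrow> bool" where
  "fits Q \<longleftrightarrow> nested Q \<and> hd Q = last P \<and> last Q = hd R"

abbreviation comp :: "'w set list \<Rightarrow> 'w set list" where
  "comp Q \<equiv> P \<circ>\<^sub>e Q \<circ>\<^sub>e R"

abbreviation mid_bimap :: "'w set list \<Rightarrow> 'w set list \<Rightarrow> (('v, 'k) bs_elt \<Rightarrow> ('v, 'k) bs_elt) \<Rightarrow> bool" where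
  "mid_bimap Q Q' \<equiv> bimap (Sym_inv H (last P)) (Sym_inv H (hd R)) (BS H Q) (BS H Q')"

text \<open>Bracketed like the composite \<open>P \<circ>\<^sub>e Q \<circ>\<^sub>e R\<close>, which
  associates to the right.\<close>

definition sw :: "'w set list \<Rightarrow> 'w set list \<Rightarrow> (('v, 'k) bs_elt \<Rightarrow> ('v, 'k) bs_elt) \<Rightarrow>
    ('v, 'k) bs_elt \<Rightarrow> ('v, 'k) bs_elt" where
  "sw Q Q' f = bs_tensor_map H P (Q \<circ>\<^sub>e R) P (Q' \<circ>\<^sub>e R) (bs_id H P)
     (bs_tensor_map H Q R Q' R f (bs_id H R))"

definition ten :: "'w set list \<Rightarrow> ('v, 'k) bs_elt \<Rightarrow> ('v, 'k) bs_elt \<Rightarrow> ('v, 'k) bs_elt \<Rightarrow> ('v, 'k) bs_elt" where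
  "ten Q U V W = bs_tensor H P (Q \<circ>\<^sub>e R) U (bs_tensor H Q R V W)"

lemma fitsD:
  assumes "fits Q"
  shows "nested Q" "hd Q = last P" "last Q = hd R" "glueable Q R" "glueable P (Q \<circ>\<^sub>e R)"
    "nested (Q \<circ>\<^sub>e R)" "nested (comp Q)" "hd (Q \<circ>\<^sub>e R) = last P" "last (Q \<circ>\<^sub>e R) = last R"
    "hd (comp Q) = hd P" "last (comp Q) = last R"
proof -
  show *: "nested Q" "hd Q = last P" "last Q = hd R" using assms by (auto simp: fits_def)
  then show QR: "glueable Q R" using nested_ends by (simp add: glueable_def)
  note ne = glueableD(4,5)[OF QR]
  show nQR: "nested (Q \<circ>\<^sub>e R)" using glueable_nested[OF QR] .
  show hQR: "hd (Q \<circ>\<^sub>e R) = last P" using * ne by simp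
  show lQR: "last (Q \<circ>\<^sub>e R) = last R" using * ne by simp
  show PQR: "glueable P (Q \<circ>\<^sub>e R)" using nQR hQR nested_ends by (simp add: glueable_def)
  show "nested (comp Q)" using glueable_nested[OF PQR] .
  show "hd (comp Q) = hd P" using glueableD(4)[OF PQR] by simp
  show "last (comp Q) = last R" using glueableD(3-5)[OF PQR] lQR by simp
qed

lemma ten_closed:
  "\<lbrakk>fits Q; U \<in> carrier (BS H P); V \<in> carrier (BS H Q); W \<in> carrier (BS H R)\<rbrakk>
    \<Longrightarrow> ten Q U V W \<in> carrier (BS H (comp Q))"
  unfolding ten_def by (intro bs_tensor_closed fitsD)

lemma ten_hom:
  assumes "fits Q" "U \<in> carrier (BS H P)" "W \<in> carrier (BS H R)"
  shows "(\<lambda>V. ten Q U V W) \<in> hom (BS H Q) (BS H (comp Q))"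
  unfolding ten_def
  by (rule hom_comp[OF bs_tensor_hom_left[OF fitsD(4)[OF assms(1)] assms(3)]
      bs_tensor_hom_right[OF fitsD(5)[OF assms(1)] assms(2)]])

lemma comp_hom_eqI:
  assumes Q: "fits Q" and A: "group A" and h: "h \<in> hom (BS H (comp Q)) A" and k: "k \<in> hom (BS H (comp Q)) A"
    and eq: "\<And>U V W. \<lbrakk>U \<in> carrier (BS H P); V \<in> carrier (BS H Q); W \<in> carrier (BS H R)\<rbrakk>
      \<Longrightarrow> h (ten Q U V W) = k (ten Q U V W)"
    and Z: "Z \<in> carrier (BS H (comp Q))"
  shows "h Z = k Z"
proof (rule bs_tensor_generate[OF fitsD(5)[OF Q] A h k _ Z])
  fix U Y assume U: "U \<in> carrier (BS H P)" and Y: "Y \<in> carrier (BS H (Q \<circ>\<^sub>e R))"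
  note hr = bs_tensor_hom_right[OF fitsD(5)[OF Q] U]
  show "h (bs_tensor H P (Q \<circ>\<^sub>e R) U Y) = k (bs_tensor H P (Q \<circ>\<^sub>e R) U Y)"
  proof (rule bs_tensor_generate[OF fitsD(4)[OF Q] A hom_comp[OF hr h] hom_comp[OF hr k] _ Y])
    fix V W assume "V \<in> carrier (BS H Q)" "W \<in> carrier (BS H R)"
    then show "h (bs_tensor H P (Q \<circ>\<^sub>e R) U (bs_tensor H Q R V W))
        = k (bs_tensor H P (Q \<circ>\<^sub>e R) U (bs_tensor H Q R V W))"
      using eq[OF U] unfolding ten_def by blast
  qed
qed

lemma inner_tensor_maps:
  assumes Q: "fits Q" "fits Q'" and f: "mid_bimap Q Q' f"
  shows "tensor_maps H Q R Q' R f (bs_id H R)"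
proof
  show "glueable Q R" "glueable Q' R" using Q fitsD by blast+
  show "hd Q' = hd Q" "last Q' = last Q" using fitsD(2,3)[OF Q(1)] fitsD(2,3)[OF Q(2)] by simp_all
  show "bs_bimap H Q Q' f" using f fitsD(2,3)[OF Q(1)] by simp
  show "bs_bimap H R R (bs_id H R)" using bs_id_bimap nested_ends by blast
qed simp_all

lemma outer_tensor_maps:
  assumes Q: "fits Q" "fits Q'" and f: "mid_bimap Q Q' f"
  shows "tensor_maps H P (Q \<circ>\<^sub>e R) P (Q' \<circ>\<^sub>e R) (bs_id H P) (bs_tensor_map H Q R Q' R f (bs_id H R))"
proof
  interpret I: tensor_maps H Q R Q' R f "bs_id H R" by (rule inner_tensor_maps[OF assms])
  show "glueable P (Q \<circ>\<^sub>e R)" "glueable P (Q' \<circ>\<^sub>e R)" using Q fitsD by blast+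
  show "hd (Q' \<circ>\<^sub>e R) = hd (Q \<circ>\<^sub>e R)" "last (Q' \<circ>\<^sub>e R) = last (Q \<circ>\<^sub>e R)"
    using fitsD(8,9)[OF Q(1)] fitsD(8,9)[OF Q(2)] by simp_all
  show "bs_bimap H P P (bs_id H P)" using bs_id_bimap nested_ends by blast
  show "bs_bimap H (Q \<circ>\<^sub>e R) (Q' \<circ>\<^sub>e R) I.tmap" by (rule I.tmap_bimap)
qed simp_all

lemma sw_props:
  assumes Q: "fits Q" "fits Q'" and f: "mid_bimap Q Q' f"
  shows sw_hom: "sw Q Q' f \<in> hom (BS H (comp Q)) (BS H (comp Q'))"
    and sw_ext: "sw Q Q' f \<in> extensional (carrier (BS H (comp Q)))"
    and sw_ten: "\<lbrakk>U \<in> carrier (BS H P); V \<in> carrier (BS H Q); W \<in> carrier (BS H R)\<rbrakk>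
      \<Longrightarrow> sw Q Q' f (ten Q U V W) = ten Q' U (f V) W"
    and sw_bimap: "bimap (Sym_inv H (hd P)) (Sym_inv H (last R)) (BS H (comp Q)) (BS H (comp Q')) (sw Q Q' f)"
proof -
  interpret I: tensor_maps H Q R Q' R f "bs_id H R" by (rule inner_tensor_maps[OF assms])
  interpret O: tensor_maps H P "Q \<circ>\<^sub>e R" P "Q' \<circ>\<^sub>e R" "bs_id H P" I.tmap
    by (rule outer_tensor_maps[OF assms])
  show "sw Q Q' f \<in> hom (BS H (comp Q)) (BS H (comp Q'))" unfolding sw_def by (rule O.tmap_hom)
  show "sw Q Q' f \<in> extensional (carrier (BS H (comp Q)))" unfolding sw_def by (rule O.tmap_ext)
  show "bimap (Sym_inv H (hd P)) (Sym_inv H (last R)) (BS H (comp Q)) (BS H (comp Q')) (sw Q Q' f)"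
    using O.tmap_bimap unfolding sw_def fitsD(10,11)[OF Q(1)] .
  show "sw Q Q' f (ten Q U V W) = ten Q' U (f V) W"
    if "U \<in> carrier (BS H P)" "V \<in> carrier (BS H Q)" "W \<in> carrier (BS H R)"
    using that O.tmap_tensor[OF that(1) bs_tensor_closed[OF fitsD(4)[OF Q(1)] that(2,3)]] I.tmap_tensor[OF that(2,3)]
    unfolding sw_def ten_def by simp
qed

text \<open>Triple tensors generate the composite, so the values on them determine
  \<open>sw\<close>. Compatibility with zero, sums, composites and the decomposition into degrees
  are all instances of this.\<close>

lemma sw_eqI:
  assumes Q: "fits Q" "fits Q'" and f: "mid_bimap Q Q' f"
    and h: "h \<in> hom (BS H (comp Q)) (BS H (comp Q'))"
    and eq: "\<And>U V W. \<lbrakk>U \<in> carrier (BS H P); V \<in> carrier (BS H Q); W \<in> carrier (BS H R)\<rbrakk>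
      \<Longrightarrow> h (ten Q U V W) = ten Q' U (f V) W"
  shows "sw Q Q' f = restrict h (carrier (BS H (comp Q)))"
proof (rule extensionalityI[OF sw_ext[OF Q f] restrict_extensional])
  fix Z assume Z: "Z \<in> carrier (BS H (comp Q))"
  have "sw Q Q' f Z = h Z"
  proof (rule comp_hom_eqI[OF Q(1) BS_group[OF fitsD(7)[OF Q(2)]] sw_hom[OF Q f] h _ Z])
    fix U V W assume *: "U \<in> carrier (BS H P)" "V \<in> carrier (BS H Q)" "W \<in> carrier (BS H R)"
    show "sw Q Q' f (ten Q U V W) = h (ten Q U V W)" using sw_ten[OF Q f *] eq[OF *] by simp
  qed
  then show "sw Q Q' f Z = restrict h (carrier (BS H (comp Q))) Z" using Z by simp
qed

lemma sw_Hom_deg: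
  assumes Q: "fits Q" "fits Q'"
    and f: "f \<in> Hom_deg (Sym_inv H (last P)) (Sym_inv H (hd R)) i (BS H Q) (BS H Q')"
  shows "sw Q Q' f \<in> Hom_deg (Sym_inv H (hd P)) (Sym_inv H (last R)) i (BS H (comp Q)) (BS H (comp Q'))"
proof -
  have bm: "mid_bimap Q Q' f" using f by (rule Hom_deg_bimap)
  interpret I: tensor_maps H Q R Q' R f "bs_id H R" by (rule inner_tensor_maps[OF Q bm])
  interpret O: tensor_maps H P "Q \<circ>\<^sub>e R" P "Q' \<circ>\<^sub>e R" "bs_id H P" I.tmap
    by (rule outer_tensor_maps[OF Q bm])
  have fi: "f ` gpart (BS H Q) n \<subseteq> gpart (BS H Q') (n + i)" for n using f by (simp add: Hom_deg_def)
  have "I.tmap ` gpart (BS H (Q \<circ>\<^sub>e R)) n \<subseteq> gpart (BS H (Q' \<circ>\<^sub>e R)) (n + (i + 0))" for n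
    using fi bs_id_gpart[OF nested_ends(2)] by (rule I.tmap_gpart)
  \<comment> \<open>The identities on both sides contribute degree 0, which leaves
    \<open>i\<close>.\<close>
  then have "sw Q Q' f ` gpart (BS H (comp Q)) n \<subseteq> gpart (BS H (comp Q')) (n + (0 + (i + 0)))" for n
    unfolding sw_def by (rule O.tmap_gpart[OF bs_id_gpart[OF nested_ends(1)]])
  then show ?thesis
    using sw_bimap[OF Q bm] sw_ext[OF Q bm] by (simp add: Hom_deg_def bimap_def)
qed

text \<open>The scalar actions are additive, hence commute with the finite sum over degrees.\<close>

lemma Hom_bimap:
  assumes M: "nested Is" and N: "nested Js" and ends: "hd Js = hd Is" "last Js = last Is"
    and f: "f \<in> Hom (Sym_inv H (hd Is)) (Sym_inv H (last Is)) (BS H Is) (BS H Js)"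
  shows "bs_bimap H Is Js f"
proof -
  interpret N: comm_group "BS H Js" by (rule BS_comm_group[OF N])
  obtain F \<phi> where F: "finite F"
    and deg: "\<And>i. i \<in> F \<Longrightarrow> \<phi> i \<in> Hom_deg (Sym_inv H (hd Is)) (Sym_inv H (last Is)) i (BS H Is) (BS H Js)"
    and f_eq: "f = (\<lambda>x \<in> carrier (BS H Is). finprod (BS H Js) (\<lambda>i. \<phi> i x) F)"
    using f unfolding Hom_def by blast
  note \<phi> = Hom_deg_bimap[OF deg]
  let ?s = "\<lambda>x. finprod (BS H Js) (\<lambda>i. \<phi> i x) F"
  have fs: "f x = ?s x" if "x \<in> carrier (BS H Is)" for x using that f_eq by simp
  have s: "?s \<in> hom (BS H Is) (BS H Js)"
    using bimapD(1)[OF \<phi>] by (intro finprod_hom BS_group M N.comm_group_axioms)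
  have cl: "(\<lambda>i. \<phi> i x) \<in> F \<rightarrow> carrier (BS H Js)" if "x \<in> carrier (BS H Is)" for x
    using bimapD(2)[OF \<phi> that] by blast
  show ?thesis
    unfolding bimap_def
  proof (intro conjI ballI)
    show "f \<in> hom (BS H Is) (BS H Js)" using hom_cong_carrier[OF BS_group[OF M] s fs] .
    fix a x assume x: "x \<in> carrier (BS H Is)"
    show "f (lact (BS H Is) a x) = lact (BS H Js) a (f x)" if a: "a \<in> Sym_inv H (hd Is)"
    proof -
      have aJ: "a \<in> Sym_inv H (hd Js)" using a ends by simp
      have "f (lact (BS H Is) a x) = finprod (BS H Js) (\<lambda>i. lact (BS H Js) a (\<phi> i x)) F"
        unfolding fs[OF lact_closed[OF M a x]] using bimapD(3)[OF \<phi> a x] lact_closed[OF N aJ bimapD(2)[OF \<phi> x]]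
        by (intro N.finprod_cong') simp_all
      also have "\<dots> = lact (BS H Js) a (?s x)"
        using hom_finprod[OF N.comm_group_axioms N.comm_group_axioms lact_hom(1)[OF N aJ] F cl[OF x]] by simp
      finally show ?thesis using fs[OF x] by simp
    qed
    show "f (ract (BS H Is) x a) = ract (BS H Js) (f x) a" if a: "a \<in> Sym_inv H (last Is)"
    proof -
      have aJ: "a \<in> Sym_inv H (last Js)" using a ends by simp
      have "f (ract (BS H Is) x a) = finprod (BS H Js) (\<lambda>i. ract (BS H Js) (\<phi> i x) a) F"
        unfolding fs[OF ract_closed[OF M a x]] using bimapD(4)[OF \<phi> a x] ract_closed[OF N aJ bimapD(2)[OF \<phi> x]]
        by (intro N.finprod_cong') simp_all
      also have "\<dots> = ract (BS H Js) (?s x) a"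
        using hom_finprod[OF N.comm_group_axioms N.comm_group_axioms ract_hom(1)[OF N aJ] F cl[OF x]] by simp
      finally show ?thesis using fs[OF x] by simp
    qed
  qed
qed

lemma Hom_mid_bimap:
  assumes Q: "fits Q" "fits Q'" and f: "f \<in> Hom (Sym_inv H (last P)) (Sym_inv H (hd R)) (BS H Q) (BS H Q')"
  shows "mid_bimap Q Q' f"
  using Hom_bimap[OF fitsD(1)[OF Q(1)] fitsD(1)[OF Q(2)], of f] fitsD(2,3)[OF Q(1)] fitsD(2,3)[OF Q(2)] f
  by simp

text \<open>Homogeneous components are sandwiched separately, each keeping its degree, and by
  \<open>sw_eqI\<close> the sandwich of the sum is the sum of the results.\<close>

lemma sw_Hom:
  assumes Q: "fits Q" "fits Q'"
    and f: "f \<in> Hom (Sym_inv H (last P)) (Sym_inv H (hd R)) (BS H Q) (BS H Q')"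
  shows "sw Q Q' f \<in> Hom (Sym_inv H (hd P)) (Sym_inv H (last R)) (BS H (comp Q)) (BS H (comp Q'))"
proof -
  note nQ' = fitsD(1)[OF Q(2)] and nC' = fitsD(7)[OF Q(2)]
  obtain F \<phi> where F: "finite F"
    and \<phi>: "\<And>i. i \<in> F \<Longrightarrow> \<phi> i \<in> Hom_deg (Sym_inv H (last P)) (Sym_inv H (hd R)) i (BS H Q) (BS H Q')"
    and f_eq: "f = (\<lambda>x \<in> carrier (BS H Q). finprod (BS H Q') (\<lambda>i. \<phi> i x) F)"
    using f unfolding Hom_def by blast
  note b\<phi> = Hom_deg_bimap[OF \<phi>]
  interpret N: comm_group "BS H (comp Q')" by (rule BS_comm_group[OF nC'])
  let ?s = "\<lambda>x. finprod (BS H (comp Q')) (\<lambda>i. sw Q Q' (\<phi> i) x) F"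
  have "sw Q Q' f = restrict ?s (carrier (BS H (comp Q)))"
  proof (rule sw_eqI[OF Q Hom_mid_bimap[OF Q f]])
    show "?s \<in> hom (BS H (comp Q)) (BS H (comp Q'))"
      using sw_hom[OF Q b\<phi>] by (intro finprod_hom BS_group fitsD(7)[OF Q(1)] N.comm_group_axioms)
    fix U V W assume *: "U \<in> carrier (BS H P)" "V \<in> carrier (BS H Q)" "W \<in> carrier (BS H R)"
    have cl: "(\<lambda>i. \<phi> i V) \<in> F \<rightarrow> carrier (BS H Q')" using bimapD(2)[OF b\<phi> *(2)] by blast
    have "?s (ten Q U V W) = finprod (BS H (comp Q')) (\<lambda>i. ten Q' U (\<phi> i V) W) F"
      using sw_ten[OF Q b\<phi> *] ten_closed[OF Q(2) *(1) bimapD(2)[OF b\<phi> *(2)] *(3)]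
      by (intro N.finprod_cong') simp_all
    also have "\<dots> = ten Q' U (finprod (BS H Q') (\<lambda>i. \<phi> i V) F) W"
      using hom_finprod[OF BS_comm_group[OF nQ'] N.comm_group_axioms ten_hom[OF Q(2) *(1,3)] F cl] by simp
    finally show "?s (ten Q U V W) = ten Q' U (f V) W" using f_eq *(2) by simp
  qed
  then show ?thesis
    unfolding Hom_def using F sw_Hom_deg[OF Q \<phi>]
    by (intro CollectI exI[of _ F] exI[of _ "\<lambda>i. sw Q Q' (\<phi> i)"]) simp
qed

text \<open>Linearity is proved along with membership because \<open>sw_eqI\<close> requires it of
  each map met in the induction. Information on cosets enters only through the assumption on
  \<open>D\<close> and \<open>D'\<close>.\<close>

lemma sw_ideal:
  assumes Q: "fits Q"
    and D: "\<And>M q. \<lbrakk>q \<in> D; expresses H M q\<rbrakk> \<Longrightarrow> fits M \<and> (\<exists>x \<in> D'. expresses H (comp M) x)"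
    and f: "f \<in> Hom_ideal H (last P) (hd R) D (BS H Q) (BS H Q)"
  shows "mid_bimap Q Q f \<and> sw Q Q f \<in> Hom_ideal H (hd P) (last R) D' (BS H (comp Q)) (BS H (comp Q))"
  using f
proof induction
  note nQ = fitsD(1)[OF Q] and nC = fitsD(7)[OF Q]
  interpret B: comm_group "BS H Q" by (rule BS_comm_group[OF nQ])
  interpret N: comm_group "BS H (comp Q)" by (rule BS_comm_group[OF nC])
  have one_ten: "ten Q U \<one>\<^bsub>BS H Q\<^esub> W = \<one>\<^bsub>BS H (comp Q)\<^esub>"
    if "U \<in> carrier (BS H P)" "W \<in> carrier (BS H R)" for U W
    using group_hom.hom_one[OF BS_group_hom[OF nQ nC ten_hom[OF Q that]]] .
  {
    case zero
    let ?z = "\<lambda>x \<in> carrier (BS H Q). \<one>\<^bsub>BS H Q\<^esub>"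
    have z: "?z \<in> hom (BS H Q) (BS H Q)" by (rule homI) simp_all
    have "lact (BS H Q) a \<one>\<^bsub>BS H Q\<^esub> = \<one>\<^bsub>BS H Q\<^esub>" if "a \<in> Sym_inv H (last P)" for a
      using group_hom.hom_one[OF BS_group_hom[OF nQ nQ lact_hom(1)[OF nQ]], of a] that fitsD(2)[OF Q] by simp
    moreover have "ract (BS H Q) \<one>\<^bsub>BS H Q\<^esub> a = \<one>\<^bsub>BS H Q\<^esub>" if "a \<in> Sym_inv H (hd R)" for a
      using group_hom.hom_one[OF BS_group_hom[OF nQ nQ ract_hom(1)[OF nQ]], of a] that fitsD(3)[OF Q] by simp
    ultimately have bz: "mid_bimap Q Q ?z"
      using z lact_closed[OF nQ, where H = H] ract_closed[OF nQ, where H = H] fitsD(2,3)[OF Q]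
      by (simp add: bimap_def)
    have "sw Q Q ?z = (\<lambda>x \<in> carrier (BS H (comp Q)). \<one>\<^bsub>BS H (comp Q)\<^esub>)"
      by (rule sw_eqI[OF Q Q bz]) (simp_all add: hom_def one_ten)
    then show ?case using bz Hom_ideal.zero by metis
  next
    case (factor q M f g)
    have M: "fits M" and "\<exists>x \<in> D'. expresses H (comp M) x" using D factor by blast+
    then obtain x where x: "x \<in> D'" "expresses H (comp M) x" by blast
    have bf: "mid_bimap Q M f" and bg: "mid_bimap M Q g"
      using Hom_mid_bimap[OF Q M factor(3)] Hom_mid_bimap[OF M Q factor(4)] by auto
    let ?c = "compose (carrier (BS H Q)) g f"
    have ch: "?c \<in> hom (BS H Q) (BS H Q)"
      using hom_cong_carrier[OF B.is_group hom_comp[OF bimapD(1)[OF bf] bimapD(1)[OF bg]], of ?c]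
      by (simp add: compose_def)
    have bc: "mid_bimap Q Q ?c"
      unfolding bimap_def
    proof (intro conjI ballI ch)
      fix a x assume x: "x \<in> carrier (BS H Q)"
      show "?c (lact (BS H Q) a x) = lact (BS H Q) a (?c x)" if "a \<in> Sym_inv H (last P)"
        using that x lact_closed[OF nQ _ x, of a] fitsD(2)[OF Q] bimapD(3)[OF bf that x]
          bimapD(3)[OF bg that bimapD(2)[OF bf x]] by (simp add: compose_def)
      show "?c (ract (BS H Q) x a) = ract (BS H Q) (?c x) a" if "a \<in> Sym_inv H (hd R)"
        using that x ract_closed[OF nQ _ x, of a] fitsD(3)[OF Q] bimapD(4)[OF bf that x]
          bimapD(4)[OF bg that bimapD(2)[OF bf x]] by (simp add: compose_def)
    qed
    \<comment> \<open>Functoriality: the sandwiched composite factors through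
      \<open>BS H (comp M)\<close>, and \<open>comp M\<close> expresses a coset in
      \<open>D'\<close>.\<close>
    have "sw Q Q ?c = restrict (\<lambda>Z. sw M Q g (sw Q M f Z)) (carrier (BS H (comp Q)))"
    proof (rule sw_eqI[OF Q Q bc])
      show "(\<lambda>Z. sw M Q g (sw Q M f Z)) \<in> hom (BS H (comp Q)) (BS H (comp Q))"
        by (rule hom_comp[OF sw_hom[OF Q M bf] sw_hom[OF M Q bg]])
      fix U V W assume *: "U \<in> carrier (BS H P)" "V \<in> carrier (BS H Q)" "W \<in> carrier (BS H R)"
      show "sw M Q g (sw Q M f (ten Q U V W)) = ten Q U (?c V) W"
        using sw_ten[OF Q M bf *] sw_ten[OF M Q bg *(1) bimapD(2)[OF bf *(2)] *(3)] *(2)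
        by (simp add: compose_def)
    qed
    then have "sw Q Q ?c = compose (carrier (BS H (comp Q))) (sw M Q g) (sw Q M f)"
      by (simp add: compose_def)
    moreover have "compose (carrier (BS H (comp Q))) (sw M Q g) (sw Q M f)
        \<in> Hom_ideal H (hd P) (last R) D' (BS H (comp Q)) (BS H (comp Q))"
      by (rule Hom_ideal.factor[OF x sw_Hom[OF Q M factor(3)] sw_Hom[OF M Q factor(4)]])
    ultimately show ?case using bc by simp
  next
    case (add f g)
    then have bf: "mid_bimap Q Q f" and bg: "mid_bimap Q Q g" by auto
    let ?s = "\<lambda>x \<in> carrier (BS H Q). f x \<otimes>\<^bsub>BS H Q\<^esub> g x"
    \<comment> \<open>Stated for arbitrary lists because it serves both \<open>Q\<close> and the
      composite.\<close>
    have sum_hom: "(\<lambda>x. h x \<otimes>\<^bsub>BS H Js\<^esub> k x) \<in> hom (BS H Is) (BS H Js)"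
      if n: "nested Js" and h: "h \<in> hom (BS H Is) (BS H Js)" and k: "k \<in> hom (BS H Is) (BS H Js)" for h k Is Js
    proof -
      interpret J: comm_group "BS H Js" by (rule BS_comm_group[OF n])
      show ?thesis
        using h k by (intro homI) (simp_all add: hom_in_carrier hom_mult J.m_ac)
    qed
    have s: "?s \<in> hom (BS H Q) (BS H Q)"
      using hom_cong_carrier[OF B.is_group sum_hom[OF nQ bimapD(1)[OF bf] bimapD(1)[OF bg]], of ?s] by simp
    have bs: "mid_bimap Q Q ?s"
      unfolding bimap_def
    proof (intro conjI ballI s)
      fix a x assume x: "x \<in> carrier (BS H Q)"
      show "?s (lact (BS H Q) a x) = lact (BS H Q) a (?s x)" if a: "a \<in> Sym_inv H (last P)"
        using a x lact_closed[OF nQ _ x, of a] fitsD(2)[OF Q] bimapD(3)[OF bf a x] bimapD(3)[OF bg a x]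
          hom_mult[OF lact_hom(1)[OF nQ] bimapD(2)[OF bf x] bimapD(2)[OF bg x], of a] by simp
      show "?s (ract (BS H Q) x a) = ract (BS H Q) (?s x) a" if a: "a \<in> Sym_inv H (hd R)"
        using a x ract_closed[OF nQ _ x, of a] fitsD(3)[OF Q] bimapD(4)[OF bf a x] bimapD(4)[OF bg a x]
          hom_mult[OF ract_hom(1)[OF nQ] bimapD(2)[OF bf x] bimapD(2)[OF bg x], of a] by simp
    qed
    have "sw Q Q ?s = (\<lambda>x \<in> carrier (BS H (comp Q)). sw Q Q f x \<otimes>\<^bsub>BS H (comp Q)\<^esub> sw Q Q g x)"
    proof (rule sw_eqI[OF Q Q bs])
      show "(\<lambda>x. sw Q Q f x \<otimes>\<^bsub>BS H (comp Q)\<^esub> sw Q Q g x) \<in> hom (BS H (comp Q)) (BS H (comp Q))"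
        by (rule sum_hom[OF nC sw_hom[OF Q Q bf] sw_hom[OF Q Q bg]])
      fix U V W assume *: "U \<in> carrier (BS H P)" "V \<in> carrier (BS H Q)" "W \<in> carrier (BS H R)"
      show "sw Q Q f (ten Q U V W) \<otimes>\<^bsub>BS H (comp Q)\<^esub> sw Q Q g (ten Q U V W) = ten Q U (?s V) W"
        using sw_ten[OF Q Q bf *] sw_ten[OF Q Q bg *] *(2)
          hom_mult[OF ten_hom[OF Q *(1,3)] bimapD(2)[OF bf *(2)] bimapD(2)[OF bg *(2)]] by simp
    qed
    moreover have "(\<lambda>x \<in> carrier (BS H (comp Q)). sw Q Q f x \<otimes>\<^bsub>BS H (comp Q)\<^esub> sw Q Q g x)
        \<in> Hom_ideal H (hd P) (last R) D' (BS H (comp Q)) (BS H (comp Q))"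
      using add by (intro Hom_ideal.add) auto
    ultimately have "sw Q Q ?s \<in> Hom_ideal H (hd P) (last R) D' (BS H (comp Q)) (BS H (comp Q))"
      by (simp only:)
    with bs show ?case by (rule conjI)
  }
qed

end

theorem proposition3p7:
  fixes H :: "('w, 'v::ab_group_add, 'k::field) realization_data"
    and P Q R :: "'w set list" and p q r pqr :: "'w coset"
  assumes "is_realization H" and "balanced H" and "reflection_faithful H"
    and "demazure_surjective H"
    and "reduced_expr H P" and "expresses H P p"
    and "reduced_expr H Q" and "expresses H Q q"
    and "reduced_expr H R" and "expresses H R r"
    and "composable P Q" and "composable Q R"
    and "reduced_expr H (P \<circ>\<^sub>e Q \<circ>\<^sub>e R)" and "expresses H (P \<circ>\<^sub>e Q \<circ>\<^sub>e R) pqr"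
  shows "{bs_tensor_map H P (Q \<circ>\<^sub>e R) P (Q \<circ>\<^sub>e R) (bs_id H P)
            (bs_tensor_map H Q R Q R f (bs_id H R)) | f. f \<in> End_below H q (BS H Q)}
         \<subseteq> End_below H pqr (BS H (P \<circ>\<^sub>e Q \<circ>\<^sub>e R))"
proof -
  have cox: "coxeter_system H" using assms(1) by (simp add: is_realization_def)
  interpret coxeter_sys H
    using cox by (simp add: coxeter_sys_def coxeter_sys_axioms_def coxeter_system_def)
  have ePQR: "expression H P" "expression H Q" "expression H R"
    using assms(6,8,10) by (simp_all add: expresses_def)
  interpret sandwich H P R
    using expression_nested ePQR by unfold_locales blast+
  have ends: "last P = hd Q" "last Q = hd R" using assms(11,12) by (simp_all add: composable_def)
  have Q: "fits Q" using expression_nested[OF ePQR(2)] ends by (simp add: fits_def)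
  obtain a where q: "q = (a, last P, hd R)"
    using assms(8) ends by (cases q) (auto simp: expresses_def)
  obtain b where pqr: "pqr = (b, hd P, last R)"
    using assms(14) fitsD(10,11)[OF Q] by (cases pqr) (auto simp: expresses_def)
  \<comment> \<open>Comparable cosets have the same end sets, so an expression of a coset below
    \<open>q\<close> composes with \<open>P\<close> and \<open>R\<close>.\<close>
  have lower: "fits M \<and> (\<exists>x \<in> {x. coset_less H x pqr}. expresses H (comp M) x)"
    if "q' \<in> {q'. coset_less H q' q}" and M: "expresses H M q'" for M q'
  proof
    have less: "coset_less H q' q" using that(1) by simp
    then have "snd q' = (last P, hd R)" using q by (simp add: coset_less_def coset_le_def)
    then show "fits M" using M expression_nested[of H M] by (simp add: fits_def expresses_def)
    show "\<exists>x \<in> {x. coset_less H x pqr}. expresses H (comp M) x"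
      using coset_less_comp[OF assms(5,7,8,9) ends assms(13,14) M less] by blast
  qed
  show ?thesis
  proof
    fix h assume "h \<in> {bs_tensor_map H P (Q \<circ>\<^sub>e R) P (Q \<circ>\<^sub>e R) (bs_id H P)
      (bs_tensor_map H Q R Q R f (bs_id H R)) | f. f \<in> End_below H q (BS H Q)}"
    then obtain f where f: "f \<in> End_below H q (BS H Q)" and h: "h = sw Q Q f"
      unfolding sw_def by blast
    have "f \<in> Hom_ideal H (last P) (hd R) {q'. coset_less H q' q} (BS H Q) (BS H Q)"
      using f unfolding End_below_def q by simp
    from sw_ideal[OF Q lower this]
    have "sw Q Q f \<in> Hom_ideal H (hd P) (last R) {x. coset_less H x pqr} (BS H (comp Q)) (BS H (comp Q))"
      by (rule conjunct2)
    then show "h \<in> End_below H pqr (BS H (comp Q))"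
      unfolding End_below_def h pqr by simp
  qed
qed

end
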